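(* $(A,\ell)$-Path Packing on $n$-vertex graphs can be solved in $O(2^{O(k\ell)} n^{6}\log n)$ time; in particular it is fixed-parameter tractable parameterized by $k+\ell$.
   Context: All graphs are finite and simple; the length of a path is its number of edges. For a graph $G=(V,E)$ and $A\subseteq V$, an $A$-path is a path whose first and last vertices belong to $A$ and all of whose other vertices belong to $V\setminus A$; an $(A,\ell)$-path is an $A$-path of length exactly $\ell$. The problem $(A,\ell)$-Path Packing: given $(G,A,k,\ell)$ where $G=(V,E)$ is a graph, $A\subseteq V$, and $k,\ell$ are positive integers, decide whether $G$ contains $k$ pairwise vertex-disjoint $(A,\ell)$-paths. *)

theory Defs
  imports Complex_Main "HOL-Library.Log_Nat"
begin

definition simple_graph :: "'a set \<Rightarrow> 'a set set \<Rightarrow> bool" where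
  "simple_graph V E \<longleftrightarrow> finite V \<and> (\<forall>e\<in>E. e \<subseteq> V \<and> card e = 2)"

definition is_path :: "'a set \<Rightarrow> 'a set set \<Rightarrow> 'a list \<Rightarrow> bool" where
  "is_path V E p \<longleftrightarrow> p \<noteq> [] \<and> distinct p \<and> set p \<subseteq> V \<and>
     (\<forall>i. Suc i < length p \<longrightarrow> {p ! i, p ! Suc i} \<in> E)"

definition path_length :: "'a list \<Rightarrow> nat" where
  "path_length p = length p - 1"

definition A_path :: "'a set \<Rightarrow> 'a set set \<Rightarrow> 'a set \<Rightarrow> 'a list \<Rightarrow> bool" where
  "A_path V E A p \<longleftrightarrow> is_path V E p \<and> hd p \<in> A \<and> last p \<in> A \<and> set (butlast (tl p)) \<subseteq> V - A"

definition A_l_path :: "'a set \<Rightarrow> 'a set set \<Rightarrow> 'a set \<Rightarrow> nat \<Rightarrow> 'a list \<Rightarrow> bool" where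
  "A_l_path V E A l p \<longleftrightarrow> A_path V E A p \<and> path_length p = l"

definition has_path_packing :: "'a set \<Rightarrow> 'a set set \<Rightarrow> 'a set \<Rightarrow> nat \<Rightarrow> nat \<Rightarrow> bool" where
  "has_path_packing V E A k l \<longleftrightarrow>
     (\<exists>Q. finite Q \<and> card Q = k \<and> (\<forall>p\<in>Q. A_l_path V E A l p) \<and>
          pairwise (\<lambda>p q. set p \<inter> set q = {}) Q)"

text \<open>
  The model of computation is a word RAM: a fixed finite program, unit-cost instructions, and words
  of logarithmically many bits. The word length is imposed in \<open>computes_in_time\<close>, not in the step
  function: a run is admissible only if all values occurring in it are polynomially
  bounded in the input and the running time. Operations are those of type \<open>nat\<close>, so subtraction is
  truncated and division by zero yields zero.
\<close>

datatype binop = Plus | Minus | Times | Div | Mod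

fun apply_binop :: "binop \<Rightarrow> nat \<Rightarrow> nat \<Rightarrow> nat" where
  "apply_binop Plus a b = a + b"
| "apply_binop Minus a b = a - b"
| "apply_binop Times a b = a * b"
| "apply_binop Div a b = a div b"
| "apply_binop Mod a b = a mod b"

datatype instr =
    Const nat nat
  | Move nat nat
  | Arith binop nat nat nat
  | Load nat nat
  | Store nat nat
  | Jump nat
  | JumpZero nat nat

type_synonym program = "instr list"

record config =
  pc :: nat
  reg :: "nat \<Rightarrow> nat"
  mem :: "nat \<Rightarrow> nat"

fun exec :: "instr \<Rightarrow> config \<Rightarrow> config" where
  "exec (Const r a) c = c\<lparr>pc := Suc (pc c), reg := (reg c)(r := a)\<rparr>"
| "exec (Move r s) c = c\<lparr>pc := Suc (pc c), reg := (reg c)(r := reg c s)\<rparr>"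
| "exec (Arith f r s t) c =
     c\<lparr>pc := Suc (pc c), reg := (reg c)(r := apply_binop f (reg c s) (reg c t))\<rparr>"
| "exec (Load r s) c = c\<lparr>pc := Suc (pc c), reg := (reg c)(r := mem c (reg c s))\<rparr>"
| "exec (Store r s) c = c\<lparr>pc := Suc (pc c), mem := (mem c)(reg c r := reg c s)\<rparr>"
| "exec (Jump a) c = c\<lparr>pc := a\<rparr>"
| "exec (JumpZero r a) c = c\<lparr>pc := (if reg c r = 0 then a else Suc (pc c))\<rparr>"

definition halted :: "program \<Rightarrow> config \<Rightarrow> bool" where
  "halted P c \<longleftrightarrow> length P \<le> pc c"

definition step :: "program \<Rightarrow> config \<Rightarrow> config" where
  "step P c = (if halted P c then c else exec (P ! pc c) c)"

text \<open>The input occupies the initial segment of the memory, and its length is in register 0.\<close>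

definition init_config :: "nat list \<Rightarrow> config" where
  "init_config xs =
     \<lparr>pc = 0, reg = (\<lambda>r. if r = 0 then length xs else 0),
      mem = (\<lambda>a. if a < length xs then xs ! a else 0)\<rparr>"

definition run :: "program \<Rightarrow> nat list \<Rightarrow> nat \<Rightarrow> config" where
  "run P xs t = (step P ^^ t) (init_config xs)"

definition words_bounded :: "nat \<Rightarrow> config \<Rightarrow> bool" where
  "words_bounded B c \<longleftrightarrow> (\<forall>r. reg c r \<le> B) \<and> (\<forall>a. mem c a \<le> B)"

text \<open>
  Halted configurations are fixed by \<open>step\<close>, so \<open>T x\<close> is an upper bound on the running time on \<open>x\<close>.
  The last conjunct says that words of \<open>d * log 2 (2 + T x + length xs + sum_list xs)\<close> bits suffice
  for the run; \<open>d\<close> does not depend on the input.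
\<close>

definition computes_in_time ::
    "program \<Rightarrow> 'i set \<Rightarrow> ('i \<Rightarrow> nat list) \<Rightarrow> ('i \<Rightarrow> nat) \<Rightarrow> ('i \<Rightarrow> nat) \<Rightarrow> bool" where
  "computes_in_time P I enc F T \<longleftrightarrow>
     (\<exists>d. \<forall>x\<in>I. let xs = enc x in
        halted P (run P xs (T x)) \<and> reg (run P xs (T x)) 0 = F x \<and>
        (\<forall>s\<le>T x. words_bounded ((2 + T x + length xs + sum_list xs) ^ d) (run P xs s)))"

definition decides_in_time ::
    "program \<Rightarrow> 'i set \<Rightarrow> ('i \<Rightarrow> nat list) \<Rightarrow> ('i \<Rightarrow> bool) \<Rightarrow> ('i \<Rightarrow> nat) \<Rightarrow> bool" where
  "decides_in_time P I enc Q T \<longleftrightarrow> computes_in_time P I enc (\<lambda>x. of_bool (Q x)) T"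

definition computable :: "(nat \<Rightarrow> nat) \<Rightarrow> bool" where
  "computable f \<longleftrightarrow> (\<exists>P T. computes_in_time P UNIV (\<lambda>x. [x]) f T)"

text \<open>The input size is measured in bits; the summand 1 is for a delimiter after each number.\<close>

definition bit_size :: "nat list \<Rightarrow> nat" where
  "bit_size xs = (\<Sum>x\<leftarrow>xs. floorlog 2 x + 1)"

definition fixed_parameter_tractable ::
    "'i set \<Rightarrow> ('i \<Rightarrow> nat list) \<Rightarrow> ('i \<Rightarrow> bool) \<Rightarrow> ('i \<Rightarrow> nat) \<Rightarrow> bool" where
  "fixed_parameter_tractable I enc Q \<kappa> \<longleftrightarrow>
     (\<exists>P T f c. computable f \<and> decides_in_time P I enc Q T \<and>
        (\<forall>x\<in>I. T x \<le> f (\<kappa> x) * bit_size (enc x) ^ c))"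

record packing_instance =
  order :: nat
  edges :: "nat set set"
  terminals :: "nat set"
  num_paths :: nat
  len :: nat

definition packing_instances :: "packing_instance set" where
  "packing_instances =
     {x. simple_graph {..<order x} (edges x) \<and> terminals x \<subseteq> {..<order x} \<and>
         0 < num_paths x \<and> 0 < len x}"

definition packing_yes :: "packing_instance \<Rightarrow> bool" where
  "packing_yes x \<longleftrightarrow>
     has_path_packing {..<order x} (edges x) (terminals x) (num_paths x) (len x)"

text \<open>The graph is given by its adjacency matrix, row by row, and \<open>A\<close> by its characteristic vector.\<close>

definition encode_packing :: "packing_instance \<Rightarrow> nat list" where
  "encode_packing x =
     [order x, num_paths x, len x] @
     map (\<lambda>v. of_bool (v \<in> terminals x)) [0..<order x] @
     [of_bool ({u, v} \<in> edges x). u \<leftarrow> [0..<order x], v \<leftarrow> [0..<order x]]"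

end

theory Submission imports Defs begin

text \<open>
  Write \<open>K = k (l + 1)\<close>. A packing is the same as an injective sequence \<open>v\<^sub>0, ..., v\<^bsub>K-1\<^esub>\<close> of vertices that
  satisfies local conditions: membership in \<open>A\<close> at a position and adjacency to the previous vertex
  depend only on the position modulo \<open>l + 1\<close>. The determinant of the Vandermonde matrix with nodes
  \<open>v\<^sub>0, ..., v\<^bsub>K-1\<^esub>\<close> is nonzero iff the sequence is injective, so a packing exists iff the sum of the
  squared determinants over all locally valid sequences is positive. Expanding the two determinants along
  their last rows turns this sum into a dynamic program over a position, a vertex and two
  sets of columns, with \<open>4\<^sup>K\<close> pairs of sets. The sum has \<open>O(n K\<^sup>2)\<close> bits, too many for a word. It is
  therefore computed modulo every \<open>m\<close> up to a bound \<open>M = O(n K\<^sup>2)\<close>: as \<open>lcm(1, ..., 2 J) \<ge> 2\<^sup>J\<close>,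
  a positive number below \<open>2\<^sup>J\<close> is nonzero modulo some \<open>m \<le> 2 J\<close>.
\<close>

text \<open>Distinctness of all \<open>K\<close> vertices is a global condition, and a dynamic
  program remembering the vertices used would have far too many states. The determinant moves that
  memory to its columns: a row depends on a single vertex, so a partial expansion must know which
  columns are taken but never which vertices. Squaring replaces randomness: determinants of
  different sequences carry signs and could cancel in the sum, squares cannot. The price is a second
  column set, \<open>4 ^ K\<close> pairs in place of \<open>2 ^ K\<close> sets. Using all small
  moduli rather than primes avoids both a primality test and any estimate on primes. The time is
  \<open>n ^ 3\<close> times a function of \<open>K\<close>: one factor \<open>n\<close> each for
  the modulus, the vertex of a table entry and its predecessor. Crude estimates such as
  \<open>K \<le> 2 ^ K\<close> turn that function into \<open>2 ^ (9 * K)\<close>, and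
  \<open>K \<le> 2 * k * l\<close> gives \<open>2 ^ (18 * k * l)\<close>; the claimed
  \<open>n ^ 6 * log n\<close> leaves a wide margin. As long words are forbidden, every assertion
  about the program carries, besides its time, a bound \<open>B\<close> on all values that
  occur.\<close>

lemma pair_index_less: "u < m \<Longrightarrow> v < n \<Longrightarrow> u * n + v < m * (n :: nat)"
proof -
  assume "u < m" "v < n"
  then have "u * n + v < Suc u * n" by simp
  also have "\<dots> \<le> m * n" using \<open>u < m\<close> by (intro mult_right_mono) auto
  finally show ?thesis .
qed

section \<open>Hoare logic for the word RAM\<close>

text \<open>Jump targets of a program fragment are relative to its first instruction.\<close>

fun reloc :: "nat \<Rightarrow> instr \<Rightarrow> instr" where
  "reloc d (Jump a) = Jump (d + a)"
| "reloc d (JumpZero r a) = JumpZero r (d + a)"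
| "reloc d (Const r a) = Const r a"
| "reloc d (Move r s) = Move r s"
| "reloc d (Arith f r s t) = Arith f r s t"
| "reloc d (Load r s) = Load r s"
| "reloc d (Store r s) = Store r s"

lemma reloc_reloc [simp]: "reloc d (reloc d' i) = reloc (d + d') i"
  by (cases i) auto

lemma reloc_0 [simp]: "reloc 0 i = i"
  by (cases i) auto

definition placed :: "program \<Rightarrow> nat \<Rightarrow> program \<Rightarrow> bool" where
  "placed p d c \<longleftrightarrow> (\<forall>i<length c. d + i < length p \<and> p ! (d + i) = reloc d (c ! i))"

definition seq :: "program \<Rightarrow> program \<Rightarrow> program" (infixr ";;" 60) where
  "c1 ;; c2 = c1 @ map (reloc (length c1)) c2"

lemma length_seq [simp]: "length (c1 ;; c2) = length c1 + length c2"
  by (simp add: seq_def)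

lemma placed_append: "placed p d (c1 @ c2) \<Longrightarrow> placed p d c1"
  by (auto simp: placed_def nth_append split: if_splits)

lemma placed_seq:
  assumes "placed p d (c1 ;; c2)"
  shows "placed p d c1" "placed p (d + length c1) c2"
proof -
  show "placed p d c1"
    using assms placed_append by (auto simp: seq_def)
  show "placed p (d + length c1) c2"
    unfolding placed_def
  proof (intro allI impI)
    fix i assume "i < length c2"
    with assms have "d + (length c1 + i) < length p \<and>
        p ! (d + (length c1 + i)) = reloc d ((c1 ;; c2) ! (length c1 + i))"
      unfolding placed_def by (metis length_seq nat_add_left_cancel_less)
    then show "d + length c1 + i < length p \<and> p ! (d + length c1 + i) = reloc (d + length c1) (c2 ! i)"
      using \<open>i < length c2\<close> by (simp add: seq_def nth_append add.assoc)
  qed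
qed

lemma placed_self: "placed p 0 p"
  by (simp add: placed_def)

definition reach :: "nat \<Rightarrow> program \<Rightarrow> nat \<Rightarrow> config \<Rightarrow> config \<Rightarrow> bool" where
  "reach B p t c c' \<longleftrightarrow>
     (step p ^^ t) c = c' \<and> (\<forall>s\<le>t. words_bounded B ((step p ^^ s) c))"

lemma reach_0: "words_bounded B c \<Longrightarrow> reach B p 0 c c"
  by (simp add: reach_def)

lemma reach_trans:
  assumes "reach B p t1 c c1" "reach B p t2 c1 c2"
  shows "reach B p (t1 + t2) c c2"
  unfolding reach_def
proof (intro conjI allI impI)
  have *: "(step p ^^ (t1 + s)) c = (step p ^^ s) c1" for s
    using assms(1) by (subst add.commute) (simp add: reach_def funpow_add)
  then show "(step p ^^ (t1 + t2)) c = c2"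
    using assms(2) by (simp add: reach_def)
  fix s assume "s \<le> t1 + t2"
  show "words_bounded B ((step p ^^ s) c)"
  proof (cases "s \<le> t1")
    case True
    then show ?thesis using assms(1) by (simp add: reach_def)
  next
    case False
    then show ?thesis
      using *[of "s - t1"] assms(2) \<open>s \<le> t1 + t2\<close> by (simp add: reach_def)
  qed
qed

lemma reach_bounded: "reach B p t c c' \<Longrightarrow> words_bounded B c'"
  unfolding reach_def by blast

lemma reach_step:
  assumes "placed p d c" "i < length c" "pc s = d + i" "words_bounded B s"
    and "words_bounded B (exec (reloc d (c ! i)) s)"
  shows "reach B p 1 s (exec (reloc d (c ! i)) s)"
proof -
  have "pc s < length p" "p ! pc s = reloc d (c ! i)"
    using assms(1-3) by (auto simp: placed_def)
  then have "step p s = exec (reloc d (c ! i)) s"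
    by (simp add: step_def halted_def)
  then show ?thesis
    using assms by (auto simp: reach_def le_Suc_eq)
qed

type_synonym assn = "(nat \<Rightarrow> nat) \<Rightarrow> (nat \<Rightarrow> nat) \<Rightarrow> bool"

text \<open>Quantifying over every host program \<open>p\<close> and offset \<open>d\<close> frees a
  triple from the place where the fragment ends up, so triples compose without further relocation.
  The word bound is part of \<open>reach\<close> and hence holds at all intermediate configurations,
  not only at the end.\<close>

definition hoare :: "nat \<Rightarrow> program \<Rightarrow> assn \<Rightarrow> nat \<Rightarrow> assn \<Rightarrow> bool" where
  "hoare B c P T Q \<longleftrightarrow>
     (\<forall>p d s. placed p d c \<and> pc s = d \<and> words_bounded B s \<and> P (reg s) (mem s) \<longrightarrow>
        (\<exists>t s'. t \<le> T \<and> reach B p t s s' \<and> pc s' = d + length c \<and> Q (reg s') (mem s')))"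

lemma hoareD:
  assumes "hoare B c P T Q" "placed p d c" "pc s = d" "words_bounded B s" "P (reg s) (mem s)"
  obtains t s' where "t \<le> T" "reach B p t s s'" "pc s' = d + length c" "Q (reg s') (mem s')"
  using assms unfolding hoare_def by metis

lemma hoare_conseq:
  assumes "hoare B c P T Q"
    and "\<And>r m. P' r m \<Longrightarrow> P r m" "\<And>r m. Q r m \<Longrightarrow> Q' r m" "T \<le> T'"
  shows "hoare B c P' T' Q'"
  unfolding hoare_def
proof (intro allI impI, elim conjE)
  fix p d s assume *: "placed p d c" "pc s = d" "words_bounded B s" "P' (reg s) (mem s)"
  obtain t s' where "t \<le> T" "reach B p t s s'" "pc s' = d + length c" "Q (reg s') (mem s')"
    using hoareD[OF assms(1) *(1-3) assms(2)[OF *(4)]] .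
  then show "\<exists>t s'. t \<le> T' \<and> reach B p t s s' \<and> pc s' = d + length c \<and> Q' (reg s') (mem s')"
    using assms(3,4) by (intro exI[of _ t] exI[of _ s']) auto
qed

text \<open>Freezes the initial state as constants \<open>R\<close> and \<open>M\<close>, to which
  values and bounds may then refer, and turns the word bound of the initial configuration into
  usable hypotheses.\<close>

lemma hoare_pre_bounded:
  assumes "\<And>R M. P R M \<Longrightarrow> (\<forall>i. R i \<le> B) \<Longrightarrow> (\<forall>i. M i \<le> B) \<Longrightarrow>
      hoare B c (\<lambda>r m. r = R \<and> m = M) T Q"
  shows "hoare B c P T Q"
  unfolding hoare_def
proof (intro allI impI, elim conjE)
  fix p d s
  assume *: "placed p d c" "pc s = d" "words_bounded B s" "P (reg s) (mem s)"
  then have "hoare B c (\<lambda>r m. r = reg s \<and> m = mem s) T Q"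
    by (intro assms) (auto simp: words_bounded_def)
  then show "\<exists>t s'. t \<le> T \<and> reach B p t s s' \<and> pc s' = d + length c \<and> Q (reg s') (mem s')"
    using * unfolding hoare_def by blast
qed

lemma hoare_seq:
  assumes "hoare B c1 P T1 Q" "hoare B c2 Q T2 S"
  shows "hoare B (c1 ;; c2) P (T1 + T2) S"
  unfolding hoare_def
proof (intro allI impI, elim conjE)
  fix p d s
  assume pl: "placed p d (c1 ;; c2)" and s: "pc s = d" "words_bounded B s" "P (reg s) (mem s)"
  obtain t1 s1 where 1: "t1 \<le> T1" "reach B p t1 s s1" "pc s1 = d + length c1" "Q (reg s1) (mem s1)"
    using hoareD[OF assms(1) placed_seq(1)[OF pl] s] .
  obtain t2 s2 where 2: "t2 \<le> T2" "reach B p t2 s1 s2" "pc s2 = d + length c1 + length c2"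
      "S (reg s2) (mem s2)"
    using hoareD[OF assms(2) placed_seq(2)[OF pl] 1(3) reach_bounded[OF 1(2)] 1(4)] .
  show "\<exists>t s'. t \<le> T1 + T2 \<and> reach B p t s s' \<and> pc s' = d + length (c1 ;; c2) \<and> S (reg s') (mem s')"
    using 1 2 reach_trans[OF 1(2) 2(2)] by (intro exI[of _ "t1 + t2"] exI[of _ s2]) auto
qed

lemma hoare_Const:
  assumes "a \<le> B" "\<And>r m. P r m \<Longrightarrow> Q (r(x := a)) m"
  shows "hoare B [Const x a] P 1 Q"
  unfolding hoare_def
proof (intro allI impI, elim conjE)
  fix p d s assume *: "placed p d [Const x a]" "pc s = d" "words_bounded B s" "P (reg s) (mem s)"
  show "\<exists>t s'. t \<le> 1 \<and> reach B p t s s' \<and> pc s' = d + length [Const x a] \<and> Q (reg s') (mem s')"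
    using reach_step[OF *(1), of 0 s B] * assms
    by (intro exI[of _ 1] exI[of _ "exec (Const x a) s"]) (auto simp: words_bounded_def)
qed

lemma hoare_Move:
  assumes "\<And>r m. P r m \<Longrightarrow> Q (r(x := r y)) m"
  shows "hoare B [Move x y] P 1 Q"
  unfolding hoare_def
proof (intro allI impI, elim conjE)
  fix p d s assume *: "placed p d [Move x y]" "pc s = d" "words_bounded B s" "P (reg s) (mem s)"
  show "\<exists>t s'. t \<le> 1 \<and> reach B p t s s' \<and> pc s' = d + length [Move x y] \<and> Q (reg s') (mem s')"
    using reach_step[OF *(1), of 0 s B] * assms
    by (intro exI[of _ 1] exI[of _ "exec (Move x y) s"]) (auto simp: words_bounded_def)
qed

lemma hoare_Arith:
  assumes "\<And>r m. P r m \<Longrightarrow> \<forall>i. r i \<le> B \<Longrightarrow>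
      apply_binop f (r y) (r z) \<le> B \<and> Q (r(x := apply_binop f (r y) (r z))) m"
  shows "hoare B [Arith f x y z] P 1 Q"
  unfolding hoare_def
proof (intro allI impI, elim conjE)
  fix p d s assume *: "placed p d [Arith f x y z]" "pc s = d" "words_bounded B s" "P (reg s) (mem s)"
  show "\<exists>t s'. t \<le> 1 \<and> reach B p t s s' \<and> pc s' = d + length [Arith f x y z] \<and> Q (reg s') (mem s')"
    using reach_step[OF *(1), of 0 s B] * assms[of "reg s" "mem s"]
    by (intro exI[of _ 1] exI[of _ "exec (Arith f x y z) s"]) (auto simp: words_bounded_def)
qed

lemma hoare_Load:
  assumes "\<And>r m. P r m \<Longrightarrow> Q (r(x := m (r y))) m"
  shows "hoare B [Load x y] P 1 Q"
  unfolding hoare_def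
proof (intro allI impI, elim conjE)
  fix p d s assume *: "placed p d [Load x y]" "pc s = d" "words_bounded B s" "P (reg s) (mem s)"
  show "\<exists>t s'. t \<le> 1 \<and> reach B p t s s' \<and> pc s' = d + length [Load x y] \<and> Q (reg s') (mem s')"
    using reach_step[OF *(1), of 0 s B] * assms
    by (intro exI[of _ 1] exI[of _ "exec (Load x y) s"]) (auto simp: words_bounded_def)
qed

lemma hoare_Store:
  assumes "\<And>r m. P r m \<Longrightarrow> Q r (m(r x := r y))"
  shows "hoare B [Store x y] P 1 Q"
  unfolding hoare_def
proof (intro allI impI, elim conjE)
  fix p d s assume *: "placed p d [Store x y]" "pc s = d" "words_bounded B s" "P (reg s) (mem s)"
  show "\<exists>t s'. t \<le> 1 \<and> reach B p t s s' \<and> pc s' = d + length [Store x y] \<and> Q (reg s') (mem s')"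
    using reach_step[OF *(1), of 0 s B] * assms
    by (intro exI[of _ 1] exI[of _ "exec (Store x y) s"]) (auto simp: words_bounded_def)
qed

text \<open>Truncated subtraction makes \<open>y - x\<close> vanish exactly when \<open>x\<close>
  has reached \<open>y\<close>. The tail is attached by \<open>@\<close> and not by
  \<open>;;\<close>, because its \<open>Jump 0\<close> must lead back to the start of the whole
  loop; only the body is relocated, by \<open>2\<close>.\<close>

definition count_loop :: "nat \<Rightarrow> nat \<Rightarrow> nat \<Rightarrow> program \<Rightarrow> program" where
  "count_loop x y z c =
     ([Arith Minus z y x, JumpZero z (length c + 5)] ;; c) @
     [Const z 1, Arith Plus x x z, Jump 0]"

lemma length_count_loop [simp]: "length (count_loop x y z c) = length c + 5"
  by (simp add: count_loop_def)

lemma count_loop_nth: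
  "count_loop x y z c ! 0 = Arith Minus z y x"
  "count_loop x y z c ! 1 = JumpZero z (length c + 5)"
  "count_loop x y z c ! (length c + 2) = Const z 1"
  "count_loop x y z c ! (length c + 3) = Arith Plus x x z"
  "count_loop x y z c ! (length c + 4) = Jump 0"
  by (simp_all add: count_loop_def seq_def nth_append)

text \<open>Of the overhead \<open>5\<close> per round, two steps are the test and three the
  increment with the jump back; the final \<open>2\<close> is the test that leaves the loop. The
  frame condition keeps the invariant independent of the counter and the scratch register.\<close>

lemma hoare_count_loop:
  assumes body: "\<And>i. i < n \<Longrightarrow> hoare B c (\<lambda>r m. I i r m \<and> r x = i \<and> r y = n) T
                                 (\<lambda>r m. I (Suc i) r m \<and> r x = i \<and> r y = n)"
    and frame: "\<And>i r m a b. I i r m \<Longrightarrow> I i (r(x := a, z := b)) m"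
    and ne: "x \<noteq> y" "x \<noteq> z" "y \<noteq> z" and B: "1 \<le> B"
  shows "hoare B (count_loop x y z c) (\<lambda>r m. I 0 r m \<and> r x = 0 \<and> r y = n)
           (n * (T + 5) + 2) (\<lambda>r m. I n r m)"
  unfolding hoare_def
proof (intro allI impI, elim conjE)
  fix p d s0
  let ?c = "count_loop x y z c"
  assume pl: "placed p d ?c" and s0: "pc s0 = d" "words_bounded B s0" "I 0 (reg s0) (mem s0)"
      "reg s0 x = 0" "reg s0 y = n"
  have plc: "placed p (d + 2) c"
    using placed_seq(2)[OF placed_append[OF pl[unfolded count_loop_def]]] by simp
  have frame_z: "I i (r(z := b)) m" if "I i r m" for i r m b
    using frame[OF that, of "r x" b] by simp
  have test: "reach B p 2 s (if reg s y - reg s x = 0 then s1\<lparr>pc := d + (length c + 5)\<rparr> else s1)"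
    if s: "pc s = d" "words_bounded B s"
      and s1: "s1 = s\<lparr>pc := d + 2, reg := (reg s)(z := reg s y - reg s x)\<rparr>" for s s1
  proof -
    let ?s = "s\<lparr>pc := d + 1, reg := (reg s)(z := reg s y - reg s x)\<rparr>"
    have "reg s y - reg s x \<le> B" using s(2) by (meson diff_le_self le_trans words_bounded_def)
    then have b: "words_bounded B ?s" using s by (auto simp: words_bounded_def)
    have "reach B p 1 s ?s"
      using reach_step[OF pl, of 0 s B] s b by (simp add: count_loop_nth)
    moreover have "reach B p 1 ?s
        (if reg s y - reg s x = 0 then s1\<lparr>pc := d + (length c + 5)\<rparr> else s1)"
    proof -
      have "exec (JumpZero z (d + (length c + 5))) ?s =
          (if reg s y - reg s x = 0 then s1\<lparr>pc := d + (length c + 5)\<rparr> else s1)"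
        by (intro config.equality) (auto simp: s1)
      moreover have "words_bounded B (exec (JumpZero z (d + (length c + 5))) ?s)"
        using b by (simp add: words_bounded_def)
      ultimately show ?thesis
        using reach_step[OF pl, of 1 ?s B] b by (simp add: count_loop_nth[simplified] del: exec.simps)
    qed
    ultimately show ?thesis
      using reach_trans[of B p 1 s ?s 1] unfolding one_add_one by blast
  qed
  have loop: "\<exists>t s. t \<le> i * (T + 5) \<and> reach B p t s0 s \<and> pc s = d \<and>
      I i (reg s) (mem s) \<and> reg s x = i \<and> reg s y = n" if "i \<le> n" for i
    using that
  proof (induction i)
    case 0
    then show ?case using s0 reach_0 by (intro exI[of _ 0] exI[of _ s0]) auto
  next
    case (Suc i)
    then obtain t s where ts: "t \<le> i * (T + 5)" "reach B p t s0 s" "pc s = d"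
      "I i (reg s) (mem s)" "reg s x = i" "reg s y = n" by auto
    note bs = reach_bounded[OF ts(2)]
    define s1 where "s1 = s\<lparr>pc := d + 2, reg := (reg s)(z := reg s y - reg s x)\<rparr>"
    have r1: "reach B p 2 s s1"
      using test[OF ts(3) bs s1_def] ts Suc.prems by simp
    have I1: "I i (reg s1) (mem s1) \<and> reg s1 x = i \<and> reg s1 y = n"
      using ts ne frame_z by (simp add: s1_def)
    have "i < n" using Suc.prems by simp
    obtain t2 s2 where s2: "t2 \<le> T" "reach B p t2 s1 s2" "pc s2 = d + 2 + length c"
      "I (Suc i) (reg s2) (mem s2)" "reg s2 x = i" "reg s2 y = n"
    proof -
      have "pc s1 = d + 2" by (simp add: s1_def)
      from hoareD[OF body[OF \<open>i < n\<close>] plc this reach_bounded[OF r1] I1] that show ?thesis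
        by metis
    qed
    note b2 = reach_bounded[OF s2(2)]
    define s3 where "s3 = s2\<lparr>pc := d + (length c + 3), reg := (reg s2)(z := 1)\<rparr>"
    have b3: "words_bounded B s3" using b2 B by (simp add: s3_def words_bounded_def)
    have e3: "exec (reloc d (?c ! (length c + 2))) s2 = s3"
      unfolding count_loop_nth s3_def using s2(3,5) ne by (intro config.equality) auto
    have r3: "reach B p 1 s2 s3"
      using reach_step[OF pl, of "length c + 2" s2 B, unfolded e3] s2(3) b2 b3
      by simp
    define s4 where "s4 = s3\<lparr>pc := d + (length c + 4), reg := (reg s3)(x := Suc i)\<rparr>"
    \<comment> \<open>The bound \<open>n\<close> sits in a register, so it is itself a legal word;
      hence so is the incremented counter, which is at most \<open>n\<close>.\<close>
    have "n \<le> B" using b2 s2(6) unfolding words_bounded_def by metis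
    then have b4: "words_bounded B s4" using b3 \<open>i < n\<close> by (simp add: s4_def words_bounded_def)
    have e4: "exec (reloc d (?c ! (length c + 3))) s3 = s4"
      unfolding count_loop_nth s3_def s4_def using s2(3,5) ne by (intro config.equality) auto
    have r4: "reach B p 1 s3 s4"
      using reach_step[OF pl, of "length c + 3" s3 B, unfolded e4] s2(3) b3 b4
      by (simp add: s3_def)
    define s5 where "s5 = s4\<lparr>pc := d\<rparr>"
    have b5: "words_bounded B s5" using b4 by (simp add: s5_def words_bounded_def)
    have e5: "exec (reloc d (?c ! (length c + 4))) s4 = s5"
      unfolding count_loop_nth s3_def s4_def s5_def using s2(3,5) ne by (intro config.equality) auto
    have r5: "reach B p 1 s4 s5"
      using reach_step[OF pl, of "length c + 4" s4 B, unfolded e5] s2(3) b4 b5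
      by (simp add: s3_def s4_def)
    have "reach B p (t + (2 + (t2 + (1 + (1 + 1))))) s0 s5"
      by (intro reach_trans[OF ts(2)] reach_trans[OF r1] reach_trans[OF s2(2)] reach_trans[OF r3]
          reach_trans[OF r4] r5)
    moreover have "reg s5 = (reg s2)(x := Suc i, z := 1)" "mem s5 = mem s2"
      using ne by (simp_all add: s5_def s4_def s3_def fun_upd_twist)
    then have "I (Suc i) (reg s5) (mem s5)"
      using frame[OF s2(4), of "Suc i" 1] by simp
    moreover have "pc s5 = d" "reg s5 x = Suc i" "reg s5 y = n"
      using s2(6) ne by (simp_all add: s5_def s4_def s3_def)
    moreover have "t + (2 + (t2 + (1 + (1 + 1)))) \<le> Suc i * (T + 5)"
      using ts(1) s2(1) by simp
    ultimately show ?case by blast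
  qed
  obtain t s where ts: "t \<le> n * (T + 5)" "reach B p t s0 s" "pc s = d"
      "I n (reg s) (mem s)" "reg s x = n" "reg s y = n" using loop[of n] by auto
  define s1 where "s1 = s\<lparr>pc := d + 2, reg := (reg s)(z := reg s y - reg s x)\<rparr>"
  have "reach B p 2 s (s1\<lparr>pc := d + (length c + 5)\<rparr>)"
    using test[OF ts(3) reach_bounded[OF ts(2)] s1_def] ts by simp
  then have "reach B p (t + 2) s0 (s1\<lparr>pc := d + (length c + 5)\<rparr>)"
    using ts(2) reach_trans by blast
  moreover have "I n (reg s1) (mem s1)"
    using frame_z ts by (simp add: s1_def)
  ultimately show "\<exists>t s'. t \<le> n * (T + 5) + 2 \<and> reach B p t s0 s' \<and> pc s' = d + length ?c \<and>
      I n (reg s') (mem s')"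
    using ts by (intro exI[of _ "t + 2"] exI[of _ "s1\<lparr>pc := d + (length c + 5)\<rparr>"]) auto
qed

section \<open>Expressions and their compilation\<close>

datatype exp = Num nat | Var nat | Bin binop exp exp | Ld exp | Fold exp exp exp

text \<open>
  An expression compiled at level \<open>t\<close> leaves its value in register \<open>t\<close> and preserves the registers
  below. In \<open>Fold e0 e1 e\<close> the body \<open>e\<close> finds the accumulator (initially \<open>e0\<close>) in register \<open>t\<close> and
  the iteration index (below \<open>e1\<close>) in register \<open>t + 1\<close>.
\<close>

fun comp :: "exp \<Rightarrow> nat \<Rightarrow> program" where
  "comp (Num a) t = [Const t a]"
| "comp (Var r) t = [Move t r]"
| "comp (Bin f a b) t = comp a t ;; comp b (t + 1) ;; [Arith f t t (t + 1)]"
| "comp (Ld e) t = comp e t ;; [Load t t]"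
| "comp (Fold e0 e1 e) t =
     comp e0 t ;; [Const (t + 1) 0] ;; comp e1 (t + 2) ;;
     count_loop (t + 1) (t + 2) (t + 3) (comp e (t + 3) ;; [Move t (t + 3)])"

text \<open>The precondition fixes only the registers below \<open>t\<close>, so those from
  \<open>t\<close> on may hold remnants of earlier computations. Including \<open>v \<le> B\<close>
  spares the operations that cannot exceed their first operand (\<open>Minus\<close>,
  \<open>Div\<close>, \<open>Mod\<close>) a bound of their own.\<close>

definition evals :: "nat \<Rightarrow> nat \<Rightarrow> exp \<Rightarrow> (nat \<Rightarrow> nat) \<Rightarrow> (nat \<Rightarrow> nat) \<Rightarrow> nat \<Rightarrow> nat \<Rightarrow> bool" where
  "evals B t e R M v T \<longleftrightarrow> v \<le> B \<and>
     hoare B (comp e t) (\<lambda>r m. (\<forall>i<t. r i = R i) \<and> m = M) T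
       (\<lambda>r m. (\<forall>i<t. r i = R i) \<and> m = M \<and> r t = v)"

lemma evals_conv: "evals B t e R M v' T' \<Longrightarrow> v' = v \<Longrightarrow> T' \<le> T \<Longrightarrow> evals B t e R M v T"
  unfolding evals_def by (auto elim: hoare_conseq)

lemma evals_le: "evals B t e R M v T \<Longrightarrow> v \<le> B"
  by (simp add: evals_def)

lemma evals_Num: "a \<le> B \<Longrightarrow> evals B t (Num a) R M a 1"
  unfolding evals_def comp.simps by (intro conjI hoare_Const) auto

lemma evals_Var: "r < t \<Longrightarrow> R r \<le> B \<Longrightarrow> evals B t (Var r) R M (R r) 1"
  unfolding evals_def comp.simps by (intro conjI hoare_Move) auto

lemma evals_Ld:
  assumes "evals B t e R M v T" "M v \<le> B"
  shows "evals B t (Ld e) R M (M v) (T + 1)"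
proof -
  have "hoare B [Load t t] (\<lambda>r m. (\<forall>i<t. r i = R i) \<and> m = M \<and> r t = v) 1
      (\<lambda>r m. (\<forall>i<t. r i = R i) \<and> m = M \<and> r t = M v)"
    by (intro hoare_Load) auto
  then show ?thesis
    using assms hoare_seq unfolding evals_def comp.simps by blast
qed

lemma evals_Bin:
  assumes "evals B t a R M v1 T1" "evals B (t + 1) b (R(t := v1)) M v2 T2" "apply_binop f v1 v2 \<le> B"
  shows "evals B t (Bin f a b) R M (apply_binop f v1 v2) (T1 + T2 + 1)"
proof -
  have "hoare B (comp b (t + 1)) (\<lambda>r m. (\<forall>i<t. r i = R i) \<and> m = M \<and> r t = v1) T2
      (\<lambda>r m. (\<forall>i<t. r i = R i) \<and> m = M \<and> r t = v1 \<and> r (t + 1) = v2)"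
    using assms(2) unfolding evals_def
    by (auto elim!: hoare_conseq simp: less_Suc_eq)
  moreover have "hoare B [Arith f t t (t + 1)]
      (\<lambda>r m. (\<forall>i<t. r i = R i) \<and> m = M \<and> r t = v1 \<and> r (t + 1) = v2) 1
      (\<lambda>r m. (\<forall>i<t. r i = R i) \<and> m = M \<and> r t = apply_binop f v1 v2)"
    using assms(3) by (intro hoare_Arith) auto
  ultimately show ?thesis
    using assms(1,3) unfolding evals_def comp.simps add.assoc by (blast intro: hoare_seq)
qed

text \<open>Registers \<open>t\<close>, \<open>t + 1\<close>, \<open>t + 2\<close> hold accumulator,
  index and bound, so the body starts at \<open>t + 3\<close>, which is also the scratch register of
  the loop. A round costs the body, one move back into the accumulator and the loop overhead
  \<open>5\<close>.\<close>

lemma evals_Fold: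
  assumes "evals B t e0 R M (g 0) T0"
    and "evals B (t + 2) e1 (R(t := g 0, t + 1 := 0)) M n T1"
    and "\<And>i. i < n \<Longrightarrow> evals B (t + 3) e (R(t := g i, t + 1 := i, t + 2 := n)) M (g (Suc i)) T"
    and "1 \<le> B"
  shows "evals B t (Fold e0 e1 e) R M (g n) (T0 + T1 + n * (T + 6) + 3)"
proof -
  let ?I = "\<lambda>i r m. (\<forall>j<t. r j = R j) \<and> m = M \<and> r t = g i"
  have gn: "g n \<le> B"
    using assms by (cases n) (auto dest: evals_le)
  have 1: "hoare B [Const (t + 1) 0] (\<lambda>r m. (\<forall>i<t. r i = R i) \<and> m = M \<and> r t = g 0) 1
      (\<lambda>r m. (\<forall>i<t+2. r i = (R(t := g 0, t + 1 := 0)) i) \<and> m = M)"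
    by (intro hoare_Const) (auto simp: less_Suc_eq)
  have 2: "hoare B (comp e1 (t + 2)) (\<lambda>r m. (\<forall>i<t+2. r i = (R(t := g 0, t + 1 := 0)) i) \<and> m = M) T1
      (\<lambda>r m. ?I 0 r m \<and> r (t + 1) = 0 \<and> r (t + 2) = n)"
    using assms(2) unfolding evals_def by (auto elim!: hoare_conseq)
  have 3: "hoare B (count_loop (t + 1) (t + 2) (t + 3) (comp e (t + 3) ;; [Move t (t + 3)]))
      (\<lambda>r m. ?I 0 r m \<and> r (t + 1) = 0 \<and> r (t + 2) = n) (n * ((T + 1) + 5) + 2) (\<lambda>r m. ?I n r m)"
  proof (rule hoare_count_loop)
    fix i assume "i < n"
    have "hoare B (comp e (t + 3)) (\<lambda>r m. ?I i r m \<and> r (t + 1) = i \<and> r (t + 2) = n) T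
       (\<lambda>r m. (\<forall>j<t. r j = R j) \<and> m = M \<and> r (t + 1) = i \<and> r (t + 2) = n \<and> r (t + 3) = g (Suc i))"
      using assms(3)[OF \<open>i < n\<close>] unfolding evals_def
      by (auto elim!: hoare_conseq simp: less_Suc_eq numeral_3_eq_3)
    then show "hoare B (comp e (t + 3) ;; [Move t (t + 3)])
        (\<lambda>r m. ?I i r m \<and> r (t + 1) = i \<and> r (t + 2) = n) (T + 1)
        (\<lambda>r m. ?I (Suc i) r m \<and> r (t + 1) = i \<and> r (t + 2) = n)"
      by (rule hoare_seq, intro hoare_Move) auto
  qed (use assms(4) in auto)
  have "hoare B (comp (Fold e0 e1 e) t) (\<lambda>r m. (\<forall>i<t. r i = R i) \<and> m = M)
      (T0 + (1 + (T1 + (n * ((T + 1) + 5) + 2)))) (\<lambda>r m. ?I n r m)"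
    unfolding comp.simps
    using assms(1)[unfolded evals_def, THEN conjunct2] by (rule hoare_seq[OF _ hoare_seq[OF 1 hoare_seq[OF 2 3]]])
  then show ?thesis
    using gn unfolding evals_def by (auto elim!: hoare_conseq)
qed

lemma evals_Plus:
  assumes "evals B t a R M v1 T1" "evals B (t + 1) b (R(t := v1)) M v2 T2" "v1 + v2 \<le> B"
  shows "evals B t (Bin Plus a b) R M (v1 + v2) (T1 + T2 + 1)"
  using evals_Bin[OF assms(1,2), of Plus] assms(3) by simp

lemma evals_Times:
  assumes "evals B t a R M v1 T1" "evals B (t + 1) b (R(t := v1)) M v2 T2" "v1 * v2 \<le> B"
  shows "evals B t (Bin Times a b) R M (v1 * v2) (T1 + T2 + 1)"
  using evals_Bin[OF assms(1,2), of Times] assms(3) by simp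

lemma evals_Minus:
  assumes "evals B t a R M v1 T1" "evals B (t + 1) b (R(t := v1)) M v2 T2"
  shows "evals B t (Bin Minus a b) R M (v1 - v2) (T1 + T2 + 1)"
  using evals_Bin[OF assms(1,2), of Minus] evals_le[OF assms(1)] by simp

lemma evals_Div:
  assumes "evals B t a R M v1 T1" "evals B (t + 1) b (R(t := v1)) M v2 T2"
  shows "evals B t (Bin Div a b) R M (v1 div v2) (T1 + T2 + 1)"
  using evals_Bin[OF assms(1,2), of Div] evals_le[OF assms(1)] by (simp add: div_le_dividend le_trans[OF div_le_dividend])

lemma evals_Mod:
  assumes "evals B t a R M v1 T1" "evals B (t + 1) b (R(t := v1)) M v2 T2"
  shows "evals B t (Bin Mod a b) R M (v1 mod v2) (T1 + T2 + 1)"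
  using evals_Bin[OF assms(1,2), of Mod] evals_le[OF assms(1)]
  by (simp add: le_trans[OF mod_less_eq_dividend])

lemmas evals_intros = evals_Num evals_Var evals_Plus evals_Times evals_Minus evals_Div evals_Mod evals_Ld

section \<open>Squared Vandermonde determinants\<close>

text \<open>The position of column \<open>a\<close> within \<open>S\<close>, which determines the
  sign in a Laplace expansion. The further sign depending on the number of rows is dropped: it is
  the same for any two minors with equally many rows, and minors are only ever used in products of
  two with the same rows.\<close>

definition rank :: "nat set \<Rightarrow> nat \<Rightarrow> nat" where
  "rank S a = card {x \<in> S. x < a}"

text \<open>The Vandermonde minor with rows \<open>rev ws\<close> and columns \<open>S\<close>, by Laplace expansion along the last row.\<close>

fun minor :: "nat list \<Rightarrow> nat set \<Rightarrow> int" where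
  "minor [] S = of_bool (S = {})"
| "minor (w # ws) S = (\<Sum>a\<in>S. (-1) ^ rank S a * int w ^ a * minor ws (S - {a}))"

lemma rank_remove:
  assumes "finite S" "a \<in> S" "b \<in> S" "a \<noteq> b"
  shows "rank (S - {a}) b = (if a < b then rank S b - 1 else rank S b)"
    and "a < b \<Longrightarrow> rank S b > 0"
proof -
  have eq: "{x \<in> S - {a}. x < b} = {x \<in> S. x < b} - {a}" by auto
  have "card ({x \<in> S. x < b} - {a}) = (if a < b then card {x \<in> S. x < b} - 1 else card {x \<in> S. x < b})"
    using assms by (auto simp: card_Diff_singleton_if)
  then show "rank (S - {a}) b = (if a < b then rank S b - 1 else rank S b)"
    unfolding rank_def eq .
  assume "a < b"
  then show "rank S b > 0" using assms unfolding rank_def by (auto simp: card_gt_0_iff)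
qed

text \<open>Deleting the smaller of two columns lowers the position of the larger by one, whereas
  deleting the larger leaves the position of the smaller alone. The two orders of deletion therefore
  differ by exactly one sign.\<close>

lemma sign_antisym:
  assumes "finite S" "a \<in> S" "b \<in> S" "a \<noteq> b"
  shows "(-1::int) ^ (rank S a + rank (S - {a}) b) = - ((-1) ^ (rank S b + rank (S - {b}) a))"
proof -
  have *: "(-1::int) ^ (rank S a + rank (S - {a}) b) = - ((-1) ^ (rank S b + rank (S - {b}) a))"
    if ab: "a \<in> S" "b \<in> S" "a < b" for a b
  proof -
    obtain k where k: "rank S b = Suc k"
      using rank_remove(2)[OF assms(1) ab(1,2) _ ab(3)] ab(3) by (cases "rank S b") auto
    have "rank (S - {a}) b = k" "rank (S - {b}) a = rank S a"
      using rank_remove(1)[of S a b] rank_remove(1)[of S b a] assms(1) ab k by auto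
    then show ?thesis by (simp add: k add.commute)
  qed
  show ?thesis
  proof (cases "a < b")
    case True
    then show ?thesis using *[OF assms(2,3)] by simp
  next
    case False
    then show ?thesis using *[OF assms(3,2)] assms(4) by simp
  qed
qed

text \<open>Expanding two rows gives a sum over ordered pairs of distinct columns. Exchanging the
  members of each pair exchanges the two rows and, by \<open>sign_antisym\<close>, negates every
  summand.\<close>

lemma minor_swap_head:
  assumes "finite S"
  shows "minor (u # w # ws) S = - minor (w # u # ws) S"
proof -
  let ?g = "\<lambda>u w a b. (-1) ^ (rank S a + rank (S - {a}) b) * int u ^ a * int w ^ b * minor ws (S - {a} - {b})"
  have expand: "minor (u # w # ws) S = (\<Sum>(a, b)\<in>(SIGMA a:S. S - {a}). ?g u w a b)" for u w
    using assms by (simp add: sum_distrib_left sum.Sigma power_add mult_ac)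
  have "minor (u # w # ws) S = (\<Sum>(b, a)\<in>(SIGMA a:S. S - {a}). ?g u w a b)"
    unfolding expand
    by (rule sum.reindex_bij_witness[of _ "\<lambda>(a, b). (b, a)" "\<lambda>(a, b). (b, a)"]) auto
  also have "\<dots> = (\<Sum>(b, a)\<in>(SIGMA a:S. S - {a}). - ?g w u b a)"
  proof (rule sum.cong[OF refl])
    fix p assume "p \<in> (SIGMA a:S. S - {a})"
    then obtain a b where p: "p = (b, a)" "b \<in> S" "a \<in> S" "a \<noteq> b" by auto
    then have "S - {a} - {b} = S - {b} - {a}" by auto
    then show "(case p of (b, a) \<Rightarrow> ?g u w a b) = (case p of (b, a) \<Rightarrow> - ?g w u b a)"
      using sign_antisym[OF assms, of a b] p by simp
  qed
  also have "\<dots> = - minor (w # u # ws) S"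
    unfolding expand by (simp add: sum_negf case_prod_unfold)
  finally show ?thesis .
qed

lemma minor_swap:
  "finite S \<Longrightarrow> minor (xs @ u # w # ws) S = - minor (xs @ w # u # ws) S"
proof (induction xs arbitrary: S)
  case Nil
  show ?case unfolding append_Nil by (rule minor_swap_head[OF Nil])
next
  case (Cons x xs)
  have "minor (xs @ u # w # ws) (S - {a}) = - minor (xs @ w # u # ws) (S - {a})" for a
    using Cons.prems by (intro Cons.IH) simp
  then show ?case by (simp only: append_Cons minor.simps mult_minus_right sum_negf)
qed

text \<open>Induction on the distance of the equal rows: adjacent swaps bring them together, and
  when they are neighbours the minor equals its own negative.\<close>

lemma minor_repeat:
  "finite S \<Longrightarrow> minor (xs @ u # ys @ u # zs) S = 0"
proof (induction ys arbitrary: xs)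
  case Nil
  then show ?case using minor_swap[of S xs u u zs] by simp
next
  case (Cons y ys)
  then show ?case using minor_swap[of S xs u y "ys @ u # zs"] Cons.IH[of "xs @ [y]"] by simp
qed

lemma minor_not_distinct: "finite S \<Longrightarrow> \<not> distinct ws \<Longrightarrow> minor ws S = 0"
  using not_distinct_decomp[of ws] minor_repeat by force

lemma rank_lessThan: "a < n \<Longrightarrow> rank {..<n} a = a"
proof -
  assume "a < n"
  then have "{x \<in> {..<n}. x < a} = {..<a}" by auto
  then show ?thesis by (simp add: rank_def)
qed

text \<open>As a function of its last row \<open>w\<close> the determinant is a polynomial of degree \<open>length ws\<close>
  whose leading coefficient is a smaller Vandermonde determinant and whose roots are the other rows.\<close>

lemma minor_distinct: "distinct ws \<Longrightarrow> minor ws {..<length ws} \<noteq> 0"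
proof (induction ws)
  case Nil
  then show ?case by simp
next
  case (Cons w ws)
  let ?n = "length ws"
  define c where "c a = real_of_int ((-1) ^ a * minor ws ({..<Suc ?n} - {a}))" for a
  have poly: "(\<Sum>a\<le>?n. c a * real v ^ a) = real_of_int (minor (v # ws) {..<Suc ?n})" for v
    unfolding c_def lessThan_Suc_atMost[symmetric]
    by (simp add: rank_lessThan mult_ac del: sum.lessThan_Suc)
  have "{..<Suc ?n} - {?n} = {..<?n}" by auto
  then have "c ?n \<noteq> 0" using Cons by (simp add: c_def)
  note roots = polyfun_rootbound[of c, OF this le_refl]
  show ?case
  proof
    assume *: "minor (w # ws) {..<length (w # ws)} = 0"
    have "minor (v # ws) {..<Suc ?n} = 0" if "v \<in> set (w # ws)" for v
    proof (cases "v = w")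
      case True
      then show ?thesis using * by (metis length_Cons)
    next
      case False
      then have "\<not> distinct (v # ws)" using that by auto
      then show ?thesis by (intro minor_not_distinct) auto
    qed
    then have "(\<Sum>a\<le>?n. c a * real v ^ a) = 0" if "v \<in> set (w # ws)" for v
      unfolding poly using that by simp
    then have "real ` set (w # ws) \<subseteq> {z. (\<Sum>a\<le>?n. c a * z ^ a) = 0}" by blast
    then have "card (real ` set (w # ws)) \<le> ?n"
      using roots by (meson card_mono le_trans)
    moreover have "card (real ` set (w # ws)) = Suc ?n"
      using Cons.prems by (subst card_image) (auto simp: distinct_card)
    ultimately show False by simp
  qed
qed

text \<open>Only the bit length matters later, so it suffices that each row contributes at most
  \<open>K\<close> columns and an entry of at most \<open>N ^ K\<close>.\<close>

lemma minor_bound: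
  assumes "\<forall>w\<in>set ws. w < N" "S \<subseteq> {..<K}"
  shows "\<bar>minor ws S\<bar> \<le> (int K * int N ^ K) ^ length ws"
  using assms
proof (induction ws arbitrary: S)
  case Nil
  then show ?case by simp
next
  case (Cons w ws)
  have "\<bar>minor (w # ws) S\<bar> \<le> (\<Sum>a\<in>S. \<bar>(-1) ^ rank S a * int w ^ a * minor ws (S - {a})\<bar>)"
    by simp
  also have "\<dots> \<le> (\<Sum>a\<in>S. int N ^ K * (int K * int N ^ K) ^ length ws)"
  proof (rule sum_mono)
    fix a assume "a \<in> S"
    then have "a \<le> K" using Cons.prems by auto
    have "int w ^ a \<le> int N ^ a" using Cons.prems by (intro power_mono) auto
    also have "\<dots> \<le> int N ^ K" using Cons.prems \<open>a \<le> K\<close> by (intro power_increasing) auto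
    finally have "int w ^ a \<le> int N ^ K" .
    moreover have "\<bar>minor ws (S - {a})\<bar> \<le> (int K * int N ^ K) ^ length ws"
      using Cons.prems by (intro Cons.IH) auto
    ultimately show "\<bar>(-1) ^ rank S a * int w ^ a * minor ws (S - {a})\<bar>
        \<le> int N ^ K * (int K * int N ^ K) ^ length ws"
      by (simp add: abs_mult power_abs mult_mono)
  qed
  also have "\<dots> = int (card S) * (int N ^ K * (int K * int N ^ K) ^ length ws)"
    by simp
  also have "\<dots> \<le> int K * (int N ^ K * (int K * int N ^ K) ^ length ws)"
    using card_mono[OF _ Cons.prems(2)] by (intro mult_right_mono) auto
  finally show ?case by (simp add: mult_ac)
qed

section \<open>Small moduli\<close>

text \<open>Nair's bound: the reciprocals of \<open>m * (n choose m)\<close> form Leibniz's harmonic triangle.\<close>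

lemma leibniz_triangle_dvd:
  fixes L :: nat
  assumes "m < n" "Suc m * (Suc n choose Suc m) dvd L" "Suc m * (n choose Suc m) dvd L"
  shows "Suc (Suc m) * (Suc n choose Suc (Suc m)) dvd L"
proof -
  define u v where "u = n choose m" and "v = n choose Suc m"
  obtain x y where xy: "L = Suc m * (Suc n choose Suc m) * x" "L = Suc m * v * y"
    using assms(2,3) unfolding v_def dvd_def by blast
  have a: "Suc m * (Suc n choose Suc m) = Suc n * u"
    and c: "Suc (Suc m) * (Suc n choose Suc (Suc m)) = Suc n * v"
    using Suc_times_binomial_eq[of n m] Suc_times_binomial_eq[of n "Suc m"]
    by (simp_all only: u_def v_def mult.commute)
  have uv: "Suc m * v = (n - m) * u"
    unfolding u_def v_def using binomial_absorption[of m n] binomial_absorb_comp[of n m] by simp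
  have "u > 0" "v > 0" using assms(1) by (simp_all add: u_def v_def)
  have x: "L = Suc n * u * x" using xy(1) unfolding a .
  \<comment> \<open>The triangle rule reads
    \<open>1 / (Suc n * u) + 1 / (Suc n * v) = 1 / (Suc m * v)\<close>. Multiplied by
    \<open>L\<close> it says that \<open>L / (Suc n * v)\<close> is the integer
    \<open>y - x\<close>. The following lines derive this without fractions by cancelling first
    \<open>u\<close> and then \<open>Suc m\<close>.\<close>
  have "Suc m * L + Suc n * v * Suc m * x = Suc n * L"
  proof -
    have "u * (Suc m * L + Suc n * v * Suc m * x) = Suc m * u * L + Suc n * u * x * (Suc m * v)"
      by (simp only: algebra_simps)
    also have "\<dots> = L * u * (Suc m + (n - m))"
      unfolding uv x[symmetric] by (simp only: algebra_simps)
    also have "Suc m + (n - m) = Suc n" using assms(1) by simp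
    finally have "u * (Suc m * L + Suc n * v * Suc m * x) = u * (Suc n * L)" by (simp only: mult_ac)
    then show ?thesis using \<open>u > 0\<close> by simp
  qed
  then have "Suc m * L + Suc m * (Suc n * v * x) = Suc m * (Suc n * v * y)"
    using xy(2) by (simp only: mult_ac)
  then have "Suc m * (L + Suc n * v * x) = Suc m * (Suc n * v * y)"
    by (simp only: distrib_left)
  then have "L + Suc n * v * x = Suc n * v * y"
    by (simp only: mult_cancel1) simp
  then have "Suc n * v dvd L"
    by (metis dvd_add_left_iff dvd_triv_left)
  then show ?thesis unfolding c .
qed

text \<open>An entry of the triangle is obtained from the preceding column in the same row and in
  the row above, down to the first column, whose entries are the numbers \<open>1, ..., n\<close>
  themselves. The auxiliary claim is for an arbitrary common multiple \<open>L\<close>, since the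
  row shrinks in the induction while \<open>L\<close> must stay fixed.\<close>

lemma mult_binomial_dvd_Lcm:
  "0 < m \<Longrightarrow> m \<le> n \<Longrightarrow> m * (n choose m) dvd Lcm {1..n}"
proof -
  have *: "m < n \<Longrightarrow> (\<forall>x\<in>{1..n}. x dvd L) \<Longrightarrow> Suc m * (n choose Suc m) dvd L" for L m n :: nat
  proof (induction m arbitrary: n)
    case 0
    then show ?case by auto
  next
    case (Suc m)
    obtain n' where n: "n = Suc n'" using Suc.prems by (cases n) auto
    have *: "\<forall>x\<in>{1..n'}. x dvd L" using Suc.prems n by auto
    show ?case
      unfolding n
    proof (rule leibniz_triangle_dvd)
      show "m < n'" using Suc.prems n by simp
      show "Suc m * (Suc n' choose Suc m) dvd L" using Suc.IH[of n] Suc.prems n by simp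
      show "Suc m * (n' choose Suc m) dvd L" using Suc.IH[OF \<open>m < n'\<close> *] .
    qed
  qed
  assume "0 < m" "m \<le> n"
  then show ?thesis using *[of "m - 1" n "Lcm {1..n}"] by (auto intro: dvd_Lcm)
qed

text \<open>The size comes from the central binomial coefficient, which is at least
  \<open>((2 * n) / n) ^ n\<close>.\<close>

lemma power_le_Lcm: "2 ^ n \<le> Lcm {1..2 * n :: nat}"
proof (cases "n = 0")
  case False
  have "2 ^ n \<le> (2 * n) choose n"
  proof -
    have "(real (2 * n) / real n) ^ n \<le> real (2 * n choose n)"
      by (intro binomial_ge_n_over_k_pow_k) auto
    then have "real (2 ^ n) \<le> real (2 * n choose n)" using False by simp
    then show ?thesis by linarith
  qed
  also have "\<dots> \<le> n * (2 * n choose n)" using False by simp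
  also have "\<dots> \<le> Lcm {1..2 * n}"
    using False by (intro dvd_imp_le mult_binomial_dvd_Lcm) (auto intro!: Nat.gr0I)
  finally show ?thesis .
qed simp

lemma ex_not_dvd:
  assumes "0 < x" "x < (2::nat) ^ J"
  shows "\<exists>m\<in>{1..2 * J}. \<not> m dvd x"
proof (rule ccontr)
  assume "\<not> ?thesis"
  then have "Lcm {1..2 * J} dvd x" by (auto intro: Lcm_least)
  then have "2 ^ J \<le> x" using power_le_Lcm[of J] assms(1) by (meson dvd_imp_le order_trans)
  then show False using assms(2) by simp
qed


section \<open>Summing over walks\<close>

text \<open>The empty walk ends in a dummy vertex \<open>0\<close>; the conditions at position \<open>0\<close> do not depend on it.\<close>

definition last_vertex :: "nat list \<Rightarrow> nat" where
  "last_vertex ws = (case ws of [] \<Rightarrow> 0 | w # _ \<Rightarrow> w)"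

text \<open>The newest vertex comes first, so that the head of the list is the row along which
  \<open>minor\<close> expands.\<close>

primrec walks :: "(nat \<Rightarrow> nat \<Rightarrow> nat \<Rightarrow> bool) \<Rightarrow> nat \<Rightarrow> nat \<Rightarrow> nat list set" where
  "walks ok N 0 = {[]}"
| "walks ok N (Suc i) = {w # ws | w ws. ws \<in> walks ok N i \<and> w < N \<and> ok i (last_vertex ws) w}"

text \<open>\<open>S\<close> and \<open>T\<close> are the columns occupied by the rows chosen so far
  in the two copies of the determinant. The base case puts the empty walk at the dummy vertex
  \<open>0\<close>.\<close>

primrec dp :: "(nat \<Rightarrow> nat \<Rightarrow> nat \<Rightarrow> bool) \<Rightarrow> nat \<Rightarrow> nat \<Rightarrow> nat \<Rightarrow> nat set \<Rightarrow> nat set \<Rightarrow> int" where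
  "dp ok N 0 w S T = of_bool (w = 0 \<and> S = {} \<and> T = {})"
| "dp ok N (Suc i) w S T = (\<Sum>v<N. of_bool (ok i v w) *
     (\<Sum>a\<in>S. \<Sum>b\<in>T. (-1) ^ (rank S a + rank T b) * int w ^ (a + b) * dp ok N i v (S - {a}) (T - {b})))"

lemma walks_lists: "ws \<in> walks ok N i \<Longrightarrow> set ws \<subseteq> {..<N} \<and> length ws = i"
proof (induction i arbitrary: ws)
  case (Suc i)
  then show ?case by fastforce
qed simp

lemma walks_subset: "walks ok N i \<subseteq> {ws. set ws \<subseteq> {..<N} \<and> length ws = i}"
  using walks_lists by blast

lemma finite_walks: "finite (walks ok N i)"
  by (rule finite_subset[OF walks_subset finite_lists_length_eq]) simp

lemma card_walks: "card (walks ok N i) \<le> N ^ i"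
  using card_mono[OF finite_lists_length_eq[OF finite_lessThan] walks_subset] by (simp add: card_lists_length_eq)

lemma last_vertex_less: "ws \<in> walks ok N i \<Longrightarrow> 0 < N \<Longrightarrow> last_vertex ws < N"
  using walks_lists[of ws ok N i] by (auto simp: last_vertex_def split: list.splits)

text \<open>Both minors of \<open>w # ws\<close> expand along the row \<open>w\<close>. The
  condition for appending \<open>w\<close> sees only the last vertex of \<open>ws\<close>, so the
  shorter walks are grouped by that vertex; then the sums over walks and columns are
  exchanged.\<close>

lemma dp_eq_sum_minors:
  "w < N \<Longrightarrow> dp ok N i w S T =
     (\<Sum>ws\<in>{ws \<in> walks ok N i. last_vertex ws = w}. minor ws S * minor ws T)"
proof (induction i arbitrary: w S T)
  case 0
  then have "{ws \<in> walks ok N 0. last_vertex ws = w} = (if w = 0 then {[]} else {})"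
    by (auto simp: last_vertex_def)
  then show ?case by (auto simp: of_bool_def)
next
  case (Suc i)
  have eq: "{ws \<in> walks ok N (Suc i). last_vertex ws = w} =
      (#) w ` {ws \<in> walks ok N i. ok i (last_vertex ws) w}"
    using Suc.prems by (auto simp: last_vertex_def)
  let ?g = "\<lambda>ws. minor (w # ws) S * minor (w # ws) T"
  have "(\<Sum>ws\<in>{ws \<in> walks ok N (Suc i). last_vertex ws = w}. minor ws S * minor ws T)
      = (\<Sum>ws\<in>{ws \<in> walks ok N i. ok i (last_vertex ws) w}. ?g ws)"
    unfolding eq by (subst sum.reindex) (auto simp: comp_def)
  also have "\<dots> = (\<Sum>ws\<in>walks ok N i. of_bool (ok i (last_vertex ws) w) * ?g ws)"
    by (simp add: of_bool_def if_distrib[of "\<lambda>x. x * _"] sum.inter_filter finite_walks cong: if_cong)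
  also have "\<dots> = (\<Sum>v<N. \<Sum>ws\<in>{ws \<in> walks ok N i. last_vertex ws = v}.
      of_bool (ok i (last_vertex ws) w) * ?g ws)"
    using Suc.prems last_vertex_less[of _ ok N i]
    by (intro sum.group[symmetric] finite_walks) auto
  also have "\<dots> = (\<Sum>v<N. of_bool (ok i v w) * (\<Sum>ws\<in>{ws \<in> walks ok N i. last_vertex ws = v}. ?g ws))"
    by (intro sum.cong refl) (simp add: sum_distrib_left)
  also have "\<dots> = dp ok N (Suc i) w S T"
    unfolding dp.simps
  proof (intro sum.cong refl arg_cong2[of _ _ _ _ "(*)"])
    fix v assume "v \<in> {..<N}"
    let ?W = "{ws \<in> walks ok N i. last_vertex ws = v}"
    have "(\<Sum>a\<in>S. \<Sum>b\<in>T. (-1) ^ (rank S a + rank T b) * int w ^ (a + b) * dp ok N i v (S - {a}) (T - {b}))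
      = (\<Sum>a\<in>S. \<Sum>b\<in>T. \<Sum>ws\<in>?W. ((-1) ^ rank S a * int w ^ a * minor ws (S - {a})) *
          ((-1) ^ rank T b * int w ^ b * minor ws (T - {b})))"
      using \<open>v \<in> {..<N}\<close> by (simp add: Suc.IH sum_distrib_left power_add mult_ac)
    also have "\<dots> = (\<Sum>a\<in>S. \<Sum>ws\<in>?W. \<Sum>b\<in>T. ((-1) ^ rank S a * int w ^ a * minor ws (S - {a})) *
          ((-1) ^ rank T b * int w ^ b * minor ws (T - {b})))"
      by (intro sum.cong refl sum.swap)
    also have "\<dots> = (\<Sum>ws\<in>?W. \<Sum>a\<in>S. \<Sum>b\<in>T. ((-1) ^ rank S a * int w ^ a * minor ws (S - {a})) *
          ((-1) ^ rank T b * int w ^ b * minor ws (T - {b})))"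
      by (rule sum.swap)
    also have "\<dots> = (\<Sum>ws\<in>?W. ?g ws)"
      by (simp add: sum_product)
    finally show "(\<Sum>ws\<in>?W. ?g ws) = (\<Sum>a\<in>S. \<Sum>b\<in>T. (-1) ^ (rank S a + rank T b) *
        int w ^ (a + b) * dp ok N i v (S - {a}) (T - {b}))" by simp
  qed
  finally show ?case by simp
qed

definition dp_total :: "(nat \<Rightarrow> nat \<Rightarrow> nat \<Rightarrow> bool) \<Rightarrow> nat \<Rightarrow> nat \<Rightarrow> int" where
  "dp_total ok N K = (\<Sum>w<N. dp ok N K w {..<K} {..<K})"

lemma dp_total_eq:
  assumes "0 < N"
  shows "dp_total ok N K = (\<Sum>ws\<in>walks ok N K. (minor ws {..<K})\<^sup>2)"
proof -
  have "dp_total ok N K = (\<Sum>w<N. \<Sum>ws\<in>{ws \<in> walks ok N K. last_vertex ws = w}. (minor ws {..<K})\<^sup>2)"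
    unfolding dp_total_def by (intro sum.cong refl) (simp add: dp_eq_sum_minors power2_eq_square)
  also have "\<dots> = (\<Sum>ws\<in>walks ok N K. (minor ws {..<K})\<^sup>2)"
    using assms last_vertex_less[of _ ok N K] by (intro sum.group finite_walks) auto
  finally show ?thesis .
qed

lemma dp_total_nonneg: "0 \<le> dp_total ok N K"
  by (cases "N = 0") (simp_all add: dp_total_eq sum_nonneg, simp add: dp_total_def)

lemma dp_total_pos_iff:
  assumes "0 < N"
  shows "0 < dp_total ok N K \<longleftrightarrow> (\<exists>ws\<in>walks ok N K. distinct ws)"
proof -
  have "dp_total ok N K = 0 \<longleftrightarrow> (\<forall>ws\<in>walks ok N K. minor ws {..<K} = 0)"
    unfolding dp_total_eq[OF assms] by (subst sum_nonneg_eq_0_iff) (auto simp: finite_walks)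
  also have "\<dots> \<longleftrightarrow> (\<forall>ws\<in>walks ok N K. \<not> distinct ws)"
    using minor_distinct minor_not_distinct[of "{..<K}"] walks_lists by blast
  finally show ?thesis
    using dp_total_nonneg[of ok N K] by auto
qed

text \<open>The exponent collects \<open>N * K\<close> from the number of walks, and
  \<open>2 * K * K\<close> and \<open>2 * N * K * K\<close> from the squared bound on a minor. For
  positive \<open>N\<close> and \<open>K\<close> each product is at most \<open>N * K * K\<close>,
  whence the coefficient \<open>5\<close>; the additional \<open>1\<close> makes the inequality
  strict.\<close>

lemma dp_total_bound:
  assumes "0 < N" "0 < K"
  shows "dp_total ok N K < 2 ^ (5 * N * K * K + 1)"
proof -
  have "dp_total ok N K \<le> (\<Sum>ws\<in>walks ok N K. ((int K * int N ^ K) ^ K)\<^sup>2)"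
    unfolding dp_total_eq[OF assms(1)]
  proof (rule sum_mono)
    fix ws assume "ws \<in> walks ok N K"
    then have "\<bar>minor ws {..<K}\<bar> \<le> (int K * int N ^ K) ^ K"
      using minor_bound[of ws N "{..<K}" K] walks_lists[of ws ok N K] by auto
    then have "\<bar>minor ws {..<K}\<bar>\<^sup>2 \<le> ((int K * int N ^ K) ^ K)\<^sup>2"
      by (intro power_mono) auto
    then show "(minor ws {..<K})\<^sup>2 \<le> ((int K * int N ^ K) ^ K)\<^sup>2" by simp
  qed
  also have "\<dots> = int (card (walks ok N K)) * ((int K * int N ^ K) ^ K)\<^sup>2"
    by simp
  also have "\<dots> \<le> int (N ^ K) * ((int K * int N ^ K) ^ K)\<^sup>2"
    using card_walks[of ok N K] by (intro mult_right_mono) (auto simp flip: of_nat_power)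
  \<comment> \<open>Replacing \<open>N\<close> by \<open>2 ^ N\<close> wastes a factor in the
    exponent, but makes it a polynomial in \<open>N\<close> and \<open>K\<close>: the program can
    compute the number of moduli without a logarithm.\<close>
  also have "\<dots> \<le> int ((2 ^ N) ^ K) * ((int (2 ^ K) * int (2 ^ N) ^ K) ^ K)\<^sup>2"
    by (intro mult_mono power_mono) (auto simp: less_imp_le[OF less_exp] simp flip: of_nat_power of_nat_mult
        intro!: power_mono mult_mono)
  also have "\<dots> = 2 ^ (N * K + 2 * (K * (K + N * K)))"
    by (simp add: mult_ac flip: power_mult power_add)
  also have "\<dots> < 2 ^ (5 * N * K * K + 1)"
  proof -
    have "N * K \<le> N * K * K" "K * K \<le> N * K * K" using assms by simp_all
    moreover have "N * K + 2 * (K * (K + N * K)) = N * K + 2 * (K * K) + 2 * (N * K * K)"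
      by (simp add: algebra_simps)
    moreover have "5 * N * K * K = 5 * (N * K * K)" by simp
    ultimately have "N * K + 2 * (K * (K + N * K)) \<le> 5 * N * K * K" by linarith
    then show ?thesis by (intro power_strict_increasing) auto
  qed
  finally show ?thesis .
qed

text \<open>The largest modulus \<open>10 * N * K * K + 2\<close> is \<open>2 * J\<close> for the
  exponent \<open>J\<close> in \<open>dp_total_bound\<close>.\<close>

lemma dp_total_mod:
  assumes "0 < N" "0 < K"
  shows "(\<exists>m\<in>{1..10 * N * K * K + 2}. dp_total ok N K mod int m \<noteq> 0) \<longleftrightarrow> (\<exists>ws\<in>walks ok N K. distinct ws)"
proof
  assume "\<exists>m\<in>{1..10 * N * K * K + 2}. dp_total ok N K mod int m \<noteq> 0"
  then have "dp_total ok N K \<noteq> 0" by auto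
  then show "\<exists>ws\<in>walks ok N K. distinct ws"
    using dp_total_pos_iff[OF assms(1)] dp_total_nonneg[of ok N K] by fastforce
next
  assume "\<exists>ws\<in>walks ok N K. distinct ws"
  then have pos: "0 < dp_total ok N K" using dp_total_pos_iff[OF assms(1)] by simp
  have "nat (dp_total ok N K) < 2 ^ (5 * N * K * K + 1)"
    using dp_total_bound[OF assms, of ok] pos by (simp add: nat_less_iff)
  then obtain m where "m \<in> {1..2 * (5 * N * K * K + 1)}" "\<not> m dvd nat (dp_total ok N K)"
    using ex_not_dvd pos by (metis zero_less_nat_eq)
  then show "\<exists>m\<in>{1..10 * N * K * K + 2}. dp_total ok N K mod int m \<noteq> 0"
    using pos by (intro bexI[of _ m]) (auto simp: int_dvd_int_iff[symmetric] dvd_eq_mod_eq_0 simp del: int_dvd_int_iff)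
qed

section \<open>Packings as walks\<close>

text \<open>The residue of \<open>i\<close> is the place within the current path, with
  \<open>0\<close> and \<open>l\<close> as its ends. At residue \<open>0\<close> a new path begins
  and the previous vertex \<open>v\<close> is ignored, which also makes the dummy predecessor
  harmless.\<close>

definition slot_ok :: "nat set set \<Rightarrow> nat set \<Rightarrow> nat \<Rightarrow> nat \<Rightarrow> nat \<Rightarrow> nat \<Rightarrow> bool" where
  "slot_ok E A l i v w \<longleftrightarrow>
     ((i mod Suc l = 0 \<or> i mod Suc l = l) \<longleftrightarrow> w \<in> A) \<and> (i mod Suc l = 0 \<or> {v, w} \<in> E)"

lemma walks_iff_nth:
  "ws \<in> walks ok N i \<longleftrightarrow> length ws = i \<and> set ws \<subseteq> {..<N} \<and>
     (\<forall>j<i. ok j (if j = 0 then 0 else rev ws ! (j - 1)) (rev ws ! j))"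
proof (induction i arbitrary: ws)
  case 0
  then show ?case by auto
next
  case (Suc i)
  show ?case
  proof (cases ws)
    case Nil
    then show ?thesis by simp
  next
    case (Cons w us)
    show ?thesis
    proof (cases "length us = i")
      case False
      then show ?thesis using Cons walks_lists[of us ok N i] by auto
    next
      case True
      have lv: "last_vertex us = (if i = 0 then 0 else rev us ! (i - 1))"
        using True by (cases us) (auto simp: last_vertex_def nth_append)
      have nth: "rev ws ! i = w" "\<And>j. j < i \<Longrightarrow> rev ws ! j = rev us ! j"
        using True Cons by (simp_all add: nth_append)
      have "(\<forall>j<Suc i. ok j (if j = 0 then 0 else rev ws ! (j - 1)) (rev ws ! j)) \<longleftrightarrow>
          ok i (last_vertex us) w \<and> (\<forall>j<i. ok j (if j = 0 then 0 else rev us ! (j - 1)) (rev us ! j))"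
        unfolding less_Suc_eq lv using nth by (cases "i = 0") auto
      moreover have "ws \<in> walks ok N (Suc i) \<longleftrightarrow> us \<in> walks ok N i \<and> w < N \<and> ok i (last_vertex us) w"
        using Cons by auto
      moreover have "set ws \<subseteq> {..<N} \<longleftrightarrow> w < N \<and> set us \<subseteq> {..<N}" "length ws = Suc i"
        using Cons True by auto
      ultimately show ?thesis using Suc.IH[of us] True by blast
    qed
  qed
qed

text \<open>Brings the conditions on ends and interior into one equivalence per position, the form
  tested by \<open>slot_ok\<close>.\<close>

lemma A_l_path_iff_nth:
  assumes "0 < l"
  shows "A_l_path V E A l p \<longleftrightarrow> length p = Suc l \<and> distinct p \<and> set p \<subseteq> V \<and>
     (\<forall>r<l. {p ! r, p ! Suc r} \<in> E) \<and> (\<forall>r\<le>l. (r = 0 \<or> r = l) \<longleftrightarrow> p ! r \<in> A)"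
proof -
  have *: "A_l_path V E A l p \<longleftrightarrow> length p = Suc l \<and> distinct p \<and> set p \<subseteq> V \<and>
     (\<forall>r<l. {p ! r, p ! Suc r} \<in> E) \<and> p ! 0 \<in> A \<and> p ! l \<in> A \<and> set (butlast (tl p)) \<subseteq> V - A"
  proof (cases "p \<noteq> [] \<and> length p = Suc l")
    case True
    then have "hd p = p ! 0" "last p = p ! l" by (simp_all add: hd_conv_nth last_conv_nth)
    then show ?thesis
      using True unfolding A_l_path_def A_path_def is_path_def path_length_def by auto
  next
    case False
    then show ?thesis
      using assms unfolding A_l_path_def A_path_def is_path_def path_length_def by auto
  qed
  have inner: "set (butlast (tl p)) \<subseteq> V - A \<longleftrightarrow> (\<forall>r. 0 < r \<and> r < l \<longrightarrow> p ! r \<notin> A)"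
    if "length p = Suc l" "set p \<subseteq> V"
  proof -
    have "set (butlast (tl p)) = {p ! Suc r | r. r < l - 1}"
      unfolding set_conv_nth using that(1) by (intro Collect_cong ex_cong1) (auto simp: nth_butlast nth_tl)
    also have "\<dots> = {p ! r | r. 0 < r \<and> r < l}"
    proof -
      have "\<exists>q. p ! r = p ! Suc q \<and> q < l - 1" if "0 < r" "r < l" for r
        using that by (intro exI[of _ "r - 1"]) auto
      moreover have "\<exists>q. p ! Suc r = p ! q \<and> 0 < q \<and> q < l" if "r < l - 1" for r
        using that by (intro exI[of _ "Suc r"]) auto
      ultimately show ?thesis by blast
    qed
    finally show ?thesis using that(2) nth_mem[of _ p] that(1) by (auto simp: subset_iff)
  qed
  have ends: "p ! 0 \<in> A \<and> p ! l \<in> A \<and> (\<forall>r. 0 < r \<and> r < l \<longrightarrow> p ! r \<notin> A) \<longleftrightarrow>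
      (\<forall>r\<le>l. (r = 0 \<or> r = l) \<longleftrightarrow> p ! r \<in> A)" (is "?L \<longleftrightarrow> ?R")
  proof
    assume ?L
    then show ?R by (metis le_neq_implies_less neq0_conv)
  next
    assume ?R
    then show ?L by (metis le0 le_refl less_imp_le less_irrefl)
  qed
  show ?thesis
  proof (cases "length p = Suc l \<and> set p \<subseteq> V")
    case True
    show ?thesis
      unfolding * ends[symmetric] inner[OF conjunct1[OF True] conjunct2[OF True]]
      by (simp only: conj_assoc)
  next
    case False
    then show ?thesis unfolding * by argo
  qed
qed

text \<open>Paths are concatenated in arbitrary order, and conversely a walk is cut into blocks of
  length \<open>Suc l\<close>. Injectivity of the whole sequence expresses at once that each path is
  simple and that different paths are disjoint.\<close>

lemma packing_iff_walk:
  assumes "0 < l"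
  shows "has_path_packing {..<N} E A k l \<longleftrightarrow>
     (\<exists>ws\<in>walks (slot_ok E A l) N (k * Suc l). distinct ws)"
proof
  let ?L = "Suc l"
  assume "has_path_packing {..<N} E A k l"
  then obtain Q where Q: "finite Q" "card Q = k" "\<And>p. p \<in> Q \<Longrightarrow> A_l_path {..<N} E A l p"
    "pairwise (\<lambda>p q. set p \<inter> set q = {}) Q" unfolding has_path_packing_def by auto
  obtain qs where qs: "set qs = Q" "distinct qs" using finite_distinct_list[OF Q(1)] by auto
  have len: "length qs = k" using qs Q(2) distinct_card by fastforce
  define x where "x i = qs ! (i div ?L) ! (i mod ?L)" for i
  define xs where "xs = map x [0..<k * ?L]"
  have path: "A_l_path {..<N} E A l (qs ! (i div ?L))" if "i < k * ?L" for i
  proof -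
    have "i div ?L < length qs" using that len by (simp add: less_mult_imp_div_less del: mult_Suc_right)
    then show ?thesis using Q(3) qs(1) nth_mem by blast
  qed
  note path' = path[unfolded A_l_path_iff_nth[OF assms]]
  have in_set: "x i \<in> set (qs ! (i div ?L))" if "i < k * ?L" for i
    using path'[OF that] unfolding x_def by (intro nth_mem) simp
  have "inj_on x {0..<k * ?L}"
  proof (rule inj_onI, rule ccontr)
    fix i j assume ij: "i \<in> {0..<k * ?L}" "j \<in> {0..<k * ?L}" "x i = x j" "i \<noteq> j"
    show False
    proof (cases "i div ?L = j div ?L")
      case True
      then have "i mod ?L \<noteq> j mod ?L" using ij(4) by (metis div_mod_decomp)
      then show False
        using ij path'[of i] True nth_eq_iff_index_eq[of "qs ! (i div ?L)" "i mod ?L" "j mod ?L"]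
        by (auto simp: x_def)
    next
      case False
      then have "qs ! (i div ?L) \<noteq> qs ! (j div ?L)"
        using ij len qs(2) by (simp add: nth_eq_iff_index_eq less_mult_imp_div_less)
      moreover have "qs ! (i div ?L) \<in> Q" "qs ! (j div ?L) \<in> Q"
        using ij len qs(1) by (auto simp: less_mult_imp_div_less)
      ultimately have "set (qs ! (i div ?L)) \<inter> set (qs ! (j div ?L)) = {}"
        using Q(4) by (meson pairwiseD)
      then show False using in_set[of i] in_set[of j] ij by auto
    qed
  qed
  then have "distinct (rev xs)" unfolding xs_def by (simp add: distinct_map)
  moreover have "rev xs \<in> walks (slot_ok E A l) N (k * ?L)"
    unfolding walks_iff_nth
  proof (intro conjI allI impI)
    show "set (rev xs) \<subseteq> {..<N}"
      using in_set path' unfolding xs_def by fastforce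
    fix i assume i: "i < k * ?L"
    \<comment> \<open>The predecessor is prescribed only inside a block. This treats position
      \<open>0\<close>, where it is the dummy, like every other start of a path.\<close>
    have "slot_ok E A l i v (x i)" if v: "i mod ?L \<noteq> 0 \<Longrightarrow> v = x (i - 1)" for v
    proof -
      have m: "i mod ?L \<le> l" by (simp add: less_Suc_eq_le[symmetric])
      have "{v, x i} \<in> E" if nz: "i mod ?L \<noteq> 0"
      proof -
        obtain r where r: "i mod ?L = Suc r" using nz by (cases "i mod ?L") auto
        have "i = i div ?L * ?L + Suc r" using r by (metis div_mod_decomp)
        then have "i - 1 = i div ?L * ?L + r" by simp
        moreover have "r < ?L" using m r by simp
        ultimately have "(i - 1) div ?L = i div ?L" "(i - 1) mod ?L = r"
          by (simp_all del: mult_Suc_right)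
        then show ?thesis
          using v[OF nz] path'[OF i] r m unfolding x_def by auto
      qed
      then show ?thesis
        using path'[OF i] m unfolding slot_ok_def x_def by auto
    qed
    then show "slot_ok E A l i (if i = 0 then 0 else rev (rev xs) ! (i - 1)) (rev (rev xs) ! i)"
    proof -
      assume *: "\<And>v. (i mod ?L \<noteq> 0 \<Longrightarrow> v = x (i - 1)) \<Longrightarrow> slot_ok E A l i v (x i)"
      have "slot_ok E A l i (if i = 0 then 0 else x (i - 1)) (x i)"
        by (rule *) (cases "i = 0", auto)
      moreover have "rev (rev xs) ! j = x j" if "j < k * ?L" for j
        using that by (simp add: xs_def del: upt_Suc mult_Suc_right)
      ultimately show ?thesis using i by (cases "i = 0") simp_all
    qed
  qed (simp add: xs_def)
  ultimately show "\<exists>ws\<in>walks (slot_ok E A l) N (k * ?L). distinct ws" by blast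
next
  let ?L = "Suc l"
  assume "\<exists>ws\<in>walks (slot_ok E A l) N (k * ?L). distinct ws"
  then obtain ws where ws: "ws \<in> walks (slot_ok E A l) N (k * ?L)" "distinct ws" by auto
  define x where "x = (!) (rev ws)"
  have len: "length ws = k * ?L" and sub: "set ws \<subseteq> {..<N}"
    and ok: "\<And>i. i < k * ?L \<Longrightarrow> slot_ok E A l i (if i = 0 then 0 else x (i - 1)) (x i)"
    using ws(1) unfolding walks_iff_nth x_def by auto
  have inj: "i = j" if "i < k * ?L" "j < k * ?L" "x i = x j" for i j
    using that ws(2) len unfolding x_def by (subst (asm) nth_eq_iff_index_eq) auto
  have xN: "x i < N" if "i < k * ?L" for i
    using nth_mem[of i "rev ws"] that sub len unfolding x_def by auto
  define p where "p j = map (\<lambda>r. x (j * ?L + r)) [0..<?L]" for j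
  note idx = pair_index_less[of _ k _ ?L]
  have eqD: "j = j' \<and> r = r'" if "x (j * ?L + r) = x (j' * ?L + r')" "j < k" "j' < k" "r < ?L" "r' < ?L" for j j' r r'
  proof -
    have eq: "j * ?L + r = j' * ?L + r'" using inj idx that by metis
    have "(j * ?L + r) div ?L = j" "(j' * ?L + r') div ?L = j'"
      using that by (simp_all del: mult_Suc_right)
    then have "j = j'" using eq by metis
    then show ?thesis using eq by simp
  qed
  have nth_p: "p j ! r = x (j * ?L + r)" if "r < ?L" for j r
    using that unfolding p_def by (simp del: upt_Suc mult_Suc_right)
  have path: "A_l_path {..<N} E A l (p j)" if j: "j < k" for j
    unfolding A_l_path_iff_nth[OF assms]
  proof (intro conjI allI impI)
    show "length (p j) = Suc l" by (simp add: p_def)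
    show "distinct (p j)"
    proof -
      have "inj_on (\<lambda>r. x (j * ?L + r)) {0..<?L}"
        using eqD[OF _ j j] by (intro inj_onI) (metis atLeastLessThan_iff)
      then show ?thesis unfolding p_def distinct_map by (metis distinct_upt set_upt)
    qed
    show "set (p j) \<subseteq> {..<N}"
      using xN idx[OF j] unfolding p_def by (auto simp del: upt_Suc mult_Suc_right)
  next
    fix r assume r: "r < l"
    have "(j * ?L + Suc r) mod ?L = Suc r" using r by (simp del: mult_Suc_right add: mod_mult_self3)
    then have "{x (j * ?L + Suc r - 1), x (j * ?L + Suc r)} \<in> E"
      using ok[OF idx[OF j, of "Suc r"]] r unfolding slot_ok_def by (simp del: mult_Suc_right)
    then show "{p j ! r, p j ! Suc r} \<in> E"
      using r by (simp add: nth_p del: mult_Suc_right)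
  next
    fix r assume r: "r \<le> l"
    have "(j * ?L + r) mod ?L = r" using r by (simp del: mult_Suc_right add: mod_mult_self3)
    then show "(r = 0 \<or> r = l) \<longleftrightarrow> p j ! r \<in> A"
      using ok[OF idx[OF j, of r]] r unfolding slot_ok_def by (simp add: nth_p del: mult_Suc_right)
  qed
  have disj: "set (p i) \<inter> set (p j) = {}" if "i < k" "j < k" "i \<noteq> j" for i j
  proof -
    have False if y: "y \<in> set (p i)" "y \<in> set (p j)" for y
    proof -
      obtain r r' where "r < ?L" "r' < ?L" "y = x (i * ?L + r)" "y = x (j * ?L + r')"
        using y unfolding p_def set_map set_upt by (auto simp del: mult_Suc_right)
      then show False using eqD[of i r j r'] \<open>i < k\<close> \<open>j < k\<close> \<open>i \<noteq> j\<close> by metis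
    qed
    then show ?thesis by blast
  qed
  \<comment> \<open>The paths are counted as a set, so they must be different lists; being nonempty
    and disjoint, they are.\<close>
  have "inj_on p {..<k}"
  proof (rule inj_onI, rule ccontr)
    fix i j assume "i \<in> {..<k}" "j \<in> {..<k}" "p i = p j" "i \<noteq> j"
    then have "set (p i) = {}" using disj[of i j] by auto
    then show False by (simp add: p_def)
  qed
  then show "has_path_packing {..<N} E A k l"
    unfolding has_path_packing_def
    using path disj by (intro exI[of _ "p ` {..<k}"]) (auto simp: card_image pairwise_def)
qed

section \<open>Expressions for a table entry\<close>

text \<open>The argument \<open>t\<close> repeats the level at which the expression is compiled,
  since the body names its accumulator by an absolute register number; hence the hypothesis
  \<open>u = t\<close> in the evaluation lemmas. Nested expressions get levels shifted by the
  operands already evaluated.\<close>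

definition pow2_exp :: "nat \<Rightarrow> exp \<Rightarrow> exp" where
  "pow2_exp t e = Fold (Num 1) e (Bin Times (Var t) (Num 2))"

lemma evals_pow2:
  assumes "evals B (t + 2) e (R(t := 1, t + 1 := 0)) M n T" "2 ^ n \<le> B" "2 \<le> B" and u: "u = t"
  shows "evals B t (pow2_exp u e) R M (2 ^ n) (T + n * 9 + 4)"
  unfolding pow2_exp_def u
proof (rule evals_conv[OF evals_Fold[where g = "\<lambda>i. 2 ^ i" and n = n]])
  fix i assume "i < n"
  have le: "2 ^ Suc i \<le> B"
    using \<open>i < n\<close> assms(2) by (meson Suc_leI le_trans one_le_numeral power_increasing)
  then have "(2::nat) ^ i \<le> B" by simp
  with le show "evals B (t + 3) (Bin Times (Var t) (Num 2)) (R(t := 2 ^ i, t + 1 := i, t + 2 := n)) M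
      (2 ^ Suc i) 3"
    by (intro evals_conv[OF evals_Times[OF evals_Var evals_Num]]) (use assms(3) in auto)
qed (use assms in \<open>auto intro: evals_Num\<close>)

definition bit_exp :: "nat \<Rightarrow> exp \<Rightarrow> exp \<Rightarrow> exp" where
  "bit_exp t x a = Bin Mod (Bin Div x (pow2_exp (t + 1) a)) (Num 2)"

definition nat_bit :: "nat \<Rightarrow> nat \<Rightarrow> nat" where
  "nat_bit x a = x div 2 ^ a mod 2"

lemma evals_bit:
  assumes "r < t" "s < t" "2 ^ K \<le> B" "2 \<le> B" "R r \<le> B" "R s \<le> B" "R s \<le> K" and u: "u = t"
  shows "evals B t (bit_exp u (Var r) (Var s)) R M (nat_bit (R r) (R s)) (K * 9 + 9)"
  unfolding bit_exp_def nat_bit_def u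
proof (rule evals_conv[OF evals_Mod[OF evals_Div[OF evals_Var evals_pow2[OF evals_Var]] evals_Num]])
  show "2 ^ (R(t := R r, t + 1 := 1, t + 1 + 1 := 0)) s \<le> B"
    using assms(1,2) le_trans[OF power_increasing[OF assms(7), of 2] assms(3)] by simp
qed (use assms in auto)

definition rank_exp :: "nat \<Rightarrow> exp \<Rightarrow> exp \<Rightarrow> exp" where
  "rank_exp t x a = Fold (Num 0) a (Bin Plus (Var t) (bit_exp (t + 4) x (Var (t + 1))))"

definition nat_rank :: "nat \<Rightarrow> nat \<Rightarrow> nat" where
  "nat_rank x a = (\<Sum>j<a. nat_bit x j)"

lemma nat_bit_le: "nat_bit x a \<le> 1"
  by (simp add: nat_bit_def)

lemma nat_rank_le: "nat_rank x a \<le> a"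
  unfolding nat_rank_def using sum_bounded_above[of "{..<a}" "nat_bit x" 1] nat_bit_le by simp

lemma evals_rank:
  assumes "r < t" "s < t" "2 ^ K \<le> B" "2 \<le> B" "R r \<le> B" "R s \<le> B" "R s \<le> K" and u: "u = t"
  shows "evals B t (rank_exp u (Var r) (Var s)) R M (nat_rank (R r) (R s)) (K * (K * 9 + 17) + 5)"
  unfolding rank_exp_def u
proof (rule evals_conv[OF evals_Fold[where g = "nat_rank (R r)" and n = "R s" and T = "K * 9 + 11"]])
  fix i assume i: "i < R s"
  have "nat_rank (R r) i \<le> B" "nat_rank (R r) i + nat_bit (R r) i \<le> B"
    using nat_rank_le[of "R r" i] nat_bit_le[of "R r" i] i assms by linarith+
  then show "evals B (t + 3) (Bin Plus (Var t) (bit_exp (t + 4) (Var r) (Var (t + 1))))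
      (R(t := nat_rank (R r) i, t + 1 := i, t + 2 := R s)) M (nat_rank (R r) (Suc i)) (K * 9 + 11)"
    using assms i
    by (intro evals_conv[OF evals_Plus[OF evals_Var evals_bit[where K = K]]])
      (auto simp: nat_rank_def)
next
  show "evals B (t + 2) (Var s) (R(t := nat_rank (R r) 0, t + 1 := 0)) M (R s) 1"
    using assms by (intro evals_conv[OF evals_Var]) auto
  show "evals B t (Num 0) R M (nat_rank (R r) 0) 1"
    by (intro evals_conv[OF evals_Num]) (auto simp: nat_rank_def)
  have "R s * (K * 9 + 11 + 6) \<le> K * (K * 9 + 11 + 6)"
    using assms(7) by (rule mult_right_mono) simp
  then show "1 + 1 + R s * (K * 9 + 11 + 6) + 3 \<le> K * (K * 9 + 17) + 5"
    by (simp add: algebra_simps)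
qed (use assms in auto)

definition powmod_exp :: "nat \<Rightarrow> exp \<Rightarrow> exp \<Rightarrow> exp \<Rightarrow> exp" where
  "powmod_exp t x e m = Fold (Num 1) e (Bin Mod (Bin Times (Var t) x) m)"

text \<open>The zeroth power is not reduced and equals \<open>1\<close> even for
  \<open>m = 1\<close>. Therefore the values are only at most \<open>m\<close>, and correctness is a
  congruence.\<close>

primrec powmod :: "nat \<Rightarrow> nat \<Rightarrow> nat \<Rightarrow> nat" where
  "powmod m x 0 = 1"
| "powmod m x (Suc n) = powmod m x n * x mod m"

lemma powmod_mod: "powmod m x n mod m = x ^ n mod m"
proof (induction n)
  case (Suc n)
  then show ?case by (metis mod_mod_trivial mod_mult_left_eq power_Suc2 powmod.simps(2))
qed simp

lemma powmod_le: "0 < m \<Longrightarrow> powmod m x n \<le> m"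
  by (cases n) (auto simp: less_imp_le)

lemma evals_powmod:
  assumes "evals B (t + 2) e (R(t := 1, t + 1 := 0)) M n T"
    and "r < t" "s < t" "0 < R s" "R s \<le> B" "R r \<le> B" "R s * R r \<le> B" "1 \<le> B" and u: "u = t"
  shows "evals B t (powmod_exp u (Var r) e (Var s)) R M (powmod (R s) (R r) n) (T + n * 11 + 4)"
  unfolding powmod_exp_def u
proof (rule evals_conv[OF evals_Fold[where g = "powmod (R s) (R r)" and n = n and T = 5]])
  fix i assume "i < n"
  have "powmod (R s) (R r) i \<le> B" "powmod (R s) (R r) i * R r \<le> B"
    using powmod_le[OF assms(4), of "R r" i] assms(5,7)
      mult_right_mono[of "powmod (R s) (R r) i" "R s" "R r"] by linarith+
  then show "evals B (t + 3) (Bin Mod (Bin Times (Var t) (Var r)) (Var s))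
      (R(t := powmod (R s) (R r) i, t + 1 := i, t + 2 := n)) M (powmod (R s) (R r) (Suc i)) 5"
    using assms(2-6) by (intro evals_conv[OF evals_Mod[OF evals_Times[OF evals_Var evals_Var] evals_Var]]) auto
qed (use assms in \<open>auto intro: evals_Num\<close>)

definition sum_exp :: "nat \<Rightarrow> exp \<Rightarrow> exp \<Rightarrow> exp \<Rightarrow> exp" where
  "sum_exp t n m e = Fold (Num 0) n (Bin Mod (Bin Plus (Var t) e) m)"

text \<open>Register \<open>t + 3\<close> holds the copy of the accumulator made as left operand of
  the addition, so the summand starts at level \<open>t + 4\<close>. Reducing in every round keeps
  the accumulator below the modulus.\<close>

lemma evals_sum:
  assumes body: "\<And>i g. i < n \<Longrightarrow> evals B (t + 4) e (R(t := g, t + 1 := i, t + 2 := n, t + 3 := g)) M (h i) T"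
    and h: "\<And>i. i < n \<Longrightarrow> R s + h i \<le> B"
    and R: "r < t" "R r = n" "n \<le> B" "s < t" "0 < R s" "R s \<le> B" "1 \<le> B" and u: "u = t"
  shows "evals B t (sum_exp u (Var r) (Var s) e) R M ((\<Sum>i<n. h i) mod R s) (n * (T + 10) + 5)"
  unfolding sum_exp_def u
proof (rule evals_conv[OF evals_Fold[where g = "\<lambda>i. (\<Sum>j<i. h j) mod R s" and n = n and T = "T + 4"]])
  fix i assume i: "i < n"
  let ?g = "(\<Sum>j<i. h j) mod R s"
  have "?g \<le> B" "?g + h i \<le> B"
    using mod_le_divisor[OF R(5), of "\<Sum>j<i. h j"] h[OF i] R by linarith+
  moreover have "(?g + h i) mod R s = (\<Sum>j<Suc i. h j) mod R s"
    by (simp add: mod_add_left_eq)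
  ultimately show "evals B (t + 3) (Bin Mod (Bin Plus (Var t) e) (Var s))
      (R(t := ?g, t + 1 := i, t + 2 := n)) M ((\<Sum>j<Suc i. h j) mod R s) (T + 4)"
    using body[OF i, of ?g] R
    by (intro evals_conv[OF evals_Mod[OF evals_Plus[OF evals_Var, of t, where b = e and ?v2.0 = "h i" and ?T2.0 = T] evals_Var]])
      (auto simp: numeral_eq_Suc)
next
  show "evals B (t + 2) (Var r) (R(t := (\<Sum>j<0. h j) mod R s, t + 1 := 0)) M n 1"
    using R by (intro evals_conv[OF evals_Var]) auto
  show "evals B t (Num 0) R M ((\<Sum>j<0. h j) mod R s) 1"
    by (intro evals_conv[OF evals_Num]) auto
qed (use R in \<open>auto simp: algebra_simps\<close>)

text \<open>
  Registers: 1 \<open>N\<close>, 2 \<open>K\<close>, 3 \<open>2 ^ K\<close>, 4 start of the table, 5 \<open>l\<close>, 6 and 7 loop counters,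
  8 size of a layer of the table, 9 number of entries to compute, 10 number of moduli,
  11 modulus, 12 and 13 column masks \<open>Y\<close> and \<open>X\<close>, 14 vertex \<open>w\<close>, 15 position \<open>i\<close>, 16 \<open>l + 1\<close>.
  The expressions below are compiled at the levels stated in the lemmas \<open>evals_...\<close>; there register
  22 holds the previous vertex \<open>v\<close>, and 27 and 31 hold the deleted columns \<open>a\<close> and \<open>b\<close>.
\<close>

definition sign_exp :: exp where
  "sign_exp = Bin Plus (Num 1)
     (Bin Times (Bin Mod (Bin Plus (rank_exp 37 (Var 13) (Var 27)) (rank_exp 38 (Var 12) (Var 31))) (Num 2))
       (Bin Minus (Var 11) (Num 2)))"

definition index_exp :: exp where
  "index_exp = Bin Plus (Var 4)
     (Bin Plus
       (Bin Times
         (Bin Plus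
           (Bin Times (Bin Plus (Bin Times (Var 15) (Var 1)) (Var 22)) (Var 3))
           (Bin Minus (Var 13) (pow2_exp 41 (Var 27))))
         (Var 3))
       (Bin Minus (Var 12) (pow2_exp 41 (Var 31))))"

text \<open>The two bit factors replace a conditional. If column \<open>a\<close> or
  \<open>b\<close> is absent, the truncated difference in \<open>index_exp\<close> is still a valid
  mask, so some table entry is read, and the factor zero discards it.\<close>

definition term_exp :: exp where
  "term_exp = Bin Times (bit_exp 34 (Var 13) (Var 27))
     (Bin Times (bit_exp 35 (Var 12) (Var 31))
       (Bin Times sign_exp
         (Bin Times (powmod_exp 37 (Var 14) (Bin Plus (Var 27) (Var 31)) (Var 11)) (Ld index_exp))))"

definition adjacent_exp :: exp where
  "adjacent_exp = Ld (Bin Plus (Bin Plus (Num 3) (Var 1)) (Bin Plus (Bin Times (Var 22) (Var 1)) (Var 14)))"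

text \<open>Truth values by truncated subtraction: \<open>1 - r\<close> tests \<open>r = 0\<close>,
  \<open>1 - (l - r)\<close> tests \<open>r = l\<close> as \<open>r \<le> l\<close>, and
  \<open>1 - (1 - x)\<close> sends every positive \<open>x\<close> to \<open>1\<close>. The sum of
  two products says that \<open>end\<close> and \<open>terminal\<close> agree.\<close>

definition slot_exp :: exp where
  "slot_exp =
     (let r = Bin Mod (Var 15) (Var 16);
          first = Bin Minus (Num 1) r;
          end = Bin Plus first (Bin Minus (Num 1) (Bin Minus (Var 5) r));
          terminal = Ld (Bin Plus (Num 3) (Var 14))
      in Bin Times
           (Bin Plus (Bin Times end terminal)
             (Bin Times (Bin Minus (Num 1) end) (Bin Minus (Num 1) terminal)))
           (Bin Minus (Num 1) (Bin Minus (Num 1) (Bin Plus first adjacent_exp))))"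

definition entry_exp :: exp where
  "entry_exp = sum_exp 21 (Var 1) (Var 11)
     (Bin Times slot_exp (sum_exp 26 (Var 2) (Var 11) (sum_exp 30 (Var 2) (Var 11) term_exp)))"

definition total_exp :: exp where
  "total_exp = sum_exp 21 (Var 1) (Var 11)
     (Ld (Bin Plus (Var 4)
       (Bin Plus
         (Bin Times
           (Bin Plus
             (Bin Times (Bin Plus (Bin Times (Var 2) (Var 1)) (Var 22)) (Var 3))
             (Bin Minus (Var 3) (Num 1)))
           (Var 3))
         (Bin Minus (Var 3) (Num 1)))))"

section \<open>Size bounds and the evaluation of one summand\<close>

locale packing_env =
  fixes N K l :: nat and E :: "nat set set" and A :: "nat set"
  assumes l_pos: "0 < l" and l_less: "l < K"
begin

definition "P = (2::nat) ^ K"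
definition "base = 3 + N + N * N"
definition "layer = N * P * P"
definition "moduli = 10 * N * K * K + 2"
text \<open>A common bound for addresses, masks, moduli and stored values. Products have at most
  three factors of this size (sign, power of the vertex, table entry); the fourth power in
  \<open>B\<close> leaves room for adding two numbers up to \<open>Z ^ 3\<close>, because
  \<open>2 \<le> Z\<close>.\<close>

definition "Z = base + (K + 1) * layer + moduli + P + K + 2"
definition "B = Z ^ 4"

definition index :: "nat \<Rightarrow> nat \<Rightarrow> nat \<Rightarrow> nat \<Rightarrow> nat" where
  "index i v X Y = base + (((i * N + v) * P + X) * P + Y)"

lemma two_le_Z: "2 \<le> Z"
  by (simp add: Z_def)

lemma Z_power_le: "e \<le> 4 \<Longrightarrow> Z ^ e \<le> B"
  unfolding B_def using two_le_Z by (intro power_increasing) auto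

lemma le_B: "x \<le> Z \<Longrightarrow> x \<le> B"
  using Z_power_le[of 1] by simp

lemma le_Z: "N \<le> Z" "K \<le> Z" "P \<le> Z" "base \<le> Z" "l \<le> Z" "Suc l \<le> Z" "moduli \<le> Z" "layer \<le> Z" "K * layer \<le> Z"
  using l_less by (auto simp: Z_def base_def)

lemma index_less:
  assumes "i \<le> K" "v < N" "X < P" "Y < P"
  shows "index i v X Y < base + (K + 1) * layer"
proof -
  have "i * N + v < (K + 1) * N" using assms by (intro pair_index_less) auto
  then have "(i * N + v) * P + X < (K + 1) * N * P" using assms(3) by (rule pair_index_less)
  then have "((i * N + v) * P + X) * P + Y < (K + 1) * N * P * P" using assms(4) by (rule pair_index_less)
  then show ?thesis by (simp only: index_def layer_def mult.assoc nat_add_left_cancel_less)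
qed

definition consts_ok :: "(nat \<Rightarrow> nat) \<Rightarrow> bool" where
  "consts_ok R \<longleftrightarrow> R 1 = N \<and> R 2 = K \<and> R 3 = P \<and> R 4 = base \<and> R 5 = l \<and> R 8 = layer \<and>
     R 9 = K * layer \<and> R 10 = moduli \<and> R 16 = Suc l"

definition entry_ok :: "nat \<Rightarrow> nat \<Rightarrow> nat \<Rightarrow> nat \<Rightarrow> nat \<Rightarrow> (nat \<Rightarrow> nat) \<Rightarrow> bool" where
  "entry_ok m i w X Y R \<longleftrightarrow> R 11 = m \<and> R 12 = Y \<and> R 13 = X \<and> R 14 = w \<and> R 15 = i \<and>
     0 < m \<and> m \<le> moduli \<and> i < K \<and> w < N \<and> X < P \<and> Y < P"

definition mem_ok :: "(nat \<Rightarrow> nat) \<Rightarrow> bool" where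
  "mem_ok M \<longleftrightarrow> (\<forall>v<N. M (3 + v) = of_bool (v \<in> A)) \<and>
     (\<forall>u<N. \<forall>v<N. M (3 + N + (u * N + v)) = of_bool ({u, v} \<in> E)) \<and> (\<forall>a. M a \<le> Z)"

text \<open>A representative of \<open>(-1) ^ (x + y)\<close> modulo \<open>m\<close>; for \<open>m = 1\<close> the truncated subtraction is harmless.\<close>

definition nat_sign :: "nat \<Rightarrow> nat \<Rightarrow> nat \<Rightarrow> nat" where
  "nat_sign m x y = 1 + (x + y) mod 2 * (m - 2)"

lemma sum_le_B: "a \<le> Z ^ 3 \<Longrightarrow> b \<le> Z ^ 3 \<Longrightarrow> a + b \<le> B"
proof -
  assume "a \<le> Z ^ 3" "b \<le> Z ^ 3"
  then have "a + b \<le> 2 * Z ^ 3" by simp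
  also have "\<dots> \<le> Z * Z ^ 3" using two_le_Z by (rule mult_right_mono) simp
  finally show ?thesis by (simp add: B_def power_eq_if)
qed

lemma le_Z3: "x \<le> Z \<Longrightarrow> x \<le> Z ^ 3"
  using power_increasing[of 1 3 Z] two_le_Z by simp

lemma evals_sign:
  assumes "consts_ok R" "entry_ok m i w X Y R" "R 27 = a" "R 31 = b" "a < K" "b < K"
  shows "evals B 36 sign_exp R M (nat_sign m (nat_rank X a) (nat_rank Y b)) (K * (K * 18 + 34) + 20)"
proof -
  have r: "nat_rank X a + nat_rank Y b \<le> B"
    using nat_rank_le[of X a] nat_rank_le[of Y b] assms(5,6) le_Z
    by (intro sum_le_B le_Z3) linarith+
  note le = le_Z[THEN le_B]
  have m: "m \<le> Z" using assms(2) le_Z(7) by (auto simp: entry_ok_def)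
  have "(nat_rank X a + nat_rank Y b) mod 2 * (m - 2) \<le> 1 * (m - 2)"
    by (intro mult_right_mono) auto
  then have t: "(nat_rank X a + nat_rank Y b) mod 2 * (m - 2) \<le> Z" using m by linarith
  then have t': "(nat_rank X a + nat_rank Y b) mod 2 * (m - 2) \<le> B" by (rule le_B)
  have s: "nat_sign m (nat_rank X a) (nat_rank Y b) \<le> B"
    unfolding nat_sign_def using t two_le_Z by (intro sum_le_B le_Z3) auto
  have e: "R 11 = m" "R 12 = Y" "R 13 = X" "R 27 = a" "R 31 = b" "X \<le> B" "Y \<le> B" "a \<le> B" "b \<le> B" "m \<le> B"
      "a \<le> K" "b \<le> K" "2 ^ K \<le> B" "2 \<le> B" "Suc 0 \<le> B"
    using assms m two_le_Z le_Z by (auto simp: entry_ok_def P_def intro!: le_B)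
  show ?thesis
    unfolding sign_exp_def
    by (rule evals_conv, (rule evals_intros evals_rank[where K = K] | simp add: e r t' s[unfolded nat_sign_def, simplified] nat_sign_def | simp add: algebra_simps)+)
qed

definition term_val :: "(nat \<Rightarrow> nat) \<Rightarrow> nat \<Rightarrow> nat \<Rightarrow> nat \<Rightarrow> nat \<Rightarrow> nat \<Rightarrow> nat \<Rightarrow> nat \<Rightarrow> nat \<Rightarrow> nat" where
  "term_val M m i w X Y v a b = nat_bit X a * (nat_bit Y b *
     (nat_sign m (nat_rank X a) (nat_rank Y b) * (powmod m w (a + b) * M (index i v (X - 2 ^ a) (Y - 2 ^ b)))))"

lemma evals_index:
  assumes "consts_ok R" "entry_ok m i w X Y R" "R 22 = v" "R 27 = a" "R 31 = b" "v < N" "a < K" "b < K"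
  shows "evals B 38 index_exp R M (index i v (X - 2 ^ a) (Y - 2 ^ b)) (K * 18 + 40)"
proof -
  let ?X = "X - 2 ^ a" and ?Y = "Y - 2 ^ b"
  have XY: "?X < P" "?Y < P" "i \<le> K" using assms by (auto simp: entry_ok_def)
  note le = index_less[OF XY(3) assms(6) XY(1,2)]
  \<comment> \<open>The address is evaluated by Horner's scheme with \<open>P \<ge> 1\<close>, so
    every partial result is at most the final address and inherits its bound.\<close>
  have "index i v ?X ?Y \<le> Z" using le by (simp add: Z_def)
  moreover have "((i * N + v) * P + ?X) * P + ?Y \<le> index i v ?X ?Y" by (simp add: index_def)
  moreover have "(i * N + v) * P + ?X \<le> ((i * N + v) * P + ?X) * P" by (simp add: P_def)
  moreover have "i * N + v \<le> (i * N + v) * P" by (simp add: P_def)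
  ultimately have "index i v ?X ?Y \<le> Z" "((i * N + v) * P + ?X) * P + ?Y \<le> Z"
    "((i * N + v) * P + ?X) * P \<le> Z" "(i * N + v) * P + ?X \<le> Z" "(i * N + v) * P \<le> Z"
    "i * N + v \<le> Z" "i * N \<le> Z"
    by linarith+
  note b = this[THEN le_B]
  have "2 ^ a \<le> P" "2 ^ b \<le> P" using assms(7,8) by (auto simp: P_def intro: power_increasing)
  then have p: "2 ^ a \<le> B" "2 ^ b \<le> B" using le_Z(3) le_B by (meson le_trans)+
  have e: "R 1 = N" "R (Suc 0) = N" "R 3 = P" "R 4 = base" "R 12 = Y" "R 13 = X" "R 15 = i" "R 22 = v" "R 27 = a" "R 31 = b"
    "X \<le> B" "Y \<le> B" "a \<le> B" "b \<le> B" "2 \<le> B" "Suc 0 \<le> B" "i \<le> B" "v \<le> B" "N \<le> B" "P \<le> B" "base \<le> B"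
    using assms two_le_Z le_Z by (auto simp: consts_ok_def entry_ok_def intro!: le_B)
  have c: "a * 9 \<le> K * 9" "b * 9 \<le> K * 9" using assms by auto
  show ?thesis
    unfolding index_exp_def
    apply (rule evals_conv)
    apply ((rule evals_intros evals_pow2 | simp add: e p b b[unfolded index_def])+)[1]
    subgoal by (simp add: e index_def)
    subgoal using c by (simp add: e)
    done
qed

lemma evals_term:
  assumes R: "consts_ok R" "entry_ok m i w X Y R" "R 22 = v" "R 27 = a" "R 31 = b" "v < N" "a < K" "b < K"
    and M: "\<forall>x. M x \<le> Z"
  shows "evals B 34 term_exp R M (term_val M m i w X Y v a b) (K * (K * 18 + 92) + 110)"
    and "term_val M m i w X Y v a b \<le> Z ^ 3"
proof -
  let ?i = "index i v (X - 2 ^ a) (Y - 2 ^ b)"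
  let ?s = "nat_sign m (nat_rank X a) (nat_rank Y b)"
  have m: "0 < m" "m \<le> Z" using R(2) le_Z(7) by (auto simp: entry_ok_def)
  have Mi: "M ?i \<le> Z" and pw: "powmod m w (a + b) \<le> Z"
    using M powmod_le[OF m(1), of w "a + b"] m by auto
  have "(nat_rank X a + nat_rank Y b) mod 2 * (m - 2) \<le> 1 * (m - 2)"
    by (intro mult_right_mono) auto
  then have s: "?s \<le> Z" using m two_le_Z unfolding nat_sign_def by linarith
  have 1: "powmod m w (a + b) * M ?i \<le> Z * Z" using pw Mi by (rule mult_mono) auto
  have 2: "?s * (powmod m w (a + b) * M ?i) \<le> Z * (Z * Z)" using s 1 by (rule mult_mono) auto
  have 3: "nat_bit Y b * (?s * (powmod m w (a + b) * M ?i)) \<le> 1 * (Z * (Z * Z))"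
    using nat_bit_le 2 by (rule mult_mono) auto
  have 4: "term_val M m i w X Y v a b \<le> 1 * (1 * (Z * (Z * Z)))"
    unfolding term_val_def using nat_bit_le 3 by (rule mult_mono) auto
  then show "term_val M m i w X Y v a b \<le> Z ^ 3" by (simp add: power3_eq_cube mult.assoc)
  have Z2: "Z * Z \<le> B" using Z_power_le[of 2] by (simp add: power2_eq_square)
  have Z3: "Z * (Z * Z) \<le> B" using Z_power_le[of 3] by (simp add: power3_eq_cube mult.assoc)
  have p: "powmod m w (a + b) * M ?i \<le> B" "?s * (powmod m w (a + b) * M ?i) \<le> B"
    "nat_bit Y b * (?s * (powmod m w (a + b) * M ?i)) \<le> B" "term_val M m i w X Y v a b \<le> B"
    using 1 2 3 4 Z2 Z3 by linarith+
  have wm: "m * w \<le> B"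
  proof -
    have "w \<le> Z" using R(2) le_Z(1) by (auto simp: entry_ok_def)
    then have "m * w \<le> Z * Z" using m by (intro mult_mono) auto
    then show ?thesis using Z2 by linarith
  qed
  have e: "R 11 = m" "R 12 = Y" "R 13 = X" "R 14 = w" "R 22 = v" "R 27 = a" "R 31 = b" "0 < m" "M ?i \<le> B"
    "X \<le> B" "Y \<le> B" "w \<le> B" "a \<le> B" "b \<le> B" "2 \<le> B" "Suc 0 \<le> B" "2 ^ K \<le> B" "a \<le> K" "b \<le> K" "m \<le> B"
    using R two_le_Z le_Z m Mi by (auto simp: entry_ok_def P_def intro!: le_B)
  have ab: "a + b \<le> B" using R(7,8) le_Z(2) two_le_Z by (intro sum_le_B le_Z3) auto
  have c: "(a + b) * 11 \<le> K * 22" using R(7,8) by auto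
  have upd: "consts_ok (R(x := y))" "entry_ok m i w X Y (R(x := y))" if "x > 20" "consts_ok R" "entry_ok m i w X Y R" for x y R
    using that by (auto simp: consts_ok_def entry_ok_def)
  show "evals B 34 term_exp R M (term_val M m i w X Y v a b) (K * (K * 18 + 92) + 110)"
    unfolding term_exp_def
    apply (rule evals_conv)
    apply ((rule evals_intros evals_bit[where K = K] evals_powmod
       evals_sign[where m = m and i = i and w = w and X = X and Y = Y and a = a and b = b, THEN evals_conv[OF _ refl le_refl]]
       evals_index[where m = m and i = i and w = w and X = X and Y = Y and a = a and b = b and v = v] | simp add: e p p(4)[unfolded term_val_def] ab wm upd R)+)[1]
    subgoal by (simp add: e term_val_def)
    subgoal using c by (simp add: e algebra_simps)
    done
qed

end

section \<open>Correctness of a table entry\<close>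

definition mask_set :: "nat \<Rightarrow> nat set" where
  "mask_set x = {a. bit x a}"

lemma nat_bit_eq: "nat_bit x a = of_bool (a \<in> mask_set x)"
  by (simp add: nat_bit_def mask_set_def bit_iff_odd mod_2_eq_odd)

lemma mask_set_less: "x < 2 ^ K \<Longrightarrow> mask_set x \<subseteq> {..<K}"
proof
  fix a assume "x < 2 ^ K" "a \<in> mask_set x"
  then have "2 ^ a \<le> x"
    by (metis bit_iff_odd div_less even_zero linorder_not_less mask_set_def mem_Collect_eq)
  then have "(2::nat) ^ a < 2 ^ K" using \<open>x < 2 ^ K\<close> by (rule le_less_trans)
  then show "a \<in> {..<K}" by simp
qed

lemma rank_mask_set: "rank (mask_set x) a = nat_rank x a"
proof -
  have "nat_rank x a = (\<Sum>j<a. of_bool (j \<in> mask_set x))"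
    unfolding nat_rank_def nat_bit_eq ..
  also have "\<dots> = card ({..<a} \<inter> mask_set x)"
    by (simp add: of_bool_def sum.If_cases Int_def)
  also have "{..<a} \<inter> mask_set x = {j \<in> mask_set x. j < a}" by auto
  finally show ?thesis by (simp add: rank_def)
qed

text \<open>Subtracting \<open>2 ^ a\<close> from a mask containing \<open>a\<close> causes no
  borrow: it is the same as clearing that bit.\<close>

lemma mask_set_diff:
  assumes "a \<in> mask_set x"
  shows "mask_set (x - 2 ^ a) = mask_set x - {a}"
proof -
  have bit: "bit x a" using assms by (simp add: mask_set_def)
  have "set_bit a (unset_bit a x) = x"
    using bit by (intro bit_eqI) (auto simp: bit_simps)
  then have "x = unset_bit a x + 2 ^ a"
    using set_bit_eq[of a "unset_bit a x"] by (simp add: bit_simps)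
  then have "x - 2 ^ a = unset_bit a x" by simp
  then show ?thesis by (auto simp: mask_set_def bit_simps)
qed

lemma mask_set_full: "mask_set (2 ^ K - 1) = {..<K}"
  unfolding mask_eq_exp_minus_1[symmetric] by (auto simp: mask_set_def bit_mask_iff)

lemma mask_set_0_iff: "mask_set x = {} \<longleftrightarrow> x = 0"
  by (auto simp: mask_set_def bit_eq_iff)

lemma sum_mod_cong:
  fixes f g :: "'a \<Rightarrow> int"
  assumes "\<And>i. i \<in> A \<Longrightarrow> f i mod m = g i mod m"
  shows "sum f A mod m = sum g A mod m"
  by (metis (no_types, lifting) assms mod_sum_eq sum.cong)

lemma nat_sign_mod:
  assumes "0 < m"
  shows "int (1 + (x + y) mod 2 * (m - 2)) mod int m = (-1) ^ (x + y) mod int m"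
proof (cases "even (x + y)")
  case True
  then have "(x + y) mod 2 = 0" by presburger
  then show ?thesis using True by simp
next
  case False
  then have odd: "(x + y) mod 2 = 1" by presburger
  show ?thesis
  proof (cases "m = 1")
    case False
    then have "int (1 + (m - 2)) = - 1 + int m" using assms by simp
    then have "int (1 + (m - 2)) mod int m = (-1) mod int m" by (simp only: mod_add_self2)
    then show ?thesis using odd \<open>odd (x + y)\<close> by simp
  qed simp
qed

text \<open>The program runs through all \<open>K\<close> columns and lets the bit select, whereas
  \<open>dp\<close> sums over the set itself.\<close>

lemma sum_mask:
  fixes f :: "nat \<Rightarrow> int"
  assumes "x < 2 ^ K"
  shows "(\<Sum>a<K. int (nat_bit x a) * f a) = (\<Sum>a\<in>mask_set x. f a)"
proof -
  have "(\<Sum>a<K. int (nat_bit x a) * f a) = (\<Sum>a\<in>{..<K}. if a \<in> mask_set x then f a else 0)"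
    by (intro sum.cong) (auto simp: nat_bit_eq)
  also have "\<dots> = sum f ({..<K} \<inter> mask_set x)"
    by (simp add: sum.If_cases Int_def)
  also have "{..<K} \<inter> mask_set x = mask_set x" using mask_set_less[OF assms] by auto
  finally show ?thesis .
qed

context packing_env begin

lemma evals_slot:
  assumes R: "consts_ok R" "entry_ok m i w X Y R" "R 22 = v" "v < N" and M: "mem_ok M"
  shows "evals B 25 slot_exp R M (of_bool (slot_ok E A l i v w)) 80"
proof -
  define r where "r = i mod Suc l"
  define f where "f = Suc 0 - r"
  define g where "g = Suc 0 - (l - r)"
  define t :: nat where "t = of_bool (w \<in> A)"
  define d :: nat where "d = of_bool ({v, w} \<in> E)"
  have "r \<le> l" unfolding r_def by (simp add: less_Suc_eq_le[symmetric])
  have fg: "f = of_bool (r = 0)" "g = of_bool (r = l)"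
    using \<open>r \<le> l\<close> unfolding f_def g_def by auto
  \<comment> \<open>As \<open>0 < l\<close>, no position is both the first and the last of its path,
    so the sum of the two indicators is again an indicator.\<close>
  have "f + g \<le> 1" using fg l_pos by auto
  have B2: "2 \<le> B" using two_le_Z le_B by simp
  have le: "f \<le> B" "g \<le> B" "f + g \<le> B" "t \<le> B" "d \<le> B" "f + d \<le> B" "(f + g) * t \<le> B"
    "(Suc 0 - (f + g)) * (Suc 0 - t) \<le> B" "(f + g) * t + (Suc 0 - (f + g)) * (Suc 0 - t) \<le> B"
    "((f + g) * t + (Suc 0 - (f + g)) * (Suc 0 - t)) * (Suc 0 - (Suc 0 - (f + d))) \<le> B"
    using \<open>f + g \<le> 1\<close> B2 by (auto simp: t_def d_def fg)
  have val: "((f + g) * t + (Suc 0 - (f + g)) * (Suc 0 - t)) * (Suc 0 - (Suc 0 - (f + d)))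
      = of_bool (slot_ok E A l i v w)"
    using l_pos by (auto simp: fg t_def d_def slot_ok_def r_def[symmetric])
  have w: "w < N" using R(2) by (simp add: entry_ok_def)
  have "v * N + w < N * N"
    using R(4) w by (rule pair_index_less)
  then have vw: "3 + N + (v * N + w) \<le> B" "v * N + w \<le> B" "v * N \<le> B" "3 + N \<le> B" "3 + w \<le> B"
    using w le_Z(4) by (auto intro!: le_B simp: base_def)
  define ok where "ok R' \<longleftrightarrow> consts_ok R' \<and> entry_ok m i w X Y R' \<and> R' 22 = v" for R'
  have ok_R: "ok R" using R by (simp add: ok_def)
  have upd: "ok (R'(x := y))" if "ok R'" "22 < x" for R' x y
    using that by (auto simp: ok_def consts_ok_def entry_ok_def)
  have e: "R' (Suc 0) = N" "R' 5 = l" "R' 14 = w" "R' 15 = i" "R' 16 = Suc l" "R' 22 = v"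
    if "ok R'" for R' using that by (auto simp: ok_def consts_ok_def entry_ok_def)
  have bound: "N \<le> B" "l \<le> B" "w \<le> B" "i \<le> B" "Suc l \<le> B" "v \<le> B" "3 \<le> B" "Suc 0 \<le> B"
    using R w le_Z vw by (auto simp: entry_ok_def intro!: le_B)
  have mem: "M (3 + w) = t" "M (3 + N + (v * N + w)) = d"
    using R M w by (auto simp: mem_ok_def t_def d_def)
  let ?r = "Bin Mod (Var 15) (Var 16)"
  let ?first = "Bin Minus (Num 1) ?r"
  let ?end = "Bin Plus ?first (Bin Minus (Num 1) (Bin Minus (Var 5) ?r))"
  let ?terminal = "Ld (Bin Plus (Num 3) (Var 14))"
  have r: "evals B s ?r R' M r 3" if "22 < s" "ok R'" for s R'
    using that
    by - (rule evals_conv, (rule evals_intros | (simp add: e[OF that(2)] upd bound r_def; fail))+)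
  have first: "evals B s ?first R' M f 5" if "22 < s" "ok R'" for s R'
    using that
    by - (rule evals_conv, (rule r evals_intros | (simp add: e[OF that(2)] upd bound f_def; fail))+)
  have "end": "evals B s ?end R' M (f + g) 13" if "22 < s" "ok R'" for s R'
    using that
    by - (rule evals_conv, (rule first r evals_intros | (simp add: e[OF that(2)] upd bound g_def[symmetric] le; fail))+)
  have terminal: "evals B s ?terminal R' M t 4" if "22 < s" "ok R'" for s R'
    using that
    by - (rule evals_conv, (rule evals_intros | (simp add: e[OF that(2)] upd bound le(4) mem vw; fail))+)
  have adjacent: "evals B s adjacent_exp R' M d 10" if "22 < s" "ok R'" for s R'
    using that unfolding adjacent_exp_def
    by - (rule evals_conv, (rule evals_intros | (simp add: e[OF that(2)] upd bound le(5) mem vw; fail))+)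
  have left: "evals B s (Bin Plus (Bin Times ?end ?terminal)
      (Bin Times (Bin Minus (Num 1) ?end) (Bin Minus (Num 1) ?terminal))) R' M
      ((f + g) * t + (Suc 0 - (f + g)) * (Suc 0 - t)) 41" if "22 < s" "ok R'" for s R'
    using that
    by - (rule evals_conv, (rule "end" terminal evals_intros | (simp add: e[OF that(2)] upd bound le; fail))+)
  have right: "evals B s (Bin Minus (Num 1) (Bin Minus (Num 1) (Bin Plus ?first adjacent_exp))) R' M
      (Suc 0 - (Suc 0 - (f + d))) 20" if "22 < s" "ok R'" for s R'
    using that
    by - (rule evals_conv, (rule first adjacent evals_intros | (simp add: e[OF that(2)] upd bound le; fail))+)
  show ?thesis
    unfolding slot_exp_def Let_def
    by (rule evals_conv, (rule left right evals_intros | (simp add: upd ok_R le le(10)[unfolded val] val; fail))+)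
qed

definition entry_val :: "(nat \<Rightarrow> nat) \<Rightarrow> nat \<Rightarrow> nat \<Rightarrow> nat \<Rightarrow> nat \<Rightarrow> nat \<Rightarrow> nat" where
  "entry_val M m i w X Y = (\<Sum>v<N. of_bool (slot_ok E A l i v w) *
     ((\<Sum>a<K. (\<Sum>b<K. term_val M m i w X Y v a b) mod m) mod m)) mod m"

lemma upd_ok: "20 < x \<Longrightarrow> consts_ok R \<Longrightarrow> consts_ok (R(x := y))"
  "20 < x \<Longrightarrow> entry_ok m i w X Y R \<Longrightarrow> entry_ok m i w X Y (R(x := y))"
  by (auto simp: consts_ok_def entry_ok_def)

text \<open>The time bound unfolds the three nested sums: a sum of \<open>n\<close> terms of cost
  \<open>T\<close> takes \<open>n * (T + 10) + 5\<close> steps, starting from the cost of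
  \<open>term_exp\<close>; \<open>slot_exp\<close> joins in at the outermost sum.\<close>

lemma evals_entry:
  assumes R: "consts_ok R" "entry_ok m i w X Y R" and M: "mem_ok M"
  shows "evals B 21 entry_exp R M (entry_val M m i w X Y)
    (N * (K * (K * (K * (K * 18 + 92) + 120) + 15) + 100) + 5)"
proof -
  have m: "0 < m" "m \<le> Z" using R(2) le_Z(7) by (auto simp: entry_ok_def)
  have Mz: "\<forall>x. M x \<le> Z" using M by (simp add: mem_ok_def)
  have e: "R 11 = m" "R (Suc 0) = N" "R 2 = K" "N \<le> B" "K \<le> B" "m \<le> B" "Suc 0 \<le> B"
    using R m two_le_Z le_Z by (auto simp: consts_ok_def entry_ok_def intro!: le_B)
  have mB: "m + x \<le> B" if "x \<le> Z ^ 3" for x using sum_le_B[OF le_Z3[OF m(2)] that] .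
  have md: "x mod m \<le> Z" for x using m by (meson le_trans less_imp_le mod_less_divisor)
  have ob: "of_bool c * (x mod m) \<le> Z" for c x using md by auto
  show ?thesis
    unfolding entry_exp_def entry_val_def
  proof (rule evals_conv[OF evals_sum])
    fix v g1 assume v: "v < N"
    let ?R1 = "R(21 := g1, 21 + 1 := v, 21 + 2 := N, 21 + 3 := g1)"
    have R1: "consts_ok ?R1" "entry_ok m i w X Y ?R1" by (intro upd_ok R; simp)+
    let ?R2 = "?R1(21 + 4 := of_bool (slot_ok E A l i v w))"
    have R2: "consts_ok ?R2" "entry_ok m i w X Y ?R2" by (intro upd_ok R1; simp)+
    have inner: "evals B (21 + 4 + 1) (sum_exp 26 (Var 2) (Var 11) (sum_exp 30 (Var 2) (Var 11) term_exp)) ?R2 M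
      ((\<Sum>a<K. (\<Sum>b<K. term_val M m i w X Y v a b) mod m) mod m)
      (K * (K * (K * (K * 18 + 92) + 120) + 15) + 5)"
    proof (rule evals_conv[OF evals_sum])
      fix a g2 assume a: "a < K"
      let ?R3 = "?R2(21 + 4 + 1 := g2, 21 + 4 + 1 + 1 := a, 21 + 4 + 1 + 2 := K, 21 + 4 + 1 + 3 := g2)"
      have R3: "consts_ok ?R3" "entry_ok m i w X Y ?R3" by (intro upd_ok R2; simp)+
      show "evals B (21 + 4 + 1 + 4) (sum_exp 30 (Var 2) (Var 11) term_exp) ?R3 M
        ((\<Sum>b<K. term_val M m i w X Y v a b) mod m) (K * (K * (K * 18 + 92) + 120) + 5)"
      proof (rule evals_conv[OF evals_sum])
        fix b g3 assume b: "b < K"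
        let ?R4 = "?R3(21 + 4 + 1 + 4 := g3, 21 + 4 + 1 + 4 + 1 := b, 21 + 4 + 1 + 4 + 2 := K, 21 + 4 + 1 + 4 + 3 := g3)"
        have R4: "consts_ok ?R4" "entry_ok m i w X Y ?R4" by (intro upd_ok R3; simp)+
        have "evals B 34 term_exp ?R4 M (term_val M m i w X Y v a b) (K * (K * 18 + 92) + 110)"
          by (rule evals_term(1)[OF R4 _ _ _ v a b Mz]) simp_all
        then show "evals B (21 + 4 + 1 + 4 + 4) term_exp ?R4 M (term_val M m i w X Y v a b) (K * (K * 18 + 92) + 110)"
          by simp
        have "term_val M m i w X Y v a b \<le> Z ^ 3"
          by (rule evals_term(2)[OF R4 _ _ _ v a b Mz]) simp_all
        then show "?R3 11 + term_val M m i w X Y v a b \<le> B" using mB e by simp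
      qed (use e m in \<open>simp_all\<close>)
      show "?R2 11 + (\<Sum>b<K. term_val M m i w X Y v a b) mod m \<le> B"
        using mB[OF le_Z3[OF md]] e by simp
    qed (use e m in \<open>simp_all\<close>)
    have "evals B (21 + 4) slot_exp ?R1 M (of_bool (slot_ok E A l i v w)) 80"
      using evals_slot[OF R1 _ v M] by simp
    then show "evals B (21 + 4) (Bin Times slot_exp (sum_exp 26 (Var 2) (Var 11) (sum_exp 30 (Var 2) (Var 11) term_exp)))
      ?R1 M (of_bool (slot_ok E A l i v w) * ((\<Sum>a<K. (\<Sum>b<K. term_val M m i w X Y v a b) mod m) mod m))
      (K * (K * (K * (K * 18 + 92) + 120) + 15) + 90)"
      using ob le_B by (intro evals_conv[OF evals_Times[OF _ inner]]) auto
    show "R 11 + of_bool (slot_ok E A l i v w) * ((\<Sum>a<K. (\<Sum>b<K. term_val M m i w X Y v a b) mod m) mod m) \<le> B"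
      using mB[OF le_Z3[OF ob]] e by simp
  qed (use e m in \<open>simp_all\<close>)
qed

lemma evals_total:
  assumes R: "consts_ok R" "R 11 = m" "0 < m" "m \<le> moduli" and M: "\<forall>x. M x \<le> Z"
  shows "evals B 21 total_exp R M ((\<Sum>w<N. M (index K w (P - 1) (P - 1))) mod m) (N * 40 + 5)"
proof -
  have m: "m \<le> Z" using R le_Z(7) by simp
  have e: "R 11 = m" "R (Suc 0) = N" "R 2 = K" "R 3 = P" "R 4 = base" "N \<le> B" "K \<le> B" "m \<le> B" "Suc 0 \<le> B" "P \<le> B" "base \<le> B"
    using R m two_le_Z le_Z by (auto simp: consts_ok_def intro!: le_B)
  show ?thesis
    unfolding total_exp_def
  proof (rule evals_conv[OF evals_sum])
    fix w g assume w: "w < N"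
    have P: "P - 1 < P" by (simp add: P_def)
    note le = index_less[OF le_refl w P P]
    let ?p = "P - 1"
    have "index K w ?p ?p \<le> Z" using le by (simp add: Z_def)
    moreover have "((K * N + w) * P + ?p) * P + ?p \<le> index K w ?p ?p" by (simp add: index_def)
    moreover have "(K * N + w) * P + ?p \<le> ((K * N + w) * P + ?p) * P" by (simp add: P_def)
    moreover have "K * N + w \<le> (K * N + w) * P" by (simp add: P_def)
    ultimately have "index K w ?p ?p \<le> Z" "((K * N + w) * P + ?p) * P + ?p \<le> Z"
      "((K * N + w) * P + ?p) * P \<le> Z" "(K * N + w) * P + ?p \<le> Z" "(K * N + w) * P \<le> Z"
      "K * N + w \<le> Z" "K * N \<le> Z"
      by linarith+
    note b = this[THEN le_B]
    have "M (index K w ?p ?p) \<le> B" using M le_B by simp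
    have "w \<le> B" using w e(6) by simp
    note f = this e \<open>M (index K w ?p ?p) \<le> B\<close>[unfolded index_def, simplified]
      b[simplified] b[unfolded index_def, simplified]
    show "evals B (21 + 4) (Ld (Bin Plus (Var 4) (Bin Plus (Bin Times (Bin Plus (Bin Times (Bin Plus
        (Bin Times (Var 2) (Var 1)) (Var 22)) (Var 3)) (Bin Minus (Var 3) (Num 1))) (Var 3)) (Bin Minus (Var 3) (Num 1)))))
        (R(21 := g, 21 + 1 := w, 21 + 2 := N, 21 + 3 := g)) M (M (index K w (P - 1) (P - 1))) 30"
      apply (rule evals_conv)
      apply ((rule evals_intros | (simp add: f; fail))+)[1]
      subgoal by (simp add: e index_def)
      subgoal by simp
      done
    show "R 11 + M (index K w (P - 1) (P - 1)) \<le> B"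
      using M m e(1) by (intro sum_le_B le_Z3) auto
  qed (use e R in simp_all)
qed

section \<open>Layout and correctness of the table\<close>

definition F :: "nat \<Rightarrow> nat \<Rightarrow> nat \<Rightarrow> nat \<Rightarrow> int" where
  "F i w X Y = dp (slot_ok E A l) N i w (mask_set X) (mask_set Y)"

text \<open>Without column \<open>a\<close> or \<open>b\<close> both sides vanish. Otherwise sign,
  power and table entry are each congruent to their integer counterparts, and congruences
  multiply.\<close>

lemma term_val_mod:
  assumes "0 < m" "X < P" "Y < P" "v < N"
    and M: "\<And>X' Y'. X' < P \<Longrightarrow> Y' < P \<Longrightarrow> int (M (index i v X' Y')) mod int m = F i v X' Y' mod int m"
  shows "int (term_val M m i w X Y v a b) mod int m =
    (int (nat_bit X a) * (int (nat_bit Y b) * ((-1) ^ (rank (mask_set X) a + rank (mask_set Y) b) *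
      int w ^ (a + b) * dp (slot_ok E A l) N i v (mask_set X - {a}) (mask_set Y - {b})))) mod int m"
proof (cases "a \<in> mask_set X \<and> b \<in> mask_set Y")
  case False
  then show ?thesis by (auto simp: term_val_def nat_bit_eq)
next
  case True
  let ?i = "index i v (X - 2 ^ a) (Y - 2 ^ b)" and ?s = "nat_sign m (nat_rank X a) (nat_rank Y b)"
  have "int ?s mod int m = (-1) ^ (nat_rank X a + nat_rank Y b) mod int m"
    unfolding nat_sign_def by (rule nat_sign_mod[OF assms(1)])
  moreover have "int (powmod m w (a + b)) mod int m = int w ^ (a + b) mod int m"
    using powmod_mod[of m w "a + b"] by (simp flip: of_nat_mod of_nat_power)
  moreover have "int (M ?i) mod int m = F i v (X - 2 ^ a) (Y - 2 ^ b) mod int m"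
    using assms by (intro M) auto
  ultimately have "(int ?s * (int (powmod m w (a + b)) * int (M ?i))) mod int m =
      ((-1) ^ (nat_rank X a + nat_rank Y b) * (int w ^ (a + b) * F i v (X - 2 ^ a) (Y - 2 ^ b))) mod int m"
    by (intro mod_mult_cong)
  then show ?thesis
    using True by (simp add: term_val_def nat_bit_eq F_def mask_set_diff rank_mask_set mult.assoc)
qed

lemma entry_val_mod:
  assumes "0 < m" "X < P" "Y < P"
    and M: "\<And>v X' Y'. v < N \<Longrightarrow> X' < P \<Longrightarrow> Y' < P \<Longrightarrow> int (M (index i v X' Y')) mod int m = F i v X' Y' mod int m"
  shows "int (entry_val M m i w X Y) = F (Suc i) w X Y mod int m"
proof -
  let ?h = "\<lambda>v a b. (-1) ^ (rank (mask_set X) a + rank (mask_set Y) b) *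
      int w ^ (a + b) * dp (slot_ok E A l) N i v (mask_set X - {a}) (mask_set Y - {b})"
  have X: "X < 2 ^ K" "Y < 2 ^ K" using assms by (simp_all add: P_def)
  have "int (entry_val M m i w X Y) = (\<Sum>v<N. of_bool (slot_ok E A l i v w) *
     ((\<Sum>a<K. (\<Sum>b<K. int (term_val M m i w X Y v a b)) mod int m) mod int m)) mod int m"
    unfolding entry_val_def by (simp add: of_nat_mod)
  also have "\<dots> = (\<Sum>v<N. of_bool (slot_ok E A l i v w) *
     (\<Sum>a\<in>mask_set X. \<Sum>b\<in>mask_set Y. ?h v a b)) mod int m"
  proof (intro sum_mod_cong mod_mult_cong refl)
    fix v assume "v \<in> {..<N}"
    then have "v < N" by simp
    have "(\<Sum>a<K. (\<Sum>b<K. int (term_val M m i w X Y v a b)) mod int m) mod int m mod int m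
      = (\<Sum>a<K. \<Sum>b<K. int (term_val M m i w X Y v a b)) mod int m"
      by (simp add: mod_sum_eq)
    also have "\<dots> = (\<Sum>a<K. \<Sum>b<K. int (nat_bit X a) * (int (nat_bit Y b) * ?h v a b)) mod int m"
      using term_val_mod[OF assms(1-3) \<open>v < N\<close> M[OF \<open>v < N\<close>]] by (intro sum_mod_cong)
    also have "(\<Sum>a<K. \<Sum>b<K. int (nat_bit X a) * (int (nat_bit Y b) * ?h v a b)) =
        (\<Sum>a\<in>mask_set X. \<Sum>b\<in>mask_set Y. ?h v a b)"
      by (simp only: sum_distrib_left[symmetric] sum_mask[OF X(1)] sum_mask[OF X(2)])
    finally show "(\<Sum>a<K. (\<Sum>b<K. int (term_val M m i w X Y v a b)) mod int m) mod int m mod int m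
      = (\<Sum>a\<in>mask_set X. \<Sum>b\<in>mask_set Y. ?h v a b) mod int m" .
  qed
  also have "\<dots> = F (Suc i) w X Y mod int m"
    by (simp add: F_def)
  finally show ?thesis .
qed

text \<open>A mixed-radix number with leading digit \<open>i\<close>: increasing order of addresses
  is an order by layers, and one counter can stand for all four digits.\<close>

definition flat :: "nat \<Rightarrow> nat \<Rightarrow> nat \<Rightarrow> nat \<Rightarrow> nat" where
  "flat i v X Y = ((i * N + v) * P + X) * P + Y"

lemma index_eq_flat: "index i v X Y = base + flat i v X Y"
  by (simp add: index_def flat_def)

lemma P_pos: "0 < P"
  by (simp add: P_def)

lemma flat_decode:
  assumes "v < N" "X < P" "Y < P"
  shows "flat i v X Y mod P = Y" "flat i v X Y div P mod P = X"
    "flat i v X Y div (P * P) mod N = v" "flat i v X Y div layer = i"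
proof -
  have 1: "flat i v X Y div P = (i * N + v) * P + X" and "flat i v X Y mod P = Y"
    using assms P_pos unfolding flat_def by simp_all
  then show "flat i v X Y mod P = Y" by simp
  have 2: "((i * N + v) * P + X) div P = i * N + v" using assms P_pos by simp
  show "flat i v X Y div P mod P = X" unfolding 1 using assms by simp
  show "flat i v X Y div (P * P) mod N = v"
    unfolding div_mult2_eq 1 2 using assms by simp
  have layer: "layer = P * P * N" by (simp add: layer_def)
  have "flat i v X Y div layer = (i * N + v) div N"
    unfolding layer div_mult2_eq 1 2 ..
  then show "flat i v X Y div layer = i" using assms by simp
qed

lemma flat_less:
  assumes "v < N" "X < P" "Y < P"
  shows "flat i v X Y < Suc i * layer"
proof -
  have "0 < layer" using assms by (simp add: layer_def)
  then show ?thesis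
    using flat_decode(4)[OF assms, of i] by (metis dividend_less_div_times mult.commute plus_1_eq_Suc mult_Suc add.commute)
qed

text \<open>Computed entries are counted from the layer after the initial one, hence the
  \<open>Suc\<close>.\<close>

definition G :: "nat \<Rightarrow> int" where
  "G q = F (Suc (q div layer)) (q div (P * P) mod N) (q div P mod P) (q mod P)"

text \<open>These are the values of \<open>dp\<close> for length \<open>0\<close>: a single one, at
  the dummy vertex with two empty masks. They are the same for all moduli, so this layer is written
  once; the others are overwritten for each modulus.\<close>

definition layer0_ok :: "(nat \<Rightarrow> nat) \<Rightarrow> bool" where
  "layer0_ok M \<longleftrightarrow> (\<forall>x<layer. M (base + x) = of_bool (x = 0))"

definition table_ok :: "nat \<Rightarrow> nat \<Rightarrow> (nat \<Rightarrow> nat) \<Rightarrow> bool" where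
  "table_ok m q M \<longleftrightarrow> mem_ok M \<and> layer0_ok M \<and> (\<forall>q'<q. int (M (base + layer + q')) = G q' mod int m)"

lemma table_read:
  assumes T: "table_ok m q M" and i: "i * layer \<le> q" and v: "v < N" "X < P" "Y < P"
  shows "int (M (index i v X Y)) mod int m = F i v X Y mod int m"
proof (cases i)
  case 0
  have "flat 0 v X Y < layer" using flat_less[OF v, of 0] by simp
  then have "M (index i v X Y) = of_bool (flat 0 v X Y = 0)"
    using T 0 by (simp add: table_ok_def layer0_ok_def index_eq_flat)
  moreover have "flat 0 v X Y = 0 \<longleftrightarrow> v = 0 \<and> X = 0 \<and> Y = 0"
    using P_pos by (auto simp: flat_def)
  ultimately show ?thesis using 0 by (simp add: F_def mask_set_0_iff)
next
  case (Suc j)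
  have "flat j v X Y < q" using flat_less[OF v, of j] i Suc by simp
  then have "int (M (base + layer + flat j v X Y)) = G (flat j v X Y) mod int m"
    using T by (simp add: table_ok_def)
  moreover have "index i v X Y = base + layer + flat j v X Y"
    by (simp add: index_eq_flat flat_def Suc layer_def algebra_simps)
  moreover have "G (flat j v X Y) = F i v X Y"
    unfolding G_def flat_decode[OF v] Suc ..
  ultimately show ?thesis by simp
qed

lemma entry_pos:
  assumes "q < K * layer"
  shows "0 < N" "q div layer < K" "q div (P * P) mod N < N" "q div P mod P < P" "q mod P < P"
  using assms P_pos by (auto simp: less_mult_imp_div_less layer_def intro!: Nat.gr0I mod_less_divisor)

lemma table_step:
  assumes T: "table_ok m q M" and q: "q < K * layer" and m: "0 < m" "m \<le> moduli"
  defines "e \<equiv> entry_val M m (q div layer) (q div (P * P) mod N) (q div P mod P) (q mod P)"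
  shows "table_ok m (Suc q) (M(base + layer + q := e))"
proof -
  note p = entry_pos[OF q]
  \<comment> \<open>An entry reads only the layer directly before its own, and that layer is
    complete at this moment.\<close>
  have "q div layer * layer \<le> q" by simp
  then have G: "int e = G q mod int m"
    unfolding e_def G_def
    by (intro entry_val_mod[OF m(1) p(4,5)] table_read[OF T])
  have "e < m" using m unfolding e_def entry_val_def by simp
  then have "e \<le> Z" using m le_Z(7) by linarith
  moreover have "3 + N + (u * N + v) < base" if "u < N" "v < N" for u v
    using pair_index_less[OF that] by (simp add: base_def)
  moreover have "3 + v < base" if "v < N" for v using that by (simp add: base_def)
  ultimately show ?thesis
    using T G unfolding table_ok_def mem_ok_def layer0_ok_def by (fastforce simp: less_Suc_eq)
qed

lemma total_mod:
  assumes T: "table_ok m (K * layer) M"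
  shows "int ((\<Sum>w<N. M (index K w (P - 1) (P - 1))) mod m) = dp_total (slot_ok E A l) N K mod int m"
proof -
  have P: "P - 1 < P" using P_pos by simp
  have "int ((\<Sum>w<N. M (index K w (P - 1) (P - 1))) mod m) = (\<Sum>w<N. int (M (index K w (P - 1) (P - 1)))) mod int m"
    by (simp add: of_nat_mod)
  also have "\<dots> = (\<Sum>w<N. F K w (P - 1) (P - 1)) mod int m"
    by (rule sum_mod_cong, rule table_read[OF T le_refl _ P P]) simp
  also have "(\<Sum>w<N. F K w (P - 1) (P - 1)) = dp_total (slot_ok E A l) N K"
    unfolding dp_total_def F_def P_def mask_set_full ..
  finally show ?thesis .
qed

end

section \<open>The program\<close>

text \<open>Registers from 20 on hold intermediate results; no assertion depends on them.\<close>

definition assign :: "nat \<Rightarrow> exp \<Rightarrow> program" where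
  "assign x e = comp e 20 ;; [Move x 20]"

definition store :: "exp \<Rightarrow> exp \<Rightarrow> program" where
  "store e1 e2 = comp e1 20 ;; comp e2 21 ;; [Store 20 21]"

definition for_loop :: "nat \<Rightarrow> nat \<Rightarrow> program \<Rightarrow> program" where
  "for_loop x y c = [Const x 0] ;; count_loop x y 20 c"

lemma hoare_assign:
  assumes "x < 20" "\<And>R M. P R M \<Longrightarrow> evals B 20 e R M (v R M) T"
    and "\<And>R M R'. P R M \<Longrightarrow> (\<And>i. i < 20 \<Longrightarrow> R' i = (if i = x then v R M else R i)) \<Longrightarrow> Q R' M"
  shows "hoare B (assign x e) P (T + 1) Q"
proof (rule hoare_pre_bounded)
  fix R M assume PRM: "P R M"
  have "hoare B (comp e 20) (\<lambda>r m. (\<forall>i<20. r i = R i) \<and> m = M) T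
      (\<lambda>r m. (\<forall>i<20. r i = R i) \<and> m = M \<and> r 20 = v R M)"
    using assms(2)[OF PRM] by (simp add: evals_def)
  then have "hoare B (assign x e) (\<lambda>r m. (\<forall>i<20. r i = R i) \<and> m = M) (T + 1) Q"
    unfolding assign_def
  proof (rule hoare_seq)
    show "hoare B [Move x 20] (\<lambda>r m. (\<forall>i<20. r i = R i) \<and> m = M \<and> r 20 = v R M) 1 Q"
    proof (rule hoare_Move)
      fix r m assume "(\<forall>i<20. r i = R i) \<and> m = M \<and> r 20 = v R M"
      then show "Q (r(x := r 20)) m"
        using assms(3)[OF PRM, of "r(x := r 20)"] assms(1) by auto
    qed
  qed
  then show "hoare B (assign x e) (\<lambda>r m. r = R \<and> m = M) (T + 1) Q"
    by (rule hoare_conseq) auto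
qed

lemma hoare_store:
  assumes "\<And>R M. P R M \<Longrightarrow> evals B 20 e1 R M (a R M) T1"
    and "\<And>R M x. P R M \<Longrightarrow> evals B 21 e2 (R(20 := x)) M (v R M) T2"
    and "\<And>R M R'. P R M \<Longrightarrow> (\<And>i. i < 20 \<Longrightarrow> R' i = R i) \<Longrightarrow> Q R' (M(a R M := v R M))"
  shows "hoare B (store e1 e2) P (T1 + (T2 + 1)) Q"
proof (rule hoare_pre_bounded)
  fix R M assume PRM: "P R M"
  have 1: "hoare B (comp e1 20) (\<lambda>r m. (\<forall>i<20. r i = R i) \<and> m = M) T1
      (\<lambda>r m. (\<forall>i<20. r i = R i) \<and> m = M \<and> r 20 = a R M)"
    using assms(1)[OF PRM] by (simp add: evals_def)
  have 2: "hoare B (comp e2 21) (\<lambda>r m. (\<forall>i<20. r i = R i) \<and> m = M \<and> r 20 = a R M) T2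
      (\<lambda>r m. (\<forall>i<20. r i = R i) \<and> m = M \<and> r 20 = a R M \<and> r 21 = v R M)"
    using assms(2)[OF PRM, of "a R M", unfolded evals_def, THEN conjunct2]
  proof (rule hoare_conseq)
    fix r m assume *: "(\<forall>i<21. r i = (R(20 := a R M)) i) \<and> m = M \<and> r 21 = v R M"
    have "r 20 = (R(20 := a R M)) 20" using conjunct1[OF *] by (elim allE[of _ 20]) auto
    then have "r 20 = a R M" by simp
    moreover have "r i = R i" if "i < 20" for i
      using * that by auto
    ultimately show "(\<forall>i<20. r i = R i) \<and> m = M \<and> r 20 = a R M \<and> r 21 = v R M" using * by blast
  next
    fix r m assume *: "(\<forall>i<20. r i = R i) \<and> m = M \<and> r 20 = a R M"
    then have "r i = (R(20 := a R M)) i" if "i < 21" for i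
      using that by (cases "i = 20") auto
    then show "(\<forall>i<21. r i = (R(20 := a R M)) i) \<and> m = M" using * by blast
  qed simp
  have 3: "hoare B [Store 20 21] (\<lambda>r m. (\<forall>i<20. r i = R i) \<and> m = M \<and> r 20 = a R M \<and> r 21 = v R M) 1 Q"
    using assms(3)[OF PRM] by (intro hoare_Store) auto
  have "hoare B (store e1 e2) (\<lambda>r m. (\<forall>i<20. r i = R i) \<and> m = M) (T1 + (T2 + 1)) Q"
    unfolding store_def by (rule hoare_seq[OF 1 hoare_seq[OF 2 3]])
  then show "hoare B (store e1 e2) (\<lambda>r m. r = R \<and> m = M) (T1 + (T2 + 1)) Q"
    by (rule hoare_conseq) auto
qed

text \<open>The frame condition admits exactly those invariants that ignore the counter register and
  all scratch registers from \<open>20\<close> on.\<close>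

lemma hoare_for:
  assumes body: "\<And>i. i < n \<Longrightarrow> hoare B c (\<lambda>r m. I i r m \<and> r x = i \<and> r y = n) T
                                 (\<lambda>r m. I (Suc i) r m \<and> r x = i \<and> r y = n)"
    and frame: "\<And>i r m r'. I i r m \<Longrightarrow> (\<And>j. j < 20 \<Longrightarrow> j \<noteq> x \<Longrightarrow> r' j = r j) \<Longrightarrow> I i r' m"
    and ne: "x < 20" "y < 20" "x \<noteq> y" and B: "1 \<le> B"
  shows "hoare B (for_loop x y c) (\<lambda>r m. I 0 r m \<and> r y = n) (1 + (n * (T + 5) + 2)) (I n)"
  unfolding for_loop_def
proof (rule hoare_seq)
  show "hoare B [Const x 0] (\<lambda>r m. I 0 r m \<and> r y = n) 1 (\<lambda>r m. I 0 r m \<and> r x = 0 \<and> r y = n)"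
  proof (rule hoare_Const)
    fix r m assume *: "I 0 r m \<and> r y = n"
    have "I 0 (r(x := 0)) m" using frame[of 0 r m "r(x := 0)"] * by simp
    then show "I 0 (r(x := 0)) m \<and> (r(x := 0)) x = 0 \<and> (r(x := 0)) y = n" using ne * by simp
  qed simp
  show "hoare B (count_loop x y 20 c) (\<lambda>r m. I 0 r m \<and> r x = 0 \<and> r y = n) (n * (T + 5) + 2) (I n)"
  proof (rule hoare_count_loop[OF body])
    fix i r m a b assume "I i r m"
    then show "I i (r(x := a, 20 := b)) m" by (rule frame) simp
  qed (use ne B in auto)
qed

text \<open>One loop over \<open>q\<close>, whose digits are recovered by division, replaces nested
  loops over position, vertex and the two masks.\<close>

definition entry_prog :: program where
  "entry_prog =
     assign 12 (Bin Mod (Var 7) (Var 3)) ;;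
     assign 13 (Bin Mod (Bin Div (Var 7) (Var 3)) (Var 3)) ;;
     assign 14 (Bin Mod (Bin Div (Var 7) (Bin Times (Var 3) (Var 3))) (Var 1)) ;;
     assign 15 (Bin Div (Var 7) (Var 8)) ;;
     store (Bin Plus (Bin Plus (Var 4) (Var 8)) (Var 7)) entry_exp"

text \<open>The residues for all moduli are added up in register \<open>0\<close>. Being nonnegative
  they cannot cancel, so the sum is positive iff some residue is nonzero, and it stays below
  \<open>Z * Z\<close>.\<close>

definition modulus_prog :: program where
  "modulus_prog =
     assign 11 (Bin Plus (Var 6) (Num 1)) ;;
     for_loop 7 9 entry_prog ;;
     assign 0 (Bin Plus (Var 0) total_exp)"

definition search_prog :: program where
  "search_prog = for_loop 6 10 modulus_prog ;; assign 0 (Bin Minus (Num 1) (Bin Minus (Num 1) (Var 0)))"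

context packing_env begin

definition "entry_time = N * (K * (K * (K * (K * 18 + 92) + 120) + 15) + 100) + 5"

lemma one_le_B: "1 \<le> B" "Suc 0 \<le> B"
  using two_le_Z le_B[of 1] by auto

lemma hoare_entry_prog:
  assumes q: "q < K * layer" and m: "0 < m" "m \<le> moduli"
  shows "hoare B entry_prog
    (\<lambda>R M. (consts_ok R \<and> R 11 = m \<and> R 6 = j \<and> R 0 = s \<and> table_ok m q M) \<and> R 7 = q \<and> R 9 = K * layer)
    (entry_time + 40)
    (\<lambda>R M. (consts_ok R \<and> R 11 = m \<and> R 6 = j \<and> R 0 = s \<and> table_ok m (Suc q) M) \<and> R 7 = q \<and> R 9 = K * layer)"
proof -
  let ?A = "\<lambda>R M. (consts_ok R \<and> R 11 = m \<and> R 6 = j \<and> R 0 = s \<and> table_ok m q M) \<and> R 7 = q \<and> R 9 = K * layer"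
  let ?Y = "q mod P" and ?X = "q div P mod P" and ?w = "q div (P * P) mod N" and ?i = "q div layer"
  note p = entry_pos[OF q]
  have "q \<le> Z" using q le_Z(9) by simp
  moreover have "base + layer + q \<le> Z" using q by (simp add: Z_def)
  moreover have "base + layer \<le> Z" using \<open>base + layer + q \<le> Z\<close> by simp
  ultimately have b: "q \<le> B" "base + layer + q \<le> B" "base + layer \<le> B" "N \<le> B" "P \<le> B" "layer \<le> B" "base \<le> B"
    using le_Z by (auto intro!: le_B)
  have PP: "P * P \<le> B"
    using mult_mono[OF le_Z(3) le_Z(3)] Z_power_le[of 2] by (simp add: power2_eq_square)
  have 1: "hoare B (assign 12 (Bin Mod (Var 7) (Var 3))) ?A (3 + 1) (\<lambda>R M. ?A R M \<and> R 12 = ?Y)"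
  proof (rule hoare_assign)
    fix R M assume A: "?A R M"
    then show "evals B 20 (Bin Mod (Var 7) (Var 3)) R M ?Y 3"
      by - (rule evals_conv, (rule evals_intros | (simp add: consts_ok_def b; fail))+)
  next
    fix R M R' assume "?A R M" "\<And>i. i < 20 \<Longrightarrow> R' i = (if i = 12 then ?Y else R i)"
    then show "?A R' M \<and> R' 12 = ?Y" by (simp add: consts_ok_def)
  qed simp
  have 2: "hoare B (assign 13 (Bin Mod (Bin Div (Var 7) (Var 3)) (Var 3))) (\<lambda>R M. ?A R M \<and> R 12 = ?Y)
      (5 + 1) (\<lambda>R M. ?A R M \<and> R 12 = ?Y \<and> R 13 = ?X)"
  proof (rule hoare_assign)
    fix R M assume A: "?A R M \<and> R 12 = ?Y"
    then show "evals B 20 (Bin Mod (Bin Div (Var 7) (Var 3)) (Var 3)) R M ?X 5"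
      by - (rule evals_conv, (rule evals_intros | (simp add: consts_ok_def b; fail))+)
  next
    fix R M R' assume "?A R M \<and> R 12 = ?Y" "\<And>i. i < 20 \<Longrightarrow> R' i = (if i = 13 then ?X else R i)"
    then show "?A R' M \<and> R' 12 = ?Y \<and> R' 13 = ?X" by (simp add: consts_ok_def)
  qed simp
  have 3: "hoare B (assign 14 (Bin Mod (Bin Div (Var 7) (Bin Times (Var 3) (Var 3))) (Var 1)))
      (\<lambda>R M. ?A R M \<and> R 12 = ?Y \<and> R 13 = ?X) (7 + 1) (\<lambda>R M. ?A R M \<and> R 12 = ?Y \<and> R 13 = ?X \<and> R 14 = ?w)"
  proof (rule hoare_assign)
    fix R M assume A: "?A R M \<and> R 12 = ?Y \<and> R 13 = ?X"
    then show "evals B 20 (Bin Mod (Bin Div (Var 7) (Bin Times (Var 3) (Var 3))) (Var 1)) R M ?w 7"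
      by - (rule evals_conv, (rule evals_intros | (simp add: consts_ok_def b PP; fail))+)
  next
    fix R M R' assume "?A R M \<and> R 12 = ?Y \<and> R 13 = ?X" "\<And>i. i < 20 \<Longrightarrow> R' i = (if i = 14 then ?w else R i)"
    then show "?A R' M \<and> R' 12 = ?Y \<and> R' 13 = ?X \<and> R' 14 = ?w" by (simp add: consts_ok_def)
  qed simp
  have 4: "hoare B (assign 15 (Bin Div (Var 7) (Var 8)))
      (\<lambda>R M. ?A R M \<and> R 12 = ?Y \<and> R 13 = ?X \<and> R 14 = ?w) (3 + 1)
      (\<lambda>R M. ?A R M \<and> R 12 = ?Y \<and> R 13 = ?X \<and> R 14 = ?w \<and> R 15 = ?i)"
  proof (rule hoare_assign)
    fix R M assume A: "?A R M \<and> R 12 = ?Y \<and> R 13 = ?X \<and> R 14 = ?w"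
    then show "evals B 20 (Bin Div (Var 7) (Var 8)) R M ?i 3"
      by - (rule evals_conv, (rule evals_intros | (simp add: consts_ok_def b; fail))+)
  next
    fix R M R' assume "?A R M \<and> R 12 = ?Y \<and> R 13 = ?X \<and> R 14 = ?w"
      "\<And>i. i < 20 \<Longrightarrow> R' i = (if i = 15 then ?i else R i)"
    then show "?A R' M \<and> R' 12 = ?Y \<and> R' 13 = ?X \<and> R' 14 = ?w \<and> R' 15 = ?i" by (simp add: consts_ok_def)
  qed simp
  have 5: "hoare B (store (Bin Plus (Bin Plus (Var 4) (Var 8)) (Var 7)) entry_exp)
      (\<lambda>R M. ?A R M \<and> R 12 = ?Y \<and> R 13 = ?X \<and> R 14 = ?w \<and> R 15 = ?i) (5 + (entry_time + 1))
      (\<lambda>R M. (consts_ok R \<and> R 11 = m \<and> R 6 = j \<and> R 0 = s \<and> table_ok m (Suc q) M) \<and> R 7 = q \<and> R 9 = K * layer)"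
  proof (rule hoare_store)
    fix R M assume A: "?A R M \<and> R 12 = ?Y \<and> R 13 = ?X \<and> R 14 = ?w \<and> R 15 = ?i"
    then show "evals B 20 (Bin Plus (Bin Plus (Var 4) (Var 8)) (Var 7)) R M (base + layer + q) 5"
      by - (rule evals_conv, (rule evals_intros | (simp add: consts_ok_def b; fail))+)
  next
    fix R M x assume A: "?A R M \<and> R 12 = ?Y \<and> R 13 = ?X \<and> R 14 = ?w \<and> R 15 = ?i"
    then have "consts_ok (R(20 := x))" "entry_ok m ?i ?w ?X ?Y (R(20 := x))" "mem_ok M"
      using p m by (auto simp: consts_ok_def entry_ok_def table_ok_def)
    then show "evals B 21 entry_exp (R(20 := x)) M (entry_val M m ?i ?w ?X ?Y) entry_time"
      unfolding entry_time_def by (rule evals_entry)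
  next
    fix R M R' assume A: "?A R M \<and> R 12 = ?Y \<and> R 13 = ?X \<and> R 14 = ?w \<and> R 15 = ?i" "\<And>i. i < 20 \<Longrightarrow> R' i = R i"
    then have "table_ok m (Suc q) (M(base + layer + q := entry_val M m ?i ?w ?X ?Y))"
      by (intro table_step[OF _ q m]) simp
    then show "(consts_ok R' \<and> R' 11 = m \<and> R' 6 = j \<and> R' 0 = s \<and>
        table_ok m (Suc q) (M(base + layer + q := entry_val M m ?i ?w ?X ?Y))) \<and> R' 7 = q \<and> R' 9 = K * layer"
      using A by (simp add: consts_ok_def)
  qed
  show ?thesis
    unfolding entry_prog_def
    by (rule hoare_conseq[OF hoare_seq[OF 1 hoare_seq[OF 2 hoare_seq[OF 3 hoare_seq[OF 4 5]]]]]) simp_all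
qed

definition "modulus_time = K * layer * (entry_time + 45) + N * 40 + 20"

lemma hoare_modulus_prog:
  assumes j: "j < moduli"
  shows "hoare B modulus_prog
    (\<lambda>R M. (consts_ok R \<and> mem_ok M \<and> layer0_ok M \<and> R 0 = s \<and> s \<le> j * Z) \<and> R 6 = j \<and> R 10 = moduli)
    modulus_time
    (\<lambda>R M. (consts_ok R \<and> mem_ok M \<and> layer0_ok M \<and>
        R 0 = s + nat (dp_total (slot_ok E A l) N K mod int (Suc j)) \<and> R 0 \<le> Suc j * Z) \<and> R 6 = j \<and> R 10 = moduli)"
proof -
  let ?m = "Suc j"
  let ?d = "nat (dp_total (slot_ok E A l) N K mod int ?m)"
  have m: "0 < ?m" "?m \<le> moduli" using j by simp_all
  have mB: "Suc j \<le> B" "j \<le> B" using m le_Z(7) by (auto intro!: le_B)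
  have 1: "hoare B (assign 11 (Bin Plus (Var 6) (Num 1)))
      (\<lambda>R M. (consts_ok R \<and> mem_ok M \<and> layer0_ok M \<and> R 0 = s \<and> s \<le> j * Z) \<and> R 6 = j \<and> R 10 = moduli) (3 + 1)
      (\<lambda>R M. (consts_ok R \<and> R 11 = ?m \<and> R 6 = j \<and> R 0 = s \<and> table_ok ?m 0 M) \<and> R 9 = K * layer)"
  proof (rule hoare_assign)
    fix R M assume "(consts_ok R \<and> mem_ok M \<and> layer0_ok M \<and> R 0 = s \<and> s \<le> j * Z) \<and> R 6 = j \<and> R 10 = moduli"
    then show "evals B 20 (Bin Plus (Var 6) (Num 1)) R M ?m 3"
      by - (rule evals_conv, (rule evals_intros | (simp add: one_le_B mB; fail))+)
  next
    fix R M R' assume "(consts_ok R \<and> mem_ok M \<and> layer0_ok M \<and> R 0 = s \<and> s \<le> j * Z) \<and> R 6 = j \<and> R 10 = moduli"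
      "\<And>i. i < 20 \<Longrightarrow> R' i = (if i = 11 then ?m else R i)"
    then show "(consts_ok R' \<and> R' 11 = ?m \<and> R' 6 = j \<and> R' 0 = s \<and> table_ok ?m 0 M) \<and> R' 9 = K * layer"
      by (simp add: consts_ok_def table_ok_def)
  qed simp
  have 2: "hoare B (for_loop 7 9 entry_prog)
      (\<lambda>R M. (consts_ok R \<and> R 11 = ?m \<and> R 6 = j \<and> R 0 = s \<and> table_ok ?m 0 M) \<and> R 9 = K * layer)
      (1 + (K * layer * (entry_time + 40 + 5) + 2))
      (\<lambda>R M. consts_ok R \<and> R 11 = ?m \<and> R 6 = j \<and> R 0 = s \<and> table_ok ?m (K * layer) M)"
  proof (rule hoare_for)
    fix q assume "q < K * layer"
    then show "hoare B entry_prog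
      (\<lambda>R M. (consts_ok R \<and> R 11 = ?m \<and> R 6 = j \<and> R 0 = s \<and> table_ok ?m q M) \<and> R 7 = q \<and> R 9 = K * layer)
      (entry_time + 40)
      (\<lambda>R M. (consts_ok R \<and> R 11 = ?m \<and> R 6 = j \<and> R 0 = s \<and> table_ok ?m (Suc q) M) \<and> R 7 = q \<and> R 9 = K * layer)"
      by (rule hoare_entry_prog[OF _ m])
  next
    fix q r M r' assume "consts_ok r \<and> r 11 = ?m \<and> r 6 = j \<and> r 0 = s \<and> table_ok ?m q M"
      "\<And>j. j < 20 \<Longrightarrow> j \<noteq> 7 \<Longrightarrow> r' j = r j"
    then show "consts_ok r' \<and> r' 11 = ?m \<and> r' 6 = j \<and> r' 0 = s \<and> table_ok ?m q M"
      by (simp add: consts_ok_def)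
  qed (simp_all add: one_le_B)
  have "?d < ?m" by (simp add: nat_less_iff)
  then have dZ: "?d \<le> Z" using m le_Z(7) by linarith
  have 3: "hoare B (assign 0 (Bin Plus (Var 0) total_exp))
      (\<lambda>R M. (consts_ok R \<and> R 11 = ?m \<and> R 6 = j \<and> R 0 = s \<and> table_ok ?m (K * layer) M) \<and> s \<le> j * Z)
      ((1 + (N * 40 + 5) + 1) + 1)
      (\<lambda>R M. (consts_ok R \<and> mem_ok M \<and> layer0_ok M \<and> R 0 = s + ?d \<and> R 0 \<le> Suc j * Z) \<and> R 6 = j \<and> R 10 = moduli)"
  proof (rule hoare_assign[where v = "\<lambda>R M. s + ?d"])
    fix R M assume A: "(consts_ok R \<and> R 11 = ?m \<and> R 6 = j \<and> R 0 = s \<and> table_ok ?m (K * layer) M) \<and> s \<le> j * Z"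
    have "j * Z \<le> Z * Z" using m le_Z(7) by (intro mult_right_mono) auto
    moreover have "Z * Z \<le> Z ^ 3" using power_increasing[of 2 3 Z] two_le_Z by (simp add: power2_eq_square)
    ultimately have "s \<le> Z ^ 3" using A by linarith
    then have sB: "s + ?d \<le> B" by (rule sum_le_B[OF _ le_Z3[OF dZ]])
    then have sB': "s \<le> B" by simp
    have "consts_ok (R(20 := s))" "(R(20 := s)) 11 = ?m" "\<forall>x. M x \<le> Z"
      using A by (auto simp: consts_ok_def table_ok_def mem_ok_def)
    then have "evals B 21 total_exp (R(20 := s)) M ((\<Sum>w<N. M (index K w (P - 1) (P - 1))) mod ?m) (N * 40 + 5)"
      using m by (intro evals_total)
    moreover have "(\<Sum>w<N. M (index K w (P - 1) (P - 1))) mod ?m = ?d"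
      using total_mod[of ?m M] A by (metis nat_int)
    ultimately have "evals B 21 total_exp (R(20 := s)) M ?d (N * 40 + 5)" by simp
    then show "evals B 20 (Bin Plus (Var 0) total_exp) R M (s + ?d) (1 + (N * 40 + 5) + 1)"
      using A sB sB' by (intro evals_conv[OF evals_Plus[OF evals_Var, of 0 20 R B total_exp M ?d "N * 40 + 5"]]) auto
  next
    fix R M R' assume "(consts_ok R \<and> R 11 = ?m \<and> R 6 = j \<and> R 0 = s \<and> table_ok ?m (K * layer) M) \<and> s \<le> j * Z"
      "\<And>i. i < 20 \<Longrightarrow> R' i = (if i = 0 then s + ?d else R i)"
    then show "(consts_ok R' \<and> mem_ok M \<and> layer0_ok M \<and> R' 0 = s + ?d \<and> R' 0 \<le> Suc j * Z) \<and> R' 6 = j \<and> R' 10 = moduli"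
      using dZ by (simp add: consts_ok_def table_ok_def)
  qed simp
  show ?thesis
  \<comment> \<open>The inequality concerns the fixed number \<open>s\<close> and not the state: if
    it fails, no state satisfies the precondition.\<close>
  proof (cases "s \<le> j * Z")
    case True
    have loop: "hoare B (for_loop 7 9 entry_prog)
      (\<lambda>R M. (consts_ok R \<and> R 11 = ?m \<and> R 6 = j \<and> R 0 = s \<and> table_ok ?m 0 M) \<and> R 9 = K * layer)
      (1 + (K * layer * (entry_time + 40 + 5) + 2))
      (\<lambda>R M. (consts_ok R \<and> R 11 = ?m \<and> R 6 = j \<and> R 0 = s \<and> table_ok ?m (K * layer) M) \<and> s \<le> j * Z)"
      by (rule hoare_conseq[OF 2]) (use True in simp_all)
    show ?thesis
      unfolding modulus_prog_def
      by (rule hoare_conseq[OF hoare_seq[OF 1 hoare_seq[OF loop 3]]]) (simp_all add: modulus_time_def algebra_simps)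
  next
    case False
    then show ?thesis by (simp add: hoare_def)
  qed
qed

lemma hoare_search_prog:
  "hoare B search_prog
    (\<lambda>R M. consts_ok R \<and> mem_ok M \<and> layer0_ok M \<and> R 0 = 0)
    (moduli * (modulus_time + 5) + 12)
    (\<lambda>R M. R 0 = of_bool (\<exists>m\<in>{1..moduli}. dp_total (slot_ok E A l) N K mod int m \<noteq> 0))"
proof -
  let ?d = "\<lambda>m. dp_total (slot_ok E A l) N K mod int m"
  define I where "I j R M \<longleftrightarrow> consts_ok R \<and> mem_ok M \<and> layer0_ok M \<and> R 0 \<le> j * Z \<and>
      (0 < R 0 \<longleftrightarrow> (\<exists>m\<in>{1..j}. ?d m \<noteq> 0))" for j and R M :: "nat \<Rightarrow> nat"
  have 1: "hoare B (for_loop 6 10 modulus_prog) (\<lambda>R M. I 0 R M \<and> R 10 = moduli)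
      (1 + (moduli * (modulus_time + 5) + 2)) (I moduli)"
  proof (rule hoare_for)
    fix j assume j: "j < moduli"
    show "hoare B modulus_prog (\<lambda>R M. I j R M \<and> R 6 = j \<and> R 10 = moduli) modulus_time
        (\<lambda>R M. I (Suc j) R M \<and> R 6 = j \<and> R 10 = moduli)"
    proof (rule hoare_pre_bounded)
      fix R M assume IR: "I j R M \<and> R 6 = j \<and> R 10 = moduli"
      have "0 \<le> ?d (Suc j)" by (intro pos_mod_sign) simp
      then have "0 < R 0 + nat (?d (Suc j)) \<longleftrightarrow> 0 < R 0 \<or> ?d (Suc j) \<noteq> 0" by linarith
      also have "\<dots> \<longleftrightarrow> (\<exists>m\<in>insert (Suc j) {1..j}. ?d m \<noteq> 0)"
      proof -
        have "0 < R 0 \<longleftrightarrow> (\<exists>m\<in>{1..j}. ?d m \<noteq> 0)" using IR by (simp only: I_def)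
        then show ?thesis by (simp only: bex_simps disj_commute)
      qed
      also have "insert (Suc j) {1..j} = {1..Suc j}" by auto
      finally have "0 < R 0 + nat (?d (Suc j)) \<longleftrightarrow> (\<exists>m\<in>{1..Suc j}. ?d m \<noteq> 0)" .
      then show "hoare B modulus_prog (\<lambda>r m. r = R \<and> m = M) modulus_time
          (\<lambda>R M. I (Suc j) R M \<and> R 6 = j \<and> R 10 = moduli)"
        using IR by (intro hoare_conseq[OF hoare_modulus_prog[OF j, of "R 0"]]) (simp_all add: I_def)
    qed
  next
    fix j r M r' assume "I j r M" "\<And>j. j < 20 \<Longrightarrow> j \<noteq> 6 \<Longrightarrow> r' j = r j"
    then show "I j r' M" by (simp add: I_def consts_ok_def)
  qed (simp_all add: one_le_B)
  have 2: "hoare B (assign 0 (Bin Minus (Num 1) (Bin Minus (Num 1) (Var 0)))) (I moduli) (5 + 1)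
      (\<lambda>R M. R 0 = of_bool (\<exists>m\<in>{1..moduli}. ?d m \<noteq> 0))"
  proof (rule hoare_assign)
    fix R M assume "I moduli R M"
    then have "R 0 \<le> moduli * Z" by (simp add: I_def)
    also have "\<dots> \<le> Z * Z" using le_Z(7) by (intro mult_right_mono) auto
    also have "\<dots> \<le> B" using Z_power_le[of 2] by (simp add: power2_eq_square)
    finally show "evals B 20 (Bin Minus (Num 1) (Bin Minus (Num 1) (Var 0))) R M (1 - (1 - R 0)) 5"
      by - (rule evals_conv, (rule evals_intros | (simp add: one_le_B; fail))+)
  next
    fix R M R' assume "I moduli R M" "\<And>i. i < 20 \<Longrightarrow> R' i = (if i = 0 then 1 - (1 - R 0) else R i)"
    then show "R' 0 = of_bool (\<exists>m\<in>{1..moduli}. ?d m \<noteq> 0)"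
      by (simp only: I_def) (cases "R 0 = 0", auto)
  qed simp
  show ?thesis
    unfolding search_prog_def
    by (rule hoare_conseq[OF hoare_seq[OF 1 2]]) (simp_all add: I_def consts_ok_def)
qed

end

section \<open>Initialisation of registers and table\<close>

definition holds :: "(nat \<times> nat) list \<Rightarrow> (nat \<Rightarrow> nat) \<Rightarrow> (nat \<Rightarrow> nat) \<Rightarrow> (nat \<Rightarrow> nat) \<Rightarrow> bool" where
  "holds S M0 R M \<longleftrightarrow> M = M0 \<and> (\<forall>p\<in>set S. R (fst p) = snd p)"

lemma hoare_assign_holds:
  assumes "x < 20" "\<forall>p\<in>set S. fst p < 20 \<and> fst p \<noteq> x"
    and "\<And>R. \<forall>p\<in>set S. R (fst p) = snd p \<Longrightarrow> evals B 20 e R M v T"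
  shows "hoare B (assign x e) (holds S M) (T + 1) (holds ((x, v) # S) M)"
proof (rule hoare_assign[where v = "\<lambda>_ _. v"])
  fix R M' assume "holds S M R M'"
  then show "evals B 20 e R M' v T" using assms(3) by (simp add: holds_def)
next
  fix R M' R' assume "holds S M R M'" "\<And>i. i < 20 \<Longrightarrow> R' i = (if i = x then v else R i)"
  then show "holds ((x, v) # S) M R' M'" using assms(1,2) by (simp add: holds_def)
qed (rule assms(1))

definition setup_prog :: program where
  "setup_prog =
     assign 1 (Ld (Num 0)) ;;
     assign 5 (Ld (Num 2)) ;;
     assign 16 (Bin Plus (Var 5) (Num 1)) ;;
     assign 2 (Bin Times (Ld (Num 1)) (Var 16)) ;;
     assign 3 (pow2_exp 20 (Var 2)) ;;
     assign 4 (Bin Plus (Bin Plus (Num 3) (Var 1)) (Bin Times (Var 1) (Var 1))) ;;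
     assign 8 (Bin Times (Bin Times (Var 1) (Var 3)) (Var 3)) ;;
     assign 9 (Bin Times (Var 2) (Var 8)) ;;
     assign 10 (Bin Plus (Bin Times (Bin Times (Bin Times (Num 10) (Var 1)) (Var 2)) (Var 2)) (Num 2)) ;;
     assign 0 (Num 0) ;;
     store (Var 4) (Num 1)"

definition packing_prog :: program where
  "packing_prog = setup_prog ;; search_prog"

context packing_env begin

text \<open>Memory beyond the input is zero at the start, so a single store creates the whole
  initial layer.\<close>

lemma layer_start_ok:
  assumes "mem_ok M" "\<And>a. base \<le> a \<Longrightarrow> M a = 0"
  shows "mem_ok (M(base := 1))" "layer0_ok (M(base := 1))"
proof -
  have "3 + N + (u * N + v) < base" if "u < N" "v < N" for u v
    using pair_index_less[OF that] by (simp add: base_def)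
  moreover have "3 + v < base" if "v < N" for v using that by (simp add: base_def)
  ultimately show "mem_ok (M(base := 1))"
    using assms(1) two_le_Z unfolding mem_ok_def by fastforce
  show "layer0_ok (M(base := 1))"
    using assms(2) by (simp add: layer0_ok_def)
qed

lemma hoare_setup_prog:
  assumes M0: "M 0 = N" "M 1 = k" "M 2 = l" and K: "K = k * Suc l"
    and M: "mem_ok M" "\<And>a. base \<le> a \<Longrightarrow> M a = 0"
  shows "hoare B setup_prog (\<lambda>R m. m = M) (K * 9 + 100)
    (\<lambda>R m. consts_ok R \<and> mem_ok m \<and> layer0_ok m \<and> R 0 = 0)"
proof -
  have "0 < K" using l_less by simp
  then have k: "k \<le> Z" using K le_Z(2) by (cases k) (auto intro: le_trans)
  have "10 * N * K * K \<le> moduli" by (simp add: moduli_def)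
  moreover have "10 * N * K \<le> 10 * N * K * K" "10 * N \<le> 10 * N * K" using \<open>0 < K\<close> by simp_all
  ultimately have c: "10 * N * K * K \<le> Z" "10 * N * K \<le> Z" "10 * N \<le> Z" using le_Z(7) by linarith+
  have "N * P \<le> layer" using P_pos by (simp add: layer_def)
  then have NP: "N * P \<le> Z" using le_Z(8) by linarith
  have "N * N \<le> base" "3 + N \<le> base" by (simp_all add: base_def)
  then have d: "N * N \<le> Z" "3 + N \<le> Z" using le_Z(4) by linarith+
  have "2 \<le> moduli" "10 \<le> B"
    using mult_mono[OF two_le_Z two_le_Z] mult_mono[OF mult_mono[OF two_le_Z two_le_Z] mult_mono[OF two_le_Z two_le_Z]]
    by (simp_all add: moduli_def B_def numeral_eq_Suc)
  have b: "N \<le> B" "k \<le> B" "l \<le> B" "Suc l \<le> B" "K \<le> B" "P \<le> B" "base \<le> B" "layer \<le> B" "K * layer \<le> B"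
      "moduli \<le> B" "10 * N * K * K \<le> B" "10 * N * K \<le> B" "10 * N \<le> B" "N * P \<le> B" "N * N \<le> B" "3 + N \<le> B"
      "2 \<le> B" "Suc 0 \<le> B" "3 \<le> B"
    using k c d NP le_Z two_le_Z by (auto intro!: le_B)
  note eqs = M0 M0[simplified] b b[simplified] \<open>10 \<le> B\<close> b(10)[unfolded moduli_def, simplified]
  let ?S1 = "[(1, N)]" let ?S2 = "(5, l) # ?S1" let ?S3 = "(16, Suc l) # ?S2" let ?S4 = "(2, K) # ?S3"
  let ?S5 = "(3, P) # ?S4" let ?S6 = "(4, base) # ?S5" let ?S7 = "(8, layer) # ?S6"
  let ?S8 = "(9, K * layer) # ?S7" let ?S9 = "(10, moduli) # ?S8" let ?S10 = "(0, 0) # ?S9"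
  have 1: "hoare B (assign 1 (Ld (Num 0))) (holds [] M) (2 + 1) (holds ?S1 M)"
    by (rule hoare_assign_holds, simp, simp, rule evals_conv, (rule evals_intros | (simp add: eqs; fail))+)
  have 2: "hoare B (assign 5 (Ld (Num 2))) (holds ?S1 M) (2 + 1) (holds ?S2 M)"
    by (rule hoare_assign_holds, simp, simp, rule evals_conv, (rule evals_intros | (simp add: eqs; fail))+)
  have 3: "hoare B (assign 16 (Bin Plus (Var 5) (Num 1))) (holds ?S2 M) (3 + 1) (holds ?S3 M)"
    by (rule hoare_assign_holds, simp, simp, rule evals_conv, (rule evals_intros | (simp add: eqs; fail))+)
  have 4: "hoare B (assign 2 (Bin Times (Ld (Num 1)) (Var 16))) (holds ?S3 M) (4 + 1) (holds ?S4 M)"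
    by (rule hoare_assign_holds, simp, simp, rule evals_conv,
      (rule evals_intros | (simp add: eqs K[symmetric] K[simplified, symmetric]; fail))+)
  have 5: "hoare B (assign 3 (pow2_exp 20 (Var 2))) (holds ?S4 M) (K * 9 + 5 + 1) (holds ?S5 M)"
    by (rule hoare_assign_holds, simp, simp, rule evals_conv,
      (rule evals_intros evals_pow2 | (simp add: eqs P_def[symmetric]; fail))+)
  have 6: "hoare B (assign 4 (Bin Plus (Bin Plus (Num 3) (Var 1)) (Bin Times (Var 1) (Var 1)))) (holds ?S5 M)
      (7 + 1) (holds ?S6 M)"
    by (rule hoare_assign_holds, simp, simp, rule evals_conv,
      (rule evals_intros | (simp add: eqs base_def[symmetric]; fail) | (simp add: eqs base_def; fail))+)
  have 7: "hoare B (assign 8 (Bin Times (Bin Times (Var 1) (Var 3)) (Var 3))) (holds ?S6 M)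
      (5 + 1) (holds ?S7 M)"
    by (rule hoare_assign_holds, simp, simp, rule evals_conv,
      (rule evals_intros | (simp add: eqs layer_def[symmetric]; fail))+)
  have 8: "hoare B (assign 9 (Bin Times (Var 2) (Var 8))) (holds ?S7 M) (3 + 1) (holds ?S8 M)"
    by (rule hoare_assign_holds, simp, simp, rule evals_conv, (rule evals_intros | (simp add: eqs; fail))+)
  have 9: "hoare B (assign 10 (Bin Plus (Bin Times (Bin Times (Bin Times (Num 10) (Var 1)) (Var 2)) (Var 2)) (Num 2)))
      (holds ?S8 M) (9 + 1) (holds ?S9 M)"
    by (rule hoare_assign_holds, simp, simp, rule evals_conv,
      (rule evals_intros | (simp add: eqs moduli_def[symmetric]; fail) | (simp add: eqs moduli_def; fail))+)
  have 10: "hoare B (assign 0 (Num 0)) (holds ?S9 M) (1 + 1) (holds ?S10 M)"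
    by (rule hoare_assign_holds, simp, simp, rule evals_conv, (rule evals_intros | (simp add: eqs; fail))+)
  have 11: "hoare B (store (Var 4) (Num 1)) (holds ?S10 M) (1 + (1 + 1))
      (\<lambda>R m. consts_ok R \<and> mem_ok m \<and> layer0_ok m \<and> R 0 = 0)"
  proof (rule hoare_store)
    fix R m assume A: "holds ?S10 M R m"
    then show "evals B 20 (Var 4) R m base 1"
      by - (rule evals_conv, (rule evals_intros | (simp add: holds_def eqs; fail))+)
    show "evals B 21 (Num 1) (R(20 := x)) m 1 1" for x
      by (rule evals_Num) (use eqs in simp)
    show "consts_ok R' \<and> mem_ok (m(base := 1)) \<and> layer0_ok (m(base := 1)) \<and> R' 0 = 0"
      if "\<And>i. i < 20 \<Longrightarrow> R' i = R i" for R'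
      using A that layer_start_ok[OF M] by (simp add: holds_def consts_ok_def)
  qed
  show ?thesis
    unfolding setup_prog_def
    by (rule hoare_conseq[OF hoare_seq[OF 1 hoare_seq[OF 2 hoare_seq[OF 3 hoare_seq[OF 4 hoare_seq[OF 5
      hoare_seq[OF 6 hoare_seq[OF 7 hoare_seq[OF 8 hoare_seq[OF 9 hoare_seq[OF 10 11]]]]]]]]]]])
      (simp_all add: holds_def)
qed

definition "total_time = K * 9 + 100 + (moduli * (modulus_time + 5) + 12)"

lemma hoare_packing_prog:
  assumes "M 0 = N" "M 1 = k" "M 2 = l" "K = k * Suc l" "mem_ok M" "\<And>a. base \<le> a \<Longrightarrow> M a = 0"
  shows "hoare B packing_prog (\<lambda>R m. m = M) total_time
    (\<lambda>R m. R 0 = of_bool (has_path_packing {..<N} E A k l))"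
proof -
  have "(\<exists>m\<in>{1..moduli}. dp_total (slot_ok E A l) N K mod int m \<noteq> 0) \<longleftrightarrow> has_path_packing {..<N} E A k l"
  \<comment> \<open>The criterion by residues needs a vertex. For \<open>N = 0\<close> the total is
    an empty sum, and no walk of positive length \<open>K\<close> exists.\<close>
  proof (cases "N = 0")
    case True
    have "\<not> (\<exists>ws\<in>walks (slot_ok E A l) N K. distinct ws)"
      using walks_lists[of _ "slot_ok E A l" N K] True l_less by fastforce
    then show ?thesis
      using True packing_iff_walk[OF l_pos, of N E A k] assms(4) by (simp add: dp_total_def)
  next
    case False
    then show ?thesis
      using dp_total_mod[of N K "slot_ok E A l"] packing_iff_walk[OF l_pos, of N E A k] l_less
      unfolding moduli_def assms(4)[symmetric] by simp
  qed
  then show ?thesis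
    using hoare_seq[OF hoare_setup_prog[OF assms] hoare_search_prog]
    unfolding packing_prog_def total_time_def by simp
qed

lemma Z_le: "Z \<le> 30 * (N + 1) ^ 2 * P ^ 3"
proof -
  let ?n = "N + 1"
  have K: "K \<le> P" and P: "1 \<le> P" using P_pos by (auto simp: P_def less_imp_le)
  have n: "N \<le> ?n ^ 2" "1 \<le> ?n ^ 2" "N * N \<le> ?n ^ 2" by (simp_all add: power2_eq_square)
  have P3: "1 \<le> P ^ 3" "P \<le> P ^ 3" "P ^ 2 \<le> P ^ 3"
    using P power_increasing[of 1 3 P] power_increasing[of 2 3 P] by auto
  have 1: "1 * 1 \<le> ?n ^ 2 * P ^ 3" using n P3 by (intro mult_mono) auto
  have 2: "N * 1 \<le> ?n ^ 2 * P ^ 3" using n P3 by (intro mult_mono) auto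
  have 3: "N * N * 1 \<le> ?n ^ 2 * P ^ 3" using n P3 by (intro mult_mono) auto
  have 4: "1 * P \<le> ?n ^ 2 * P ^ 3" using n P3 by (intro mult_mono) auto
  have "K * (N * (P * P)) \<le> P * (?n ^ 2 * (P * P))" using K n by (intro mult_mono) auto
  then have 5: "K * (N * (P * P)) \<le> ?n ^ 2 * P ^ 3" by (simp add: power3_eq_cube mult_ac)
  have 6: "N * (P * P) \<le> ?n ^ 2 * P ^ 3" using n P3 by (intro mult_mono) (auto simp: power2_eq_square)
  have "N * (K * K) \<le> ?n ^ 2 * (P * P)" using K n by (intro mult_mono) auto
  also have "\<dots> \<le> ?n ^ 2 * P ^ 3" using P3 by (intro mult_left_mono) (auto simp: power2_eq_square)
  finally have 7: "N * (K * K) \<le> ?n ^ 2 * P ^ 3" .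
  have "Z = 7 + N + N * N + K * (N * (P * P)) + N * (P * P) + 10 * (N * (K * K)) + P + K"
    by (simp add: Z_def base_def layer_def moduli_def algebra_simps)
  then show ?thesis using 1 2 3 4 5 6 7 K by linarith
qed

text \<open>With \<open>K \<le> P\<close> the exponent of \<open>P\<close> is \<open>4\<close> for
  an entry, plus \<open>3\<close> for the number of entries \<open>K * layer\<close>, plus
  \<open>2\<close> for the moduli. Entry, table and moduli contribute one factor
  \<open>N + 1\<close> each.\<close>

lemma total_time_le: "total_time \<le> 6000 * (N + 1) ^ 3 * P ^ 9"
proof -
  let ?n = "N + 1"
  have K: "K \<le> P" and P: "1 \<le> P" using P_pos by (auto simp: P_def less_imp_le)
  have P7: "P ^ 7 = P * P * P * P ^ 4" and P9: "P ^ 9 = P * P * P ^ 7"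
    by (simp_all add: numeral_eq_Suc)
  have "K * (K * (K * (K * 18 + 92) + 120) + 15) + 100 \<le> P * (P * (P * (P * 18 + 92 * P) + 120 * P ^ 2) + 15 * P ^ 3) + 100 * P ^ 4"
    using K P by (intro add_mono mult_mono) (auto simp: one_le_power)
  also have "\<dots> = 345 * P ^ 4" by (simp add: algebra_simps numeral_eq_Suc)
  finally have "entry_time \<le> N * (345 * P ^ 4) + 5 * 1"
    unfolding entry_time_def by (intro add_mono mult_left_mono) auto
  also have "5 * 1 \<le> 5 * P ^ 4" using P by (intro mult_left_mono) (auto simp: one_le_power)
  finally have e: "entry_time \<le> N * (345 * P ^ 4) + 5 * P ^ 4" by simp
  have e45: "entry_time + 45 \<le> 395 * (?n * P ^ 4)"
  proof -
    have "45 * 1 \<le> 45 * P ^ 4" using P by (intro mult_left_mono) (auto simp: one_le_power)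
    then show ?thesis using e by (simp add: algebra_simps)
  qed
  have "K * layer * (entry_time + 45) \<le> (P * (?n * P * P)) * (395 * (?n * P ^ 4))"
    unfolding layer_def using K e45 by (intro mult_mono) auto
  also have "\<dots> = 395 * (?n ^ 2 * P ^ 7)" unfolding P7 power2_eq_square by (simp only: mult_ac)
  finally have 1: "K * layer * (entry_time + 45) \<le> 395 * (?n ^ 2 * P ^ 7)" .
  have "1 * 1 \<le> ?n * P ^ 7" "1 * 1 \<le> ?n ^ 2 * P ^ 7" "N * 1 \<le> ?n ^ 2 * P ^ 7"
    using P by (intro mult_mono; auto simp: one_le_power power2_eq_square)+
  then have m: "modulus_time + 5 \<le> 460 * (?n ^ 2 * P ^ 7)"
    using 1 unfolding modulus_time_def by linarith
  have "N * (K * K) \<le> ?n * (P * P)" using K by (intro mult_mono) auto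
  moreover have "1 * 1 \<le> ?n * (P * P)" using P by (intro mult_mono) auto
  ultimately have "moduli \<le> 12 * (?n * (P * P))" unfolding moduli_def by (simp add: mult.assoc)
  then have "moduli * (modulus_time + 5) \<le> (12 * (?n * (P * P))) * (460 * (?n ^ 2 * P ^ 7))"
    using m by (intro mult_mono) auto
  also have "\<dots> = 5520 * ((?n * (P * P)) * (?n ^ 2 * P ^ 7))"
  proof -
    have "(12 * a) * (460 * b) = 5520 * (a * b)" for a b :: nat by simp
    then show ?thesis .
  qed
  also have "(?n * (P * P)) * (?n ^ 2 * P ^ 7) = ?n ^ 3 * P ^ 9"
    unfolding P9 power2_eq_square power3_eq_cube by (simp only: mult_ac)
  finally have 2: "moduli * (modulus_time + 5) \<le> 5520 * (?n ^ 3 * P ^ 9)" .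
  have "P \<le> P ^ 9" using P power_increasing[of 1 9 P] by simp
  then have "1 * P \<le> ?n ^ 3 * P ^ 9" by (intro mult_mono) auto
  then have "K * 9 + 112 \<le> 121 * (?n ^ 3 * P ^ 9)" using K P by linarith
  then show ?thesis using 2 unfolding total_time_def by (simp add: mult.assoc)
qed

end


section \<open>Encoding and running time\<close>

text \<open>A whole program ends at address \<open>length p\<close>, where it is halted and its
  configuration no longer changes. Result and word bound thus persist up to any later time.\<close>

lemma hoare_run:
  assumes h: "hoare B p P T Q" and P: "P (reg (init_config xs)) (mem (init_config xs))"
    and B: "words_bounded B (init_config xs)" and T: "T \<le> T'"
  shows "halted p (run p xs T')" "Q (reg (run p xs T')) (mem (run p xs T'))"
    "words_bounded B (run p xs s)"
proof -
  have "pc (init_config xs) = 0" by (simp add: init_config_def)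
  then obtain t c where t: "t \<le> T" "reach B p t (init_config xs) c" "pc c = 0 + length p" "Q (reg c) (mem c)"
    using hoareD[OF h placed_self _ B P] by metis
  have halt: "halted p c" using t(3) by (simp add: halted_def)
  have stay: "(step p ^^ s) c = c" for s
    by (induction s) (simp_all add: step_def halt)
  have late: "run p xs s = c" if "t \<le> s" for s
  proof -
    have "s = (s - t) + t" using that by simp
    then have "run p xs s = (step p ^^ (s - t)) ((step p ^^ t) (init_config xs))"
      unfolding run_def by (metis comp_apply funpow_add)
    then show ?thesis using t(2) stay by (simp add: reach_def)
  qed
  then have "run p xs T' = c" using t(1) T by simp
  then show "halted p (run p xs T')" "Q (reg (run p xs T')) (mem (run p xs T'))"
    using halt t(4) by simp_all
  show "words_bounded B (run p xs s)"
  proof (cases "t \<le> s")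
    case True
    then show ?thesis using late reach_bounded[OF t(2)] by simp
  next
    case False
    then show ?thesis using t(2) by (simp add: reach_def run_def)
  qed
qed

lemma words_bounded_mono: "words_bounded B c \<Longrightarrow> B \<le> B' \<Longrightarrow> words_bounded B' c"
  unfolding words_bounded_def by (meson le_trans)

lemma words_bounded_init:
  assumes "length xs \<le> B" "\<forall>x\<in>set xs. x \<le> B"
  shows "words_bounded B (init_config xs)"
  using assms by (simp add: words_bounded_def init_config_def)

text \<open>Fixed-parameter tractability asks for a bound computable on the same machine. The square
  in the exponent arises because the parameter is \<open>k + l\<close>, while the running time
  involves \<open>k * l\<close>.\<close>

lemma computable_exp_square: "computable (\<lambda>x. C * 2 ^ (c * (x * x)))"
proof -
  let ?e = "Bin Times (Num C) (pow2_exp 21 (Bin Times (Num c) (Bin Times (Ld (Num 0)) (Ld (Num 0)))))"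
  let ?f = "\<lambda>x. C * 2 ^ (c * (x * x))"
  \<comment> \<open>Any upper bound on the time is admissible. This one is padded with the values
    that the computation produces, so that words are bounded already with exponent
    \<open>1\<close>.\<close>
  define T where "T x = c * (x * x) * 9 + 20 + (C + 1) * 2 ^ (c * (x * x)) + c + x * x" for x
  have "halted (assign 0 ?e) (run (assign 0 ?e) [x] (T x)) \<and> reg (run (assign 0 ?e) [x] (T x)) 0 = ?f x \<and>
      words_bounded (2 + T x + length [x] + sum_list [x]) (run (assign 0 ?e) [x] s)" for x s
  proof -
    let ?B = "2 + T x + length [x] + sum_list [x]"
    let ?M = "mem (init_config [x])"
    have M: "?M 0 = x" by (simp add: init_config_def)
    have "(C + 1) * 2 ^ (c * (x * x)) = ?f x + 2 ^ (c * (x * x))" by simp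
    then have le: "?f x \<le> ?B" "2 ^ (c * (x * x)) \<le> ?B" "c * (x * x) \<le> ?B" "x * x \<le> ?B" "x \<le> ?B" "c \<le> ?B"
        "2 \<le> ?B"
      unfolding T_def by simp_all
    have "C * 1 \<le> ?f x" by (intro mult_left_mono) auto
    then have C: "C \<le> ?B" using le(1) by linarith
    note le' = le C
    obtain B where B: "B = ?B" by simp
    have h: "hoare B (assign 0 ?e) (\<lambda>r m. m = ?M) ((c * (x * x) * 9 + 15) + 1) (\<lambda>r m. r 0 = ?f x)"
    proof (rule hoare_assign[where v = "\<lambda>_ _. ?f x"])
      fix R M assume "M = ?M"
      then have "M 0 = x" using M by simp
      then show "evals B 20 ?e R M (?f x) (c * (x * x) * 9 + 15)"
        using le'[folded B]
        by - (rule evals_conv, (rule evals_intros evals_pow2 | (simp; fail))+)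
    qed simp_all
    have init: "words_bounded B (init_config [x])"
      by (rule words_bounded_init) (use le in \<open>auto simp: B\<close>)
    have "(c * (x * x) * 9 + 15) + 1 \<le> T x" unfolding T_def by simp
    note r = hoare_run[OF h refl init this]
    show ?thesis using r(1,2) r(3)[of s] unfolding B by blast
  qed
  then have "computes_in_time (assign 0 ?e) UNIV (\<lambda>x. [x]) ?f T"
    unfolding computes_in_time_def Let_def by (intro exI[of _ 1]) simp
  then show ?thesis unfolding computable_def by blast
qed

section \<open>The encoding of instances and the final estimates\<close>

lemma nth_concat_uniform:
  "\<forall>u<n. length (f u) = m \<Longrightarrow> length (concat (map f [0..<n])) = n * m \<and>
     (\<forall>u<n. \<forall>v<m. concat (map f [0..<n]) ! (u * m + v) = f u ! v)"
proof (induction n)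
  case (Suc n)
  then have IH: "length (concat (map f [0..<n])) = n * m"
      "\<And>u v. u < n \<Longrightarrow> v < m \<Longrightarrow> concat (map f [0..<n]) ! (u * m + v) = f u ! v" by auto
  note less = pair_index_less[of _ n _ m]
  have eq: "concat (map f [0..<Suc n]) = concat (map f [0..<n]) @ f n" by simp
  show ?case
    unfolding eq using IH less Suc.prems by (auto simp: nth_append less_Suc_eq)
qed simp

lemma encode_packing_nth:
  defines "enc \<equiv> encode_packing"
  shows "length (enc x) = 3 + order x + order x * order x"
    and "enc x ! 0 = order x" "enc x ! 1 = num_paths x" "enc x ! 2 = len x"
    and "v < order x \<Longrightarrow> enc x ! (3 + v) = of_bool (v \<in> terminals x)"
    and "u < order x \<Longrightarrow> v < order x \<Longrightarrow> enc x ! (3 + order x + (u * order x + v)) = of_bool ({u, v} \<in> edges x)"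
    and "set (enc x) \<subseteq> {order x, num_paths x, len x, 0, 1}"
proof -
  let ?n = "order x"
  let ?f = "\<lambda>u. map (\<lambda>v. of_bool ({u, v} \<in> edges x)) [0..<?n] :: nat list"
  let ?a = "map (\<lambda>v. of_bool (v \<in> terminals x)) [0..<?n] :: nat list"
  have enc: "enc x = [?n, num_paths x, len x] @ ?a @ concat (map ?f [0..<?n])"
    by (simp add: enc_def encode_packing_def)
  have rows: "length (concat (map ?f [0..<?n])) = ?n * ?n"
    "\<And>u v. u < ?n \<Longrightarrow> v < ?n \<Longrightarrow> concat (map ?f [0..<?n]) ! (u * ?n + v) = of_bool ({u, v} \<in> edges x)"
    using nth_concat_uniform[of ?n ?f ?n] by auto
  show "length (enc x) = 3 + ?n + ?n * ?n" unfolding enc using rows(1) by simp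
  show "enc x ! 0 = ?n" "enc x ! 1 = num_paths x" "enc x ! 2 = len x" unfolding enc by simp_all
  show "enc x ! (3 + v) = of_bool (v \<in> terminals x)" if "v < ?n"
    unfolding enc using that by (simp add: nth_append)
  show "enc x ! (3 + ?n + (u * ?n + v)) = of_bool ({u, v} \<in> edges x)" if "u < ?n" "v < ?n"
    unfolding enc using rows(2)[OF that] by (simp add: nth_append)
  show "set (enc x) \<subseteq> {?n, num_paths x, len x, 0, 1}"
    unfolding enc by auto
qed

definition packing_time :: "packing_instance \<Rightarrow> nat" where
  "packing_time x = 6000 * (order x + 1) ^ 3 * 2 ^ (9 * (num_paths x * Suc (len x)))"

lemma decides_packing: "decides_in_time packing_prog packing_instances encode_packing packing_yes packing_time"
  unfolding decides_in_time_def computes_in_time_def Let_def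
proof (intro exI[of _ 4] ballI)
  fix x assume x: "x \<in> packing_instances"
  define N k l K where "N = order x" and "k = num_paths x" and "l = len x" and "K = k * Suc l"
  have pos: "0 < k" "0 < l" using x by (auto simp: packing_instances_def k_def l_def)
  have "1 * Suc l \<le> k * Suc l" using pos by (intro mult_right_mono) auto
  then have "l < K" by (simp add: K_def)
  then interpret packing_env N K l "edges x" "terminals x"
    using pos by unfold_locales auto
  let ?xs = "encode_packing x"
  let ?M = "mem (init_config ?xs)"
  note enc = encode_packing_nth[where x = x, folded N_def k_def l_def]
  have M: "?M a = (if a < base then ?xs ! a else 0)" for a
    by (simp add: init_config_def enc(1) base_def)
  have "k \<le> K" using pos by (simp add: K_def)
  then have kZ: "k \<le> Z" using le_Z(2) by simp
  have xs_le: "\<forall>y\<in>set ?xs. y \<le> Z"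
    using enc(7) kZ le_Z two_le_Z by fastforce
  have "?M a \<le> Z" for a
  proof (cases "a < base")
    case True
    then have "?xs ! a \<in> set ?xs" by (intro nth_mem) (simp add: enc(1) base_def)
    then show ?thesis using True M xs_le by simp
  qed (simp add: M)
  moreover have "3 + v < base" if "v < N" for v using that by (simp add: base_def)
  moreover have "3 + N + (u * N + v) < base" if "u < N" "v < N" for u v
    using pair_index_less[OF that] by (simp add: base_def)
  ultimately have mem: "mem_ok ?M"
    unfolding mem_ok_def using enc(5,6) by (simp add: M)
  have M0: "?M 0 = N" "?M 1 = k" "?M 2 = l"
    using enc(2-4) by (simp_all add: M base_def)
  note h = hoare_packing_prog[OF M0 K_def mem]
  have h: "hoare B packing_prog (\<lambda>R m. m = ?M) total_time
      (\<lambda>R m. R 0 = of_bool (has_path_packing {..<N} (edges x) (terminals x) k l))"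
    by (rule h) (simp add: M)
  have init: "words_bounded B (init_config ?xs)"
  proof (rule words_bounded_init)
    show "length ?xs \<le> B" using le_Z(4) by (intro le_B) (simp add: enc(1) base_def)
    show "\<forall>y\<in>set ?xs. y \<le> B" using xs_le le_B by blast
  qed
  have P9: "2 ^ (9 * K) = P ^ 9" by (simp add: P_def mult.commute flip: power_mult)
  have time: "total_time \<le> packing_time x"
    using total_time_le P9 unfolding packing_time_def N_def[symmetric] k_def[symmetric] l_def[symmetric]
      K_def[symmetric] by simp
  \<comment> \<open>Links word length to running time: all words are at most
    \<open>B = Z ^ 4\<close>, which explains the witness \<open>4\<close> for the exponent.\<close>
  have "Z \<le> packing_time x"
  proof -
    have "Z \<le> 30 * (N + 1) ^ 2 * P ^ 3" by (rule Z_le)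
    also have "\<dots> \<le> 6000 * (N + 1) ^ 3 * P ^ 9"
      using P_pos by (intro mult_mono power_increasing) auto
    finally show ?thesis
      unfolding packing_time_def N_def[symmetric] k_def[symmetric] l_def[symmetric] K_def[symmetric] P9 .
  qed
  then have bound: "B \<le> (2 + packing_time x + length ?xs + sum_list ?xs) ^ 4"
    unfolding B_def by (intro power_mono) auto
  note run = hoare_run[OF h refl init time]
  have "packing_yes x \<longleftrightarrow> has_path_packing {..<N} (edges x) (terminals x) k l"
    by (simp add: packing_yes_def N_def k_def l_def)
  then show "halted packing_prog (run packing_prog ?xs (packing_time x)) \<and>
      reg (run packing_prog ?xs (packing_time x)) 0 = of_bool (packing_yes x) \<and>
      (\<forall>s\<le>packing_time x. words_bounded ((2 + packing_time x + length ?xs + sum_list ?xs) ^ 4) (run packing_prog ?xs s))"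
    using run(1,2) words_bounded_mono[OF run(3) bound] by simp
qed

text \<open>Since \<open>len x\<close> is positive, \<open>k * (l + 1) \<le> 2 * k * l\<close>,
  which doubles the \<open>9\<close> in the exponent.\<close>

lemma packing_time_le:
  assumes "x \<in> packing_instances"
  shows "packing_time x \<le> 6000 * (order x + 1) ^ 3 * 2 ^ (18 * (num_paths x * len x))"
proof -
  have "num_paths x * 1 \<le> num_paths x * len x"
    using assms by (intro mult_left_mono) (auto simp: packing_instances_def)
  then show ?thesis unfolding packing_time_def by (intro mult_left_mono power_increasing) auto
qed

text \<open>The constant is \<open>6000 * 8 * 2\<close>: \<open>8\<close> from
  \<open>n + 1 \<le> 2 * n\<close> cubed, \<open>2\<close> from \<open>1 \<le> 2 * ln n\<close>. The
  latter is where \<open>2 \<le> n\<close> enters, as the logarithm vanishes at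
  \<open>1\<close>.\<close>

lemma packing_time_real:
  assumes x: "x \<in> packing_instances" and n: "2 \<le> order x"
  shows "real (packing_time x) \<le> 96000 * 2 powr (18 * real (num_paths x * len x)) * real (order x) ^ 6 * ln (real (order x))"
proof -
  let ?n = "real (order x)" and ?p = "(2::real) powr (18 * real (num_paths x * len x))"
  have n2: "2 \<le> ?n" using n by simp
  have p: "?p = 2 ^ (18 * (num_paths x * len x))"
    by (simp add: powr_realpow[symmetric])
  have "real (packing_time x) \<le> real (6000 * (order x + 1) ^ 3 * 2 ^ (18 * (num_paths x * len x)))"
    using packing_time_le[OF x] by (simp only: of_nat_le_iff)
  also have "\<dots> = 6000 * (?n + 1) ^ 3 * ?p" unfolding p by (simp add: add.commute)
  also have "\<dots> \<le> 6000 * (8 * ?n ^ 6) * ?p"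
  proof (intro mult_right_mono mult_left_mono)
    have "(?n + 1) ^ 3 \<le> (2 * ?n) ^ 3" using n2 by (intro power_mono) auto
    also have "\<dots> = 8 * ?n ^ 3" by (simp add: power_mult_distrib)
    also have "\<dots> \<le> 8 * ?n ^ 6" using n2 by (intro mult_left_mono power_increasing) auto
    finally show "(?n + 1) ^ 3 \<le> 8 * ?n ^ 6" .
  qed auto
  also have "\<dots> = 48000 * ?p * ?n ^ 6 * 1" by simp
  also have "\<dots> \<le> 48000 * ?p * ?n ^ 6 * (2 * ln ?n)"
  proof (rule mult_left_mono)
    have "ln 2 \<le> ln ?n" using n2 by (subst ln_le_cancel_iff) auto
    moreover have "1 / 2 \<le> ln (2::real)"
      using ln_le_minus_one[of "1 / 2 :: real"] by (simp add: ln_div)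
    ultimately show "1 \<le> 2 * ln ?n" by linarith
  qed (use n2 in auto)
  finally show ?thesis by (simp add: mult_ac)
qed

lemma length_le_bit_size: "length xs \<le> bit_size xs"
  unfolding bit_size_def by (induction xs) auto

text \<open>Every number in the encoding occupies at least one bit, so the adjacency matrix and its
  header alone make the input larger than the order of the graph.\<close>

lemma packing_time_fpt:
  assumes "x \<in> packing_instances"
  defines "\<kappa> \<equiv> num_paths x + len x"
  shows "packing_time x \<le> 6000 * 2 ^ (18 * (\<kappa> * \<kappa>)) * bit_size (encode_packing x) ^ 3"
proof -
  have "num_paths x * len x \<le> \<kappa> * \<kappa>" unfolding \<kappa>_def by (intro mult_mono) auto
  then have p: "(2::nat) ^ (18 * (num_paths x * len x)) \<le> 2 ^ (18 * (\<kappa> * \<kappa>))"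
    by (intro power_increasing) auto
  have "order x + 1 \<le> bit_size (encode_packing x)"
    using length_le_bit_size[of "encode_packing x"] unfolding encode_packing_nth(1) by linarith
  then have n: "(order x + 1) ^ 3 \<le> bit_size (encode_packing x) ^ 3" by (rule power_mono) simp
  have "packing_time x \<le> 6000 * (order x + 1) ^ 3 * 2 ^ (18 * (num_paths x * len x))"
    by (rule packing_time_le[OF assms(1)])
  also have "\<dots> \<le> 6000 * bit_size (encode_packing x) ^ 3 * 2 ^ (18 * (\<kappa> * \<kappa>))"
    using n p by (intro mult_mono) auto
  finally show ?thesis by (simp add: mult_ac)
qed

theorem theorem2:
  "(\<exists>P T. decides_in_time P packing_instances encode_packing packing_yes T \<and>
      (\<exists>(C::real) (c::real). \<forall>x\<in>packing_instances. 2 \<le> order x \<longrightarrow>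
         real (T x) \<le> C * 2 powr (c * real (num_paths x * len x)) *
                       real (order x) ^ 6 * ln (real (order x))))
   \<and> fixed_parameter_tractable packing_instances encode_packing packing_yes
       (\<lambda>x. num_paths x + len x)"
proof
  show "\<exists>P T. decides_in_time P packing_instances encode_packing packing_yes T \<and>
      (\<exists>(C::real) (c::real). \<forall>x\<in>packing_instances. 2 \<le> order x \<longrightarrow>
         real (T x) \<le> C * 2 powr (c * real (num_paths x * len x)) *
                       real (order x) ^ 6 * ln (real (order x)))"
    using decides_packing packing_time_real by blast
  have "computable (\<lambda>\<kappa>. 6000 * 2 ^ (18 * (\<kappa> * \<kappa>)))" by (rule computable_exp_square)
  then show "fixed_parameter_tractable packing_instances encode_packing packing_yes
       (\<lambda>x. num_paths x + len x)"
    unfolding fixed_parameter_tractable_def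
    using decides_packing packing_time_fpt by blast
qed

end
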